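(* Let $\mathcal{E}$ be a Dirichlet form in $L^2=L^2(X,m)$. For each $\beta,t>0$ let $Y_{\mathrm{cons}}^{(\beta)},Y_{\mathrm{diss}}^{(\beta)}$ be the conservative and dissipative spaces of the Deny–Yosida approximation $\mathcal{E}^{(\beta)}$, and $X_{\mathrm{cons}}^{(t)},X_{\mathrm{diss}}^{(t)}$ the conservative and dissipative spaces of the time-dependent approximation $\mathcal{E}^{(t)}$. Let $X_{\mathrm{cons}},X_{\mathrm{diss}}$ be those of $\mathcal{E}$. Then (up to $m$-null sets): (a) For every $\beta,t>0$ it holds $X_{\mathrm{cons}}=X_{\mathrm{cons}}^{(t)}=Y_{\mathrm{cons}}^{(\beta)}$, and hence $X_{\mathrm{diss}}=X_{\mathrm{diss}}^{(t)}=Y_{\mathrm{diss}}^{(\beta)}$. (b) $\mathcal{E}$ is conservative if and only if $\mathcal{E}^{(t)}$ is conservative for some and hence every $t>0$, equivalently, $\mathcal{E}^{(\beta)}$ is conservative for some and hence every $\beta>0$. Analogously, $\mathcal{E}$ is dissipative if and only if $\mathcal{E}^{(t)}$ is dissipative for some and hence every $t>0$, equivalently, $\mathcal{E}^{(\beta)}$ is dissipative for some and hence every $\beta>0$.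
   Context: $X$ is a Hausdorff topological space and $m$ is a positive $\sigma$-finite Radon measure on a $\sigma$-algebra $\mathcal{A}$ of subsets of $X$, with full support $X$; $L^p=L^p(X,m)$. All equalities and inequalities of functions and sets are understood $m$-a.e. $(\cdot,\cdot)$ is the scalar product of $L^2$. A Dirichlet form $\mathcal{E}$ with domain $\mathcal{D}\subset L^2$ is a (symmetric, nonnegative) densely defined closed quadratic form such that $u\in\mathcal{D}$ implies $u_{0,1}:=\min(\max(u,0),1)\in\mathcal{D}$ and $\mathcal{E}[u_{0,1}]\le\mathcal{E}[u]$. With $L$ the nonnegative selfadjoint operator of $\mathcal{E}$, its semigroup is $T_t=e^{-tL}$ and its resolvent is $K_\beta=(L+\beta)^{-1}$. The semigroup extends to $L^\infty$: choose $\varphi_k\in L^1\cap L^\infty$ with $0<\varphi_k\le1$, $\varphi_k\uparrow1$; for $0\le u\in L^\infty$ put $T_tu=\lim_kT_t(u\varphi_k)$, and $T_tu=T_tu^+-T_tu^-$ in general. Time-dependent approximation: for $t>0$, $\mathrm{dom}(\mathcal{E}^{(t)})=L^2$, $\mathcal{E}^{(t)}[u]=\frac1t(u-T_tu,u)$. Deny–Yosida approximation: for $\beta>0$, $\mathrm{dom}(\mathcal{E}^{(\beta)})=L^2$, $\mathcal{E}^{(\beta)}[u]=\beta(u-\beta K_\beta u,u)$. Both are bounded Dirichlet forms in $L^2$. For any Dirichlet form with semigroup $(P_s)_{s>0}$ (extended to $L^\infty$ in the same way): its conservative space is $\bigcap_{s>0}\{P_s1=1\}=\bigcap_{k\in\mathbb{N},k\ge1}\{P_k1=1\}$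 (understood up to $m$-null sets via the countable expression) and its dissipative space is the complement of the conservative space. The form is conservative if $P_s1=1$ for some (equivalently every) $s>0$, and dissipative if $m(\{P_s1<1\})>0$ for some $s>0$. *)

theory Defs
  imports "HOL-Analysis.Analysis"
begin

section \<open>The underlying measure space\<close>

text \<open>The \<sigma>-algebra \<open>sets M\<close> may be strictly larger than the Borel \<sigma>-algebra (for instance its
  completion). Radon means: defined on the open sets, locally finite, and inner regular with
  respect to the compact sets.\<close>

definition radon_measure :: "'a::t2_space measure \<Rightarrow> bool" where
  "radon_measure M \<longleftrightarrow>
     space M = UNIV \<and> sets borel \<subseteq> sets M \<and>
     (\<forall>x. \<exists>U. open U \<and> x \<in> U \<and> emeasure M U < \<infinity>) \<and>
     (\<forall>A\<in>sets M. emeasure M A = (SUP K\<in>{K. compact K \<and> K \<subseteq> A}. emeasure M K))"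

definition full_support :: "'a::topological_space measure \<Rightarrow> bool" where
  "full_support M \<longleftrightarrow> (\<forall>U. open U \<and> U \<noteq> {} \<longrightarrow> emeasure M U > 0)"

definition ae_eq_set :: "'a measure \<Rightarrow> 'a set \<Rightarrow> 'a set \<Rightarrow> bool" where
  "ae_eq_set M A B \<longleftrightarrow> (AE x in M. x \<in> A \<longleftrightarrow> x \<in> B)"


section \<open>Real $L^2$\<close>

text \<open>Elements of $L^2$ are represented by square-integrable functions; no quotient is formed.
  Equality in $L^2$ is equality almost everywhere.\<close>

definition L2 :: "'a measure \<Rightarrow> ('a \<Rightarrow> real) set" where
  "L2 M = {u \<in> borel_measurable M. integrable M (\<lambda>x. (u x)\<^sup>2)}"

definition L2_inner :: "'a measure \<Rightarrow> ('a \<Rightarrow> real) \<Rightarrow> ('a \<Rightarrow> real) \<Rightarrow> real" where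
  "L2_inner M u v = (LINT x|M. u x * v x)"

definition L2_norm :: "'a measure \<Rightarrow> ('a \<Rightarrow> real) \<Rightarrow> real" where
  "L2_norm M u = sqrt (L2_inner M u u)"

text \<open>Compatibility with equality almost everywhere follows from linearity and boundedness.\<close>

definition L2_bounded_operator :: "'a measure \<Rightarrow> (('a \<Rightarrow> real) \<Rightarrow> ('a \<Rightarrow> real)) \<Rightarrow> bool" where
  "L2_bounded_operator M A \<longleftrightarrow>
     (\<forall>u\<in>L2 M. A u \<in> L2 M) \<and>
     (\<forall>u\<in>L2 M. \<forall>v\<in>L2 M. AE x in M. A (\<lambda>y. u y + v y) x = A u x + A v x) \<and>
     (\<forall>c. \<forall>u\<in>L2 M. AE x in M. A (\<lambda>y. c * u y) x = c * A u x) \<and>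
     (\<exists>C. \<forall>u\<in>L2 M. L2_norm M (A u) \<le> C * L2_norm M u)"


section \<open>Dirichlet forms\<close>

record 'a qform =
  form_dom :: "('a \<Rightarrow> real) set"
  energy :: "('a \<Rightarrow> real) \<Rightarrow> real"

definition polar :: "'a qform \<Rightarrow> ('a \<Rightarrow> real) \<Rightarrow> ('a \<Rightarrow> real) \<Rightarrow> real" where
  "polar E u v = (energy E (\<lambda>x. u x + v x) - energy E (\<lambda>x. u x - v x)) / 4"

text \<open>The second and the third conjunct say that domain and energy are well defined on $L^2$,
  i.e. on functions modulo equality almost everywhere. The polarization is symmetric as soon
  as the energy is even, which follows from its homogeneity.\<close>

definition quadratic_form :: "'a measure \<Rightarrow> 'a qform \<Rightarrow> bool" where
  "quadratic_form M E \<longleftrightarrow>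
     form_dom E \<subseteq> L2 M \<and>
     (\<forall>u\<in>form_dom E. \<forall>v\<in>L2 M. (AE x in M. u x = v x) \<longrightarrow> v \<in> form_dom E) \<and>
     (\<forall>u\<in>form_dom E. \<forall>v\<in>form_dom E. (AE x in M. u x = v x) \<longrightarrow> energy E u = energy E v) \<and>
     (\<lambda>x. 0) \<in> form_dom E \<and>
     (\<forall>u\<in>form_dom E. \<forall>v\<in>form_dom E. (\<lambda>x. u x + v x) \<in> form_dom E) \<and>
     (\<forall>c. \<forall>u\<in>form_dom E. (\<lambda>x. c * u x) \<in> form_dom E) \<and>
     (\<forall>c. \<forall>u\<in>form_dom E. energy E (\<lambda>x. c * u x) = c\<^sup>2 * energy E u) \<and>
     (\<forall>u\<in>form_dom E. \<forall>v\<in>form_dom E. \<forall>w\<in>form_dom E.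
        polar E (\<lambda>x. u x + v x) w = polar E u w + polar E v w) \<and>
     (\<forall>c. \<forall>u\<in>form_dom E. \<forall>w\<in>form_dom E. polar E (\<lambda>x. c * u x) w = c * polar E u w)"

definition nonnegative_form :: "'a qform \<Rightarrow> bool" where
  "nonnegative_form E \<longleftrightarrow> (\<forall>u\<in>form_dom E. 0 \<le> energy E u)"

definition densely_defined :: "'a measure \<Rightarrow> 'a qform \<Rightarrow> bool" where
  "densely_defined M E \<longleftrightarrow>
     (\<forall>u\<in>L2 M. \<forall>e>0. \<exists>v\<in>form_dom E. L2_norm M (\<lambda>x. u x - v x) < e)"

definition closed_form :: "'a measure \<Rightarrow> 'a qform \<Rightarrow> bool" where
  "closed_form M E \<longleftrightarrow>
     (\<forall>u v. (\<forall>n::nat. u n \<in> form_dom E) \<and> v \<in> L2 M \<and>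
        (\<lambda>n. L2_norm M (\<lambda>x. u n x - v x)) \<longlonglongrightarrow> 0 \<and>
        (\<forall>e>0. \<exists>N. \<forall>i\<ge>N. \<forall>j\<ge>N. energy E (\<lambda>x. u i x - u j x) < e) \<longrightarrow>
        v \<in> form_dom E \<and> (\<lambda>n. energy E (\<lambda>x. u n x - v x)) \<longlonglongrightarrow> 0)"

definition unit_cutoff :: "('a \<Rightarrow> real) \<Rightarrow> ('a \<Rightarrow> real)" where
  "unit_cutoff u = (\<lambda>x. min (max (u x) 0) 1)"

definition dirichlet_form :: "'a measure \<Rightarrow> 'a qform \<Rightarrow> bool" where
  "dirichlet_form M E \<longleftrightarrow>
     quadratic_form M E \<and> nonnegative_form E \<and> densely_defined M E \<and> closed_form M E \<and>
     (\<forall>u\<in>form_dom E. unit_cutoff u \<in> form_dom E \<and> energy E (unit_cutoff u) \<le> energy E u)"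


section \<open>Operator, resolvent and semigroup of a form\<close>

text \<open>\<open>form_operator M E u f\<close> says that \<open>u\<close> lies in the domain of the selfadjoint operator $L$
  of the form and $Lu = f$.\<close>

definition form_operator ::
  "'a measure \<Rightarrow> 'a qform \<Rightarrow> ('a \<Rightarrow> real) \<Rightarrow> ('a \<Rightarrow> real) \<Rightarrow> bool" where
  "form_operator M E u f \<longleftrightarrow>
     u \<in> form_dom E \<and> f \<in> L2 M \<and> (\<forall>v\<in>form_dom E. polar E u v = L2_inner M f v)"

text \<open>$K_\beta f = (L+\beta)^{-1}f$ is the $u$ with $Lu + \beta u = f$, that is $Lu = f - \beta u$.
  It is unique up to null sets, and \<open>SOME\<close> picks a representative.\<close>

definition form_resolvent ::
  "'a measure \<Rightarrow> 'a qform \<Rightarrow> real \<Rightarrow> ('a \<Rightarrow> real) \<Rightarrow> ('a \<Rightarrow> real)" where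
  "form_resolvent M E \<beta> f = (SOME u. form_operator M E u (\<lambda>x. f x - \<beta> * u x))"

definition C0_semigroup :: "'a measure \<Rightarrow> (real \<Rightarrow> ('a \<Rightarrow> real) \<Rightarrow> ('a \<Rightarrow> real)) \<Rightarrow> bool" where
  "C0_semigroup M T \<longleftrightarrow>
     (\<forall>t\<ge>0. L2_bounded_operator M (T t)) \<and>
     (\<forall>u\<in>L2 M. AE x in M. T 0 u x = u x) \<and>
     (\<forall>s\<ge>0. \<forall>t\<ge>0. \<forall>u\<in>L2 M. AE x in M. T (s + t) u x = T s (T t u) x) \<and>
     (\<forall>u\<in>L2 M. ((\<lambda>h. L2_norm M (\<lambda>x. T h u x - u x)) \<longlongrightarrow> 0) (at_right 0))"

text \<open>\<open>generates M T u g\<close>: \<open>u\<close> lies in the domain of the infinitesimal generator of \<open>T\<close>, and the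
  generator maps it to \<open>g\<close>.\<close>

definition generates ::
  "'a measure \<Rightarrow> (real \<Rightarrow> ('a \<Rightarrow> real) \<Rightarrow> ('a \<Rightarrow> real)) \<Rightarrow> ('a \<Rightarrow> real) \<Rightarrow> ('a \<Rightarrow> real) \<Rightarrow> bool" where
  "generates M T u g \<longleftrightarrow>
     u \<in> L2 M \<and> g \<in> L2 M \<and>
     ((\<lambda>h. L2_norm M (\<lambda>x. (T h u x - u x) / h - g x)) \<longlongrightarrow> 0) (at_right 0)"

text \<open>$T_t = e^{-tL}$ is the strongly continuous semigroup on $L^2$ whose generator is exactly
  $-L$. Each $T_tu$ is unique up to null sets; only times $t \ge 0$ are meaningful.\<close>

definition form_semigroup ::
  "'a measure \<Rightarrow> 'a qform \<Rightarrow> real \<Rightarrow> ('a \<Rightarrow> real) \<Rightarrow> ('a \<Rightarrow> real)" where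
  "form_semigroup M E =
     (SOME T. C0_semigroup M T \<and>
        (\<forall>u f. form_operator M E u f \<longleftrightarrow> generates M T u (\<lambda>x. - f x)))"

definition exhausting :: "'a measure \<Rightarrow> (nat \<Rightarrow> 'a \<Rightarrow> real) \<Rightarrow> bool" where
  "exhausting M \<phi> \<longleftrightarrow>
     (\<forall>k. integrable M (\<phi> k)) \<and>
     (\<forall>k. AE x in M. 0 < \<phi> k x \<and> \<phi> k x \<le> 1) \<and>
     (AE x in M. incseq (\<lambda>k. \<phi> k x) \<and> (\<lambda>k. \<phi> k x) \<longlonglongrightarrow> 1)"

text \<open>Extension of an operator on $L^2$ to $L^\infty$. The two limits are those for $u^+$ and $u^-$;
  for the semigroup of a Dirichlet form they exist almost everywhere and, up to null sets, do
  not depend on the choice of the sequence.\<close>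

definition Linf_extension ::
  "'a measure \<Rightarrow> (('a \<Rightarrow> real) \<Rightarrow> ('a \<Rightarrow> real)) \<Rightarrow> ('a \<Rightarrow> real) \<Rightarrow> ('a \<Rightarrow> real)" where
  "Linf_extension M A u =
     (let \<phi> = (SOME \<phi>. exhausting M \<phi>) in
      (\<lambda>x. lim (\<lambda>k. A (\<lambda>y. max (u y) 0 * \<phi> k y) x) - lim (\<lambda>k. A (\<lambda>y. max (- u y) 0 * \<phi> k y) x)))"

definition form_semigroup_Linf ::
  "'a measure \<Rightarrow> 'a qform \<Rightarrow> real \<Rightarrow> ('a \<Rightarrow> real) \<Rightarrow> ('a \<Rightarrow> real)" where
  "form_semigroup_Linf M E s = Linf_extension M (form_semigroup M E s)"


section \<open>Approximating forms\<close>

definition time_approx :: "'a measure \<Rightarrow> 'a qform \<Rightarrow> real \<Rightarrow> 'a qform" where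
  "time_approx M E t =
     \<lparr>form_dom = L2 M,
      energy = (\<lambda>u. 1 / t * L2_inner M (\<lambda>x. u x - form_semigroup M E t u x) u)\<rparr>"

definition deny_yosida_approx :: "'a measure \<Rightarrow> 'a qform \<Rightarrow> real \<Rightarrow> 'a qform" where
  "deny_yosida_approx M E \<beta> =
     \<lparr>form_dom = L2 M,
      energy = (\<lambda>u. \<beta> * L2_inner M (\<lambda>x. u x - \<beta> * form_resolvent M E \<beta> u x) u)\<rparr>"


section \<open>Conservativeness and dissipativity\<close>

definition conservative_space :: "'a measure \<Rightarrow> 'a qform \<Rightarrow> 'a set" where
  "conservative_space M E =
     (\<Inter>k\<in>{1::nat..}. {x \<in> space M. form_semigroup_Linf M E (real k) (\<lambda>_. 1) x = 1})"

definition dissipative_space :: "'a measure \<Rightarrow> 'a qform \<Rightarrow> 'a set" where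
  "dissipative_space M E = space M - conservative_space M E"

definition conservative :: "'a measure \<Rightarrow> 'a qform \<Rightarrow> bool" where
  "conservative M E \<longleftrightarrow> (\<exists>s>0. AE x in M. form_semigroup_Linf M E s (\<lambda>_. 1) x = 1)"

definition dissipative :: "'a measure \<Rightarrow> 'a qform \<Rightarrow> bool" where
  "dissipative M E \<longleftrightarrow>
     (\<exists>s>0. emeasure M {x \<in> space M. form_semigroup_Linf M E s (\<lambda>_. 1) x < 1} > 0)"

end

theory Submission
  imports Defs "HOL-Probability.Discrete_Topology"
begin

text \<open>
  For a Markov operator \<open>A\<close> on $L^2$ write $A1$ for the increasing limit of
  $A\varphi_k$, where \<open>0 < \<phi>\<^sub>k \<le> 1\<close> increases to \<open>1\<close>. The
  operators of the two approximating forms are bounded, of the shape $c(1-A)$, with \<open>c =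
  1/t\<close>, $A = T_t$ in the first case and $c = \beta$, $A = \beta K_\beta$ in the second. Hence
  their semigroups are Poisson mixtures
  $$P_s = e^{-cs}\sum_n \frac{(cs)^n}{n!} A^n.$$
  For \<open>s > 0\<close> all weights are positive, they add up to \<open>1\<close>, and $A^n1 \le
  1$. So $P_s1 = 1$ holds at a point exactly if $A^n1 = 1$ there for every \<open>n\<close>
  (\<open>poisson_op_unit\<close>), and the conservative space of an approximating form is
  $\bigcap_n\{A^n1 = 1\}$.

  For $A = T_t$ the powers are $T_{nt}$. As $T_s1$ decreases in \<open>s\<close>, the conditions
  $T_{nt}1 = 1$ for all \<open>n\<close> and $T_k1 = 1$ for all \<open>k\<close> describe the same
  points (\<open>time_unit_iff\<close>).

  For $A = \beta K_\beta$ the powers have to be compared with the semigroup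
  (\<open>yosida_unit_iff\<close>). With $G = \gamma K_\gamma$, \<open>\<gamma> < \<beta>\<close>,
  the resolvent identity reads
  $$G = \frac\gamma\beta A + \Bigl(1-\frac\gamma\beta\Bigr)AG .$$
  Iterated, it presents $G1$ as a geometric mixture of the numbers $A^{n+1}1$, so $G1 = 1$ at a
  point exactly if all $A^n1 = 1$ there (\<open>Y_unit_bounds\<close>). Since $T_t$ is the strong
  limit of the Poisson mixtures of $\beta K_\beta$ as $\beta\to\infty$, it also yields
  $$(1-e^{-\gamma t/2})\,T_t1 \le \gamma K_\gamma1, \qquad \gamma K_\gamma1 - \gamma t \le T_t1$$
  (\<open>T_unit_le\<close>, \<open>T_unit_ge\<close>). Where all $T_k1 = 1$, letting $t\to\infty$
  in the first bound gives $\gamma K_\gamma1 = 1$ for a fixed $\gamma < \beta$, hence $A^n1 = 1$ for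
  all \<open>n\<close>. Where all $A^n1 = 1$, one has $\gamma K_\gamma1 = 1$ for all $\gamma<\beta$,
  and letting $\gamma\to0$ in the second bound gives $T_t1=1$.

  The second part follows: if $P_s1 = 1$ almost everywhere for one \<open>s > 0\<close>, then for
  all multiples of \<open>s\<close>, and by monotonicity for all times. So a form is conservative
  exactly if its conservative space has null complement, and, as $P_s1 \le 1$, it is dissipative
  exactly if it is not conservative.

  The semigroup of a form is given only through its generator, so these arguments rest on the
  existence and the uniqueness of the semigroup generated by $-L$. Both are proved by the
  Hille-Yosida method, for a closed subspace \<open>W\<close> of a Banach space. Because a type
  cannot depend on the measure, classes of functions in $L^2$ are represented by the functionals
  that they define on the unit ball, which form such a subspace of a fixed Banach space of bounded
  functions. The resolvent of a closed form comes from minimising a quadratic functional, and its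
  Markov property from the contraction of the form under the unit cutoff.
\<close>

section \<open>Poisson mixtures of the powers of a contraction\<close>

definition linear_map_on :: "'b::real_normed_vector set \<Rightarrow> ('b \<Rightarrow> 'b) \<Rightarrow> bool" where
  "linear_map_on W A \<longleftrightarrow> (\<forall>x\<in>W. A x \<in> W) \<and> (\<forall>x\<in>W. \<forall>y\<in>W. A (x + y) = A x + A y) \<and>
     (\<forall>c. \<forall>x\<in>W. A (c *\<^sub>R x) = c *\<^sub>R A x)"

definition bounded_map_on :: "'b::real_normed_vector set \<Rightarrow> ('b \<Rightarrow> 'b) \<Rightarrow> bool" where
  "bounded_map_on W A \<longleftrightarrow> linear_map_on W A \<and> (\<exists>C. \<forall>x\<in>W. norm (A x) \<le> C * norm x)"

definition contraction_on :: "'b::real_normed_vector set \<Rightarrow> ('b \<Rightarrow> 'b) \<Rightarrow> bool" where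
  "contraction_on W A \<longleftrightarrow> linear_map_on W A \<and> (\<forall>x\<in>W. norm (A x) \<le> norm x)"

definition poisson_weight :: "real \<Rightarrow> nat \<Rightarrow> real" where
  "poisson_weight s n = exp (- s) * s ^ n / fact n"

text \<open>
  The exponential $e^{-s(1-A)}$ of a bounded generator. In this form it is visibly an average of the
  powers of \<open>A\<close>, so that it inherits every property of \<open>A\<close> that is stable
  under averaging.
\<close>

definition poisson :: "('b::banach \<Rightarrow> 'b) \<Rightarrow> real \<Rightarrow> 'b \<Rightarrow> 'b" where
  "poisson A s x = (\<Sum>n. poisson_weight s n *\<^sub>R (A ^^ n) x)"

lemma poisson_weight_nonneg: "0 \<le> s \<Longrightarrow> 0 \<le> poisson_weight s n"
  by (simp add: poisson_weight_def)

lemma poisson_weight_pos: "0 < s \<Longrightarrow> 0 < poisson_weight s n"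
  by (simp add: poisson_weight_def)

lemma sums_poisson_weight: "poisson_weight s sums 1"
proof -
  have "(\<lambda>n. exp (- s) * (s ^ n /\<^sub>R fact n)) sums (exp (- s) * exp s)"
    by (intro sums_mult exp_converges)
  moreover have "exp (- s) * (s ^ n /\<^sub>R fact n) = poisson_weight s n" for n
    by (simp add: poisson_weight_def divide_inverse mult_ac)
  ultimately show ?thesis by (simp add: exp_minus)
qed

lemma poisson_weight_Suc: "real (Suc n) * poisson_weight s (Suc n) = s * poisson_weight s n"
  by (simp add: poisson_weight_def field_simps del: of_nat_Suc)

lemma sums_poisson_mean: "(\<lambda>n. real n * poisson_weight s n) sums s"
proof -
  have "(\<lambda>n. s * poisson_weight s n) sums (s * 1)"
    by (intro sums_mult sums_poisson_weight)
  then have "(\<lambda>n. real (Suc n) * poisson_weight s (Suc n)) sums s"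
    unfolding poisson_weight_Suc by simp
  from sums_Suc[where f="\<lambda>n. real n * poisson_weight s n", OF this] show ?thesis
    by (simp only: of_nat_0 mult_zero_left add_0_right)
qed

text \<open>
  Half of the second factorial moment is the quantity that the Taylor remainder of second order
  produces.
\<close>

lemma sums_poisson_second_moment:
  "(\<lambda>n. real n * (real n - 1) / 2 * poisson_weight s n) sums (s\<^sup>2 / 2)"
proof -
  have "(\<lambda>n. s / 2 * (real n * poisson_weight s n)) sums (s / 2 * s)"
    by (rule sums_mult[OF sums_poisson_mean])
  moreover have "s / 2 * (real n * poisson_weight s n)
      = real (Suc n) * (real (Suc n) - 1) / 2 * poisson_weight s (Suc n)" for n
  proof -
    have "real (Suc n) * (real (Suc n) - 1) / 2 * poisson_weight s (Suc n)
        = real n / 2 * (real (Suc n) * poisson_weight s (Suc n))" by simp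
    then have "real (Suc n) * (real (Suc n) - 1) / 2 * poisson_weight s (Suc n)
        = s / 2 * (real n * poisson_weight s n)"
      unfolding poisson_weight_Suc by simp
    then show ?thesis by (rule sym)
  qed
  ultimately have "(\<lambda>n. real (Suc n) * (real (Suc n) - 1) / 2 * poisson_weight s (Suc n)) sums (s\<^sup>2/2)"
    by (simp add: power2_eq_square del: of_nat_Suc)
  from sums_Suc[where f="\<lambda>n. real n * (real n - 1) / 2 * poisson_weight s n", OF this]
  show ?thesis by (simp only: of_nat_0 mult_zero_left div_0 add_0_right)
qed

lemma poisson_weight_convolution:
  "(\<Sum>i\<le>n. poisson_weight s i * poisson_weight t (n - i)) = poisson_weight (s + t) n"
proof -
  have "(\<Sum>i\<le>n. poisson_weight s i * poisson_weight t (n - i))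
      = exp (- (s + t)) / fact n * (\<Sum>i\<le>n. of_nat (n choose i) * s ^ i * t ^ (n - i))"
    unfolding sum_distrib_left
  proof (rule sum.cong[OF refl])
    fix i assume "i \<in> {..n}"
    then have "(of_nat (n choose i) :: real) = fact n / (fact i * fact (n - i))"
      by (simp add: binomial_fact)
    then show "poisson_weight s i * poisson_weight t (n - i)
      = exp (- (s + t)) / fact n * (of_nat (n choose i) * s ^ i * t ^ (n - i))"
      by (simp add: poisson_weight_def exp_add exp_diff exp_minus field_simps)
  qed
  also have "\<dots> = poisson_weight (s + t) n"
    by (simp add: poisson_weight_def binomial_ring[of s t n])
  finally show ?thesis .
qed

text \<open>
  Exponential moment bound for the lower tail at half of the mean: $2^n \le 2^m$ for \<open>n <
  m\<close>. The bound is useful because $2/e < 1$.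
\<close>

lemma poisson_tail:
  "(\<Sum>n<m. poisson_weight (2 * real m) n) \<le> (2 * exp (- 1)) ^ m"
proof -
  let ?s = "2 * real m"
  have a: "poisson_weight ?s n \<le> exp (- ?s) * 2 ^ m * (real m ^ n / fact n)" if "n < m" for n
  proof -
    have "poisson_weight ?s n = exp (- ?s) * 2 ^ n * (real m ^ n / fact n)"
      by (simp add: poisson_weight_def power_mult_distrib)
    also have "\<dots> \<le> exp (- ?s) * 2 ^ m * (real m ^ n / fact n)"
      using that by (intro mult_right_mono mult_left_mono power_increasing) auto
    finally show ?thesis .
  qed
  have "(\<Sum>n<m. real m ^ n / fact n) \<le> exp (real m)"
  proof -
    have "(\<lambda>n. real m ^ n /\<^sub>R fact n) sums exp (real m)" by (rule exp_converges)
    then have s: "(\<lambda>n. real m ^ n / fact n) sums exp (real m)"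
      by (simp add: divide_inverse mult.commute)
    show ?thesis using sum_le_suminf[OF sums_summable[OF s], of "{..<m}"] sums_unique[OF s] by simp
  qed
  then have b: "exp (- ?s) * 2 ^ m * (\<Sum>n<m. real m ^ n / fact n) \<le> exp (- ?s) * 2 ^ m * exp (real m)"
    by (intro mult_left_mono) auto
  have "(\<Sum>n<m. poisson_weight ?s n) \<le> (\<Sum>n<m. exp (- ?s) * 2 ^ m * (real m ^ n / fact n))"
    by (intro sum_mono a) simp
  also have "\<dots> = exp (- ?s) * 2 ^ m * (\<Sum>n<m. real m ^ n / fact n)"
    by (simp add: sum_distrib_left)
  also note b
  also have "exp (- ?s) * 2 ^ m * exp (real m) = exp (- real m) * 2 ^ m"
    by (simp add: exp_minus mult_exp_exp[symmetric] field_simps flip: exp_add)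
  also have "\<dots> = (2 * exp (- 1)) ^ m"
    by (simp add: power_mult_distrib flip: exp_of_nat_mult)
  finally show ?thesis .
qed

lemma linear_map_onD:
  assumes "linear_map_on W A"
  shows "x \<in> W \<Longrightarrow> A x \<in> W" "x \<in> W \<Longrightarrow> y \<in> W \<Longrightarrow> A (x + y) = A x + A y"
    "x \<in> W \<Longrightarrow> A (c *\<^sub>R x) = c *\<^sub>R A x"
  using assms by (auto simp: linear_map_on_def)

lemma linear_map_on_diff:
  assumes "linear_map_on W A" "subspace W" "x \<in> W" "y \<in> W"
  shows "A (x - y) = A x - A y"
proof -
  have "A (x + (-1) *\<^sub>R y) = A x + (-1) *\<^sub>R A y"
    using assms by (metis linear_map_onD(2,3) subspace_scale)
  then show ?thesis by simp
qed

lemma linear_map_on_zero: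
  assumes "linear_map_on W A" "subspace W" shows "A 0 = 0"
  using linear_map_on_diff[OF assms, of 0 0] assms(2) by (simp add: subspace_0)

lemma linear_map_on_sum:
  assumes "linear_map_on W A" "subspace W" "\<And>i. i \<in> I \<Longrightarrow> f i \<in> W"
  shows "A (\<Sum>i\<in>I. f i) = (\<Sum>i\<in>I. A (f i))"
  using assms(3)
proof (induction I rule: infinite_finite_induct)
  case (insert x F)
  then show ?case
    using linear_map_onD(2)[OF assms(1), of "f x" "sum f F"] subspace_sum[OF assms(2), of F f] by simp
qed (auto simp: linear_map_on_zero[OF assms(1,2)])

lemma linear_map_on_funpow: "linear_map_on W A \<Longrightarrow> linear_map_on W (A ^^ n)"
  by (induction n) (auto simp: linear_map_on_def)

lemma contraction_onD:
  assumes "contraction_on W A"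
  shows "linear_map_on W A" "x \<in> W \<Longrightarrow> norm (A x) \<le> norm x" "x \<in> W \<Longrightarrow> A x \<in> W"
  using assms by (auto simp: contraction_on_def linear_map_on_def)

lemma contraction_on_bounded: "contraction_on W A \<Longrightarrow> bounded_map_on W A"
  unfolding contraction_on_def bounded_map_on_def by (metis mult_1)

lemma contraction_on_funpow: 
  assumes "contraction_on W A" shows "contraction_on W (A ^^ n)"
proof (induction n)
  case (Suc n)
  have "norm (A ((A ^^ n) x)) \<le> norm x" if "x \<in> W" for x
    using contraction_onD(2)[OF assms contraction_onD(3)[OF Suc that]] contraction_onD(2)[OF Suc that]
    by linarith
  then show ?case using linear_map_on_funpow[OF contraction_onD(1)[OF assms], of "Suc n"]
    by (simp add: contraction_on_def o_def)
qed (auto simp: contraction_on_def linear_map_on_def)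

lemma bounded_map_onE:
  assumes "bounded_map_on W A"
  obtains C where "C > 0" "\<And>x. x \<in> W \<Longrightarrow> norm (A x) \<le> C * norm x"
proof -
  from assms obtain C where C: "\<And>x. x \<in> W \<Longrightarrow> norm (A x) \<le> C * norm x"
    by (auto simp: bounded_map_on_def)
  have "norm (A x) \<le> (\<bar>C\<bar> + 1) * norm x" if "x \<in> W" for x
  proof -
    have "C * norm x \<le> (\<bar>C\<bar> + 1) * norm x" by (intro mult_right_mono) auto
    with C[OF that] show ?thesis by linarith
  qed
  then show ?thesis by (intro that[of "\<bar>C\<bar> + 1"]) auto
qed

lemma bounded_map_on_tendsto:
  assumes "bounded_map_on W A" "subspace W" "\<And>n. f n \<in> W" "x \<in> W" "(f \<longlongrightarrow> x) F"
  shows "((\<lambda>n. A (f n)) \<longlongrightarrow> A x) F"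
proof -
  obtain C where C: "C > 0" "\<And>x. x \<in> W \<Longrightarrow> norm (A x) \<le> C * norm x"
    using bounded_map_onE[OF assms(1)] by blast
  have l: "linear_map_on W A" using assms(1) by (simp add: bounded_map_on_def)
  have "((\<lambda>n. C * norm (f n - x)) \<longlongrightarrow> C * norm (x - x)) F"
    by (intro tendsto_intros assms)
  then have t: "((\<lambda>n. C * norm (f n - x)) \<longlongrightarrow> 0) F" by simp
  have m: "\<forall>n. norm (A (f n) - A x) \<le> C * norm (f n - x)"
    using C(2)[OF subspace_diff[OF assms(2) assms(3) assms(4)]]
      linear_map_on_diff[OF l assms(2) assms(3) assms(4)] by metis
  have "((\<lambda>n. A (f n) - A x) \<longlongrightarrow> 0) F"
    by (rule Lim_null_comparison[OF always_eventually[OF m] t])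
  then show ?thesis by (rule LIM_zero_cancel)
qed

locale closed_subspace =
  fixes W :: "'b::banach set"
  assumes subspace: "subspace W" and closed: "closed W"
begin

lemma limit_in: "(f \<longlongrightarrow> x) F \<Longrightarrow> F \<noteq> bot \<Longrightarrow> (\<And>n. f n \<in> W) \<Longrightarrow> x \<in> W"
  by (rule Lim_in_closed_set[OF closed always_eventually]) auto

lemmas W_simps [simp] = subspace_add[OF subspace] subspace_diff[OF subspace]
  subspace_scale[OF subspace] subspace_0[OF subspace] subspace_sum[OF subspace]

lemma poisson_terms_summable:
  assumes "0 \<le> s" "\<And>n. norm (y n) \<le> C"
  shows "summable (\<lambda>n. norm (poisson_weight s n *\<^sub>R y n))" "summable (\<lambda>n. poisson_weight s n *\<^sub>R (y n :: 'b))"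
proof -
  show "summable (\<lambda>n. norm (poisson_weight s n *\<^sub>R y n))"
    by (rule summable_comparison_test'[where g="\<lambda>n. poisson_weight s n * C" and N=0])
      (auto intro!: summable_mult2 sums_summable[OF sums_poisson_weight] mult_left_mono
        simp: poisson_weight_nonneg assms)
  then show "summable (\<lambda>n. poisson_weight s n *\<^sub>R y n)" by (rule summable_norm_cancel)
qed

context
  fixes A assumes A: "contraction_on W A"
begin

lemma funpow_in: "x \<in> W \<Longrightarrow> (A ^^ n) x \<in> W"
  and funpow_norm: "x \<in> W \<Longrightarrow> norm ((A ^^ n) x) \<le> norm x"
  by (rule contraction_onD(3)[OF contraction_on_funpow[OF A]], assumption)
    (rule contraction_onD(2)[OF contraction_on_funpow[OF A]], assumption)

lemmas A_lin = contraction_onD(1)[OF A]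

lemma poisson_sums:
  "0 \<le> s \<Longrightarrow> x \<in> W \<Longrightarrow> (\<lambda>n. poisson_weight s n *\<^sub>R (A ^^ n) x) sums poisson A s x"
  unfolding poisson_def
  by (rule summable_sums[OF poisson_terms_summable(2)[OF _ funpow_norm]])

lemma poisson_contraction: 
  assumes "0 \<le> s" shows "contraction_on W (poisson A s)"
  unfolding contraction_on_def linear_map_on_def
proof (intro conjI ballI allI)
  note P = poisson_sums[OF assms]
  fix x assume x: "x \<in> W"
  show "poisson A s x \<in> W"
    using P[OF x] unfolding sums_def by (rule limit_in) (simp_all add: funpow_in x)
  { fix y assume y: "y \<in> W"
    have "(\<lambda>n. poisson_weight s n *\<^sub>R (A ^^ n) (x + y)) sums (poisson A s x + poisson A s y)"
      using sums_add[OF P[OF x] P[OF y]]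
      by (simp only: linear_map_onD(2)[OF linear_map_on_funpow[OF A_lin] x y] scaleR_add_right)
    then show "poisson A s (x + y) = poisson A s x + poisson A s y"
      using P[OF W_simps(1)[OF x y]] by (rule sums_unique2[symmetric]) }
  { fix c
    have "(\<lambda>n. poisson_weight s n *\<^sub>R (A ^^ n) (c *\<^sub>R x)) sums (c *\<^sub>R poisson A s x)"
      using sums_scaleR_right[OF P[OF x], of c]
      by (simp only: linear_map_onD(3)[OF linear_map_on_funpow[OF A_lin] x] scaleR_left_commute)
    then show "poisson A s (c *\<^sub>R x) = c *\<^sub>R poisson A s x"
      using P[OF W_simps(3)[OF x]] by (rule sums_unique2[symmetric]) }
  have "norm (poisson A s x) \<le> (\<Sum>n. poisson_weight s n * norm x)"
    unfolding poisson_def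
    by (rule norm_suminf_le) (auto intro!: mult_left_mono funpow_norm x summable_mult2
        sums_summable[OF sums_poisson_weight] simp: poisson_weight_nonneg assms)
  also have "\<dots> = norm x"
    using sums_unique[OF sums_mult2[OF sums_poisson_weight[of s], of "norm x"]] by simp
  finally show "norm (poisson A s x) \<le> norm x" .
qed

lemma poisson_commute:
  assumes "0 \<le> s" "bounded_map_on W B" "\<And>x. x \<in> W \<Longrightarrow> B (A x) = A (B x)" "x \<in> W"
  shows "B (poisson A s x) = poisson A s (B x)"
proof -
  have lB: "linear_map_on W B" using assms(2) by (simp add: bounded_map_on_def)
  have c: "B ((A ^^ n) x) = (A ^^ n) (B x)" for n
    by (induction n) (auto simp: assms(3) funpow_in assms(4))
  have "(\<lambda>N. B (\<Sum>n<N. poisson_weight s n *\<^sub>R (A ^^ n) x)) \<longlonglongrightarrow> B (poisson A s x)"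
    using poisson_sums[OF assms(1,4)] unfolding sums_def
    by (intro bounded_map_on_tendsto[OF assms(2) subspace])
      (auto intro!: W_simps(3,5) funpow_in assms(4) contraction_onD(3)[OF poisson_contraction[OF assms(1)]])
  moreover have "B (\<Sum>n<N. poisson_weight s n *\<^sub>R (A ^^ n) x) = (\<Sum>n<N. poisson_weight s n *\<^sub>R (A ^^ n) (B x))" for N
    by (subst linear_map_on_sum[OF lB subspace])
      (simp_all add: linear_map_onD(3)[OF lB] c funpow_in assms(4))
  ultimately have "(\<lambda>n. poisson_weight s n *\<^sub>R (A ^^ n) (B x)) sums B (poisson A s x)"
    by (simp add: sums_def)
  then show ?thesis
    using poisson_sums[OF assms(1) linear_map_onD(1)[OF lB assms(4)]] by (rule sums_unique2)
qed

lemma poisson_zero: "x \<in> W \<Longrightarrow> poisson A 0 x = x"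
proof -
  assume "x \<in> W"
  have "(\<lambda>n. poisson_weight 0 n *\<^sub>R (A ^^ n) x) sums (\<Sum>n\<in>{0}. poisson_weight 0 n *\<^sub>R (A ^^ n) x)"
    by (rule sums_finite) (auto simp: poisson_weight_def)
  then show ?thesis unfolding poisson_def by (simp add: sums_iff poisson_weight_def)
qed

text \<open>
  The semigroup law without double series: the product of two partial sums and the partial sum for
  \<open>s + t\<close> differ by the terms with $i, j < N \le i + j$, and the weights of these add
  up to a difference of partial sums of the weights, which tends to $1\cdot1-1 = 0$.
\<close>

lemma poisson_add:
  assumes "0 \<le> s" "0 \<le> t" "x \<in> W"
  shows "poisson A (s + t) x = poisson A s (poisson A t x)"
proof -
  let ?p = "poisson_weight"
  define S where "S s N x = (\<Sum>n<N. ?p s n *\<^sub>R (A ^^ n) x)" for s N x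
  have S_in: "S s N x \<in> W" if "x \<in> W" for s N x
    unfolding S_def using that by (auto intro!: W_simps(3,5) funpow_in)
  have S_lim: "(\<lambda>N. S s N x) \<longlonglongrightarrow> poisson A s x" if "0 \<le> s" "x \<in> W" for s x
    using poisson_sums[OF that] by (simp add: sums_def S_def)
  have S_norm: "norm (S s N x) \<le> norm x" if "0 \<le> s" "x \<in> W" for s N x
  proof -
    have "norm (S s N x) \<le> (\<Sum>n<N. ?p s n * norm x)"
      unfolding S_def
      by (rule sum_norm_le) (auto intro!: mult_left_mono funpow_norm that simp: poisson_weight_nonneg that)
    also have "\<dots> = (\<Sum>n<N. ?p s n) * norm x" by (simp add: sum_distrib_right)
    also have "\<dots> \<le> 1 * norm x"
      using sum_le_suminf[OF sums_summable[OF sums_poisson_weight[of s]], of "{..<N}"]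
        sums_unique[OF sums_poisson_weight[of s]]
      by (intro mult_right_mono) (auto simp: poisson_weight_nonneg that)
    finally show ?thesis by simp
  qed
  have S_diff: "S s N (x - y) = S s N x - S s N y" if "x \<in> W" "y \<in> W" for s N x y
    unfolding S_def using that linear_map_on_diff[OF linear_map_on_funpow[OF A_lin] subspace that]
    by (simp add: scaleR_diff_right sum_subtractf)
  have lim1: "(\<lambda>N. S s N (S t N x)) \<longlonglongrightarrow> poisson A s (poisson A t x)"
  proof -
    have Px: "poisson A t x \<in> W" using contraction_onD(3)[OF poisson_contraction[OF assms(2)] assms(3)] .
    have "(\<lambda>N. S s N (S t N x - poisson A t x)) \<longlonglongrightarrow> 0"
    proof (rule Lim_null_comparison[OF always_eventually])
      show "\<forall>N. norm (S s N (S t N x - poisson A t x)) \<le> norm (S t N x - poisson A t x)"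
        using S_norm[OF assms(1)] S_in[OF assms(3)] Px by auto
      show "(\<lambda>N. norm (S t N x - poisson A t x)) \<longlonglongrightarrow> 0"
        using S_lim[OF assms(2,3)] by (simp add: LIM_zero tendsto_norm_zero)
    qed
    from tendsto_add[OF this S_lim[OF assms(1) Px]]
    show ?thesis using S_diff[OF S_in[OF assms(3)] Px] by simp
  qed
  have SS: "S s N (S t N x) = (\<Sum>(i,j)\<in>{..<N}\<times>{..<N}. (?p s i * ?p t j) *\<^sub>R (A ^^ (i + j)) x)" for N
  proof -
    have "(A ^^ i) (S t N x) = (\<Sum>j<N. ?p t j *\<^sub>R (A ^^ (i + j)) x)" for i
      unfolding S_def
      by (subst linear_map_on_sum[OF linear_map_on_funpow[OF A_lin] subspace])
        (simp_all add: linear_map_onD(3)[OF linear_map_on_funpow[OF A_lin]] funpow_add funpow_in assms(3))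
    then show ?thesis
      unfolding S_def[of s] by (simp add: scaleR_sum_right sum.cartesian_product)
  qed
  have tri: "S (s + t) N x = (\<Sum>(i,j)\<in>{(i,j). i + j < N}. (?p s i * ?p t j) *\<^sub>R (A ^^ (i + j)) x)" for N
    by (subst sum.triangle_reindex)
      (auto simp: S_def poisson_weight_convolution[symmetric] scaleR_sum_left intro!: sum.cong)
  have tri1: "(\<Sum>n<N. ?p (s + t) n) = (\<Sum>(i,j)\<in>{(i,j). i + j < N}. ?p s i * ?p t j)" for N
    by (subst sum.triangle_reindex) (auto simp: poisson_weight_convolution[symmetric] intro!: sum.cong)
  have sub: "{(i,j). i + j < N} \<subseteq> {..<N} \<times> {..<N}" for N :: nat by auto
  let ?R = "\<lambda>N. {..<N} \<times> {..<N} - {(i,j). i + j < (N::nat)}"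
  have bound: "norm (S s N (S t N x) - S (s + t) N x)
      \<le> ((\<Sum>n<N. ?p s n) * (\<Sum>n<N. ?p t n) - (\<Sum>n<N. ?p (s + t) n)) * norm x" for N
  proof -
    have "S s N (S t N x) - S (s + t) N x = (\<Sum>(i,j)\<in>?R N. (?p s i * ?p t j) *\<^sub>R (A ^^ (i + j)) x)"
      unfolding SS tri by (subst sum_diff[OF _ sub]) auto
    also have "norm \<dots> \<le> (\<Sum>(i,j)\<in>?R N. (?p s i * ?p t j) * norm x)"
      by (rule sum_norm_le)
        (auto intro!: mult_left_mono funpow_norm assms simp: poisson_weight_nonneg assms abs_mult)
    also have "\<dots> = (\<Sum>(i,j)\<in>?R N. ?p s i * ?p t j) * norm x"
      by (simp add: sum_distrib_right split_def)
    also have "(\<Sum>(i,j)\<in>?R N. ?p s i * ?p t j)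
        = (\<Sum>n<N. ?p s n) * (\<Sum>n<N. ?p t n) - (\<Sum>n<N. ?p (s + t) n)"
      unfolding tri1 by (subst sum_diff[OF _ sub]) (auto simp: sum_product sum.cartesian_product)
    finally show ?thesis .
  qed
  have "(\<lambda>N. ((\<Sum>n<N. ?p s n) * (\<Sum>n<N. ?p t n) - (\<Sum>n<N. ?p (s + t) n)) * norm x)
      \<longlonglongrightarrow> (1 * 1 - 1) * norm x"
    using sums_poisson_weight unfolding sums_def by (intro tendsto_intros) auto
  then have "(\<lambda>N. S s N (S t N x) - S (s + t) N x) \<longlonglongrightarrow> 0"
    by (intro Lim_null_comparison[OF always_eventually[OF allI[OF bound]]]) simp
  from tendsto_diff[OF lim1 this] have "(\<lambda>N. S (s + t) N x) \<longlonglongrightarrow> poisson A s (poisson A t x)" by simp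
  moreover have "(\<lambda>N. S (s + t) N x) \<longlonglongrightarrow> poisson A (s + t) x"
    using S_lim assms by simp
  ultimately show ?thesis by (rule LIMSEQ_unique[rotated])
qed

text \<open>
  Averaging $\|A^nx - x\| \le n\|x - Ax\|$ over the Poisson weights produces their mean. The point
  is that the right-hand side involves only $s(x - Ax)$, which for Yosida approximations stays
  bounded.
\<close>

lemma poisson_first_order:
  assumes "0 \<le> s" "x \<in> W" shows "norm (poisson A s x - x) \<le> s * norm (x - A x)"
proof -
  have n: "norm ((A ^^ n) x - x) \<le> real n * norm (x - A x)" for n
  proof (induction n)
    case (Suc n)
    have "(A ^^ Suc n) x - x = ((A ^^ n) (A x - x)) + ((A ^^ n) x - x)"
      using linear_map_on_diff[OF linear_map_on_funpow[OF A_lin] subspace, of "A x" x n] assms(2)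
        contraction_onD(3)[OF A] by (simp add: funpow_swap1)
    also have "norm \<dots> \<le> norm (A x - x) + real n * norm (x - A x)"
      using Suc funpow_norm[of "A x - x" n] assms(2) contraction_onD(3)[OF A]
      by (intro norm_triangle_le) auto
    finally show ?case by (simp add: norm_minus_commute algebra_simps)
  qed simp
  have "(\<lambda>n. poisson_weight s n *\<^sub>R ((A ^^ n) x - x)) sums (poisson A s x - 1 *\<^sub>R x)"
    unfolding scaleR_diff_right
    by (intro sums_diff poisson_sums assms sums_scaleR_left sums_poisson_weight)
  then have "poisson A s x - x = (\<Sum>n. poisson_weight s n *\<^sub>R ((A ^^ n) x - x))"
    by (simp add: sums_iff)
  also have "norm \<dots> \<le> (\<Sum>n. real n * poisson_weight s n * norm (x - A x))"
  proof (rule norm_suminf_le)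
    show "norm (poisson_weight s k *\<^sub>R ((A ^^ k) x - x)) \<le> real k * poisson_weight s k * norm (x - A x)" for k
      using mult_left_mono[OF n poisson_weight_nonneg[OF assms(1), of k], of k]
      unfolding norm_scaleR abs_of_nonneg[OF poisson_weight_nonneg[OF assms(1)]] by (simp only: mult_ac)
  qed (intro summable_mult2 sums_summable[OF sums_poisson_mean])
  also have "\<dots> = s * norm (x - A x)"
    using sums_mult2[OF sums_poisson_mean[of s], of "norm (x - A x)"] by (simp add: sums_iff)
  finally show ?thesis .
qed

text \<open>
  The same averaging for $\|A^nx - x + n(x-Ax)\| \le \frac{n(n-1)}2\|(1-A)^2x\|$.
\<close>

lemma poisson_second_order:
  assumes "0 \<le> s" "x \<in> W"
  shows "norm (poisson A s x - x + s *\<^sub>R (x - A x)) \<le> s\<^sup>2 / 2 * norm ((x - A x) - A (x - A x))"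
proof -
  let ?d = "x - A x"
  let ?e = "?d - A ?d"
  have d: "?d \<in> W" and e: "?e \<in> W" using assms contraction_onD(3)[OF A] by auto
  have n1: "norm (?d - (A ^^ n) ?d) \<le> real n * norm ?e" for n
  proof (induction n)
    case (Suc n)
    have "?d - (A ^^ Suc n) ?d = (A ^^ n) ?e + (?d - (A ^^ n) ?d)"
      using linear_map_on_diff[OF linear_map_on_funpow[OF A_lin] subspace, of ?d "A ?d" n] d
        contraction_onD(3)[OF A] by (simp add: funpow_swap1)
    also have "norm \<dots> \<le> norm ?e + real n * norm ?e"
      using Suc funpow_norm[OF e, of n] by (intro norm_triangle_le add_mono)
    finally show ?case by (simp add: algebra_simps)
  qed simp
  have n2: "norm ((A ^^ n) x - x + real n *\<^sub>R ?d) \<le> real n * (real n - 1) / 2 * norm ?e" for n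
  proof (induction n)
    case (Suc n)
    have "(A ^^ Suc n) x - x + real (Suc n) *\<^sub>R ?d
        = ((A ^^ n) x - x + real n *\<^sub>R ?d) + (?d - (A ^^ n) ?d)"
      using linear_map_on_diff[OF linear_map_on_funpow[OF A_lin] subspace, of x "A x" n] assms(2)
        contraction_onD(3)[OF A] by (simp add: funpow_swap1 scaleR_add_left)
    also have "norm \<dots> \<le> real n * (real n - 1) / 2 * norm ?e + real n * norm ?e"
      using Suc n1 by (intro norm_triangle_le) (auto intro!: add_mono)
    finally show ?case by (simp add: field_simps)
  qed simp
  have "(\<lambda>n. poisson_weight s n *\<^sub>R ((A ^^ n) x - x + real n *\<^sub>R ?d))
      sums ((poisson A s x - 1 *\<^sub>R x) + s *\<^sub>R ?d)"
  proof -
    have "(\<lambda>n. (poisson_weight s n *\<^sub>R (A ^^ n) x - poisson_weight s n *\<^sub>R x)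
        + (real n * poisson_weight s n) *\<^sub>R ?d) sums ((poisson A s x - 1 *\<^sub>R x) + s *\<^sub>R ?d)"
      by (intro sums_diff sums_add poisson_sums assms sums_scaleR_left sums_poisson_weight sums_poisson_mean)
    then show ?thesis by (simp add: algebra_simps)
  qed
  then have "poisson A s x - x + s *\<^sub>R ?d
      = (\<Sum>n. poisson_weight s n *\<^sub>R ((A ^^ n) x - x + real n *\<^sub>R ?d))"
    by (simp add: sums_iff)
  also have "norm \<dots> \<le> (\<Sum>n. real n * (real n - 1) / 2 * poisson_weight s n * norm ?e)"
  proof (rule norm_suminf_le)
    show "norm (poisson_weight s k *\<^sub>R ((A ^^ k) x - x + real k *\<^sub>R ?d))
        \<le> real k * (real k - 1) / 2 * poisson_weight s k * norm ?e" for k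
      using mult_left_mono[OF n2 poisson_weight_nonneg[OF assms(1), of k], of k]
      unfolding norm_scaleR abs_of_nonneg[OF poisson_weight_nonneg[OF assms(1)]]
      by (simp only: mult_ac times_divide_eq_left times_divide_eq_right)
  qed (intro summable_mult2 sums_summable[OF sums_poisson_second_moment])
  also have "\<dots> = s\<^sup>2 / 2 * norm ?e"
    using sums_mult2[OF sums_poisson_second_moment[of s], of "norm ?e"] by (simp add: sums_iff)
  finally show ?thesis .
qed

end

end

section \<open>Strongly continuous semigroups on a closed subspace\<close>

definition C0_on :: "'b::real_normed_vector set \<Rightarrow> (real \<Rightarrow> 'b \<Rightarrow> 'b) \<Rightarrow> bool" where
  "C0_on W T \<longleftrightarrow>
     (\<forall>t\<ge>0. bounded_map_on W (T t)) \<and>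
     (\<forall>x\<in>W. T 0 x = x) \<and>
     (\<forall>s\<ge>0. \<forall>t\<ge>0. \<forall>x\<in>W. T (s + t) x = T s (T t x)) \<and>
     (\<forall>x\<in>W. ((\<lambda>h. T h x) \<longlongrightarrow> x) (at_right 0))"

definition generator_on ::
    "'b::real_normed_vector set \<Rightarrow> (real \<Rightarrow> 'b \<Rightarrow> 'b) \<Rightarrow> 'b \<Rightarrow> 'b \<Rightarrow> bool" where
  "generator_on W T x g \<longleftrightarrow> x \<in> W \<and> g \<in> W \<and> ((\<lambda>h. (T h x - x) /\<^sub>R h) \<longlongrightarrow> g) (at_right 0)"

lemma C0_onD:
  assumes "C0_on W T"
  shows "0 \<le> t \<Longrightarrow> bounded_map_on W (T t)" "0 \<le> t \<Longrightarrow> linear_map_on W (T t)"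
    "0 \<le> t \<Longrightarrow> x \<in> W \<Longrightarrow> T t x \<in> W"
    "x \<in> W \<Longrightarrow> T 0 x = x"
    "0 \<le> s \<Longrightarrow> 0 \<le> t \<Longrightarrow> x \<in> W \<Longrightarrow> T (s + t) x = T s (T t x)"
    "x \<in> W \<Longrightarrow> ((\<lambda>h. T h x) \<longlongrightarrow> x) (at_right 0)"
  using assms unfolding C0_on_def bounded_map_on_def linear_map_on_def by blast+

context closed_subspace
begin

text \<open>
  The operator norm \<open>m\<close> is a supremum, hence attained up to the factor
  \<open>2/3\<close>.
\<close>

lemma near_maximal_vector:
  assumes "bounded_map_on W A" "z \<in> W" "norm (A z) > c * norm z" "c \<ge> 0"
  obtains m y where "c < m" "y \<in> W" "norm y = 1" "norm (A y) \<ge> 2/3 * m"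
    "\<And>x. x \<in> W \<Longrightarrow> norm (A x) \<le> m * norm x"
proof -
  have lin: "linear_map_on W A" using assms(1) by (simp add: bounded_map_on_def)
  obtain C where C: "C > 0" "\<And>x. x \<in> W \<Longrightarrow> norm (A x) \<le> C * norm x"
    using bounded_map_onE[OF assms(1)] by blast
  define U where "U = {norm (A y) | y. y \<in> W \<and> norm y = 1}"
  have bdd: "bdd_above U" unfolding U_def by (rule bdd_aboveI[of _ C]) (use C(2) in fastforce)
  have unit: "(1 / norm x) *\<^sub>R x \<in> W" "norm ((1 / norm x) *\<^sub>R x) = 1"
     "norm (A ((1 / norm x) *\<^sub>R x)) = norm (A x) / norm x" if "x \<in> W" "x \<noteq> 0" for x
    using that linear_map_onD(3)[OF lin that(1)] by auto
  have z0: "z \<noteq> 0" using assms(3) linear_map_on_zero[OF lin subspace] by auto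
  let ?m = "Sup U"
  have inU: "norm (A x) / norm x \<in> U" if "x \<in> W" "x \<noteq> 0" for x
    unfolding U_def using unit[OF that] by (metis (mono_tags, lifting) mem_Collect_eq)
  have ne: "U \<noteq> {}" using inU[OF assms(2) z0] by auto
  have le: "norm (A x) \<le> ?m * norm x" if "x \<in> W" for x
  proof (cases "x = 0")
    case False
    from cSup_upper[OF inU[OF that False] bdd] False show ?thesis by (simp add: field_simps)
  qed (simp add: linear_map_on_zero[OF lin subspace])
  have "c < norm (A z) / norm z" using assms(3) z0 by (simp add: field_simps)
  also have "\<dots> \<le> ?m" by (rule cSup_upper[OF inU[OF assms(2) z0] bdd])
  finally have cm: "c < ?m" .
  then have "2/3 * ?m < ?m" using assms(4) by simp
  then obtain r where "r \<in> U" "2/3 * ?m < r" using less_cSup_iff[OF ne bdd] by blast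
  then show ?thesis using that[OF cm _ _ _ le] unfolding U_def by fastforce
qed

text \<open>
  A quantitative form of the uniform boundedness principle, proved by a gliding hump instead of the
  category theorem: if $\|A_n\| > 4^n$, choose signs in $w = \sum_n \pm 3^{-n}y_n$, with $y_n$
  almost norming for $A_n$, such that the \<open>n\<close>-th step does not decrease $\|A_n x\|$
  below $\|A_n(3^{-n}y_n)\|$. The remaining terms change $A_nw$ too little to compensate, and
  $\|A_nw\|$ grows like $(4/3)^n$.
\<close>

lemma uniform_boundedness:
  assumes A: "\<And>n::nat. bounded_map_on W (A n)"
    and pw: "\<And>x. x \<in> W \<Longrightarrow> \<exists>B. \<forall>n. norm (A n x) \<le> B"
  shows "\<not> (\<forall>n. \<exists>z\<in>W. norm (A n z) > 4 ^ n * norm z)"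
proof
  assume "\<forall>n. \<exists>z\<in>W. norm (A n z) > 4 ^ n * norm z"
  then have "\<exists>m y. 4 ^ n < m \<and> y \<in> W \<and> norm y = 1 \<and> norm (A n y) \<ge> 2/3 * m \<and>
    (\<forall>x\<in>W. norm (A n x) \<le> m * norm x)" for n
    using near_maximal_vector[OF A[of n], where c="4 ^ n"] by (metis zero_le_numeral zero_le_power)
  then obtain m y where m: "\<And>n. (4::real) ^ n < m n" and y: "\<And>n. y n \<in> W" "\<And>n. norm (y n) = 1"
    "\<And>n. norm (A n (y n)) \<ge> 2/3 * m n" and mx: "\<And>n x. x \<in> W \<Longrightarrow> norm (A n x) \<le> m n * norm x"
    by metis
  define v where "v n = (1/3) ^ n *\<^sub>R y n" for n :: nat
  have lin: "linear_map_on W (A n)" for n using A by (simp add: bounded_map_on_def)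
  have v: "v n \<in> W" "norm (v n) = (1/3) ^ n" "norm (A n (v n)) \<ge> 2/3 * m n * (1/3) ^ n" for n
  proof -
    show "v n \<in> W" "norm (v n) = (1/3) ^ n" by (simp_all add: v_def y)
    have "norm (A n (v n)) = (1/3) ^ n * norm (A n (y n))"
      by (simp add: v_def linear_map_onD(3)[OF lin y(1)])
    also have "\<dots> \<ge> (1/3) ^ n * (2/3 * m n)" by (intro mult_left_mono y) auto
    finally show "norm (A n (v n)) \<ge> 2/3 * m n * (1/3) ^ n" by (simp add: mult_ac)
  qed
  \<comment> \<open>One of the two signs works, because $2v_k$ is the difference of the two candidates.\<close>
  define x where "x = rec_nat 0 (\<lambda>k u. if norm (A k (u + v k)) \<ge> norm (A k (u - v k)) then u + v k else u - v k)"
  have x0: "x 0 = 0" and xS: "x (Suc k) = (if norm (A k (x k + v k)) \<ge> norm (A k (x k - v k)) then x k + v k else x k - v k)" for k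
    by (simp_all add: x_def)
  have xW: "x k \<in> W" for k by (induction k) (auto simp: x0 xS v)
  have big: "norm (A k (x (Suc k))) \<ge> norm (A k (v k))" for k
  proof -
    have "2 *\<^sub>R v k = (x k + v k) - (x k - v k)" by (simp add: scaleR_2)
    then have "A k (2 *\<^sub>R v k) = A k (x k + v k) - A k (x k - v k)"
      using linear_map_on_diff[OF lin subspace, of "x k + v k" "x k - v k" k] by (simp add: xW v)
    then have "2 *\<^sub>R A k (v k) = A k (x k + v k) - A k (x k - v k)"
      using linear_map_onD(3)[OF lin v(1)] by simp
    then have "2 * norm (A k (v k)) \<le> norm (A k (x k + v k)) + norm (A k (x k - v k))"
      by (metis abs_numeral norm_scaleR norm_triangle_ineq4)
    then show ?thesis by (auto simp: xS)
  qed
  define d where "d k = x (Suc k) - x k" for k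
  have nd: "norm (d k) = (1/3) ^ k" for k by (simp add: d_def xS v(2))
  have sd: "summable (\<lambda>k. norm (d k))" unfolding nd by (rule summable_geometric) simp
  have xsum: "x k = (\<Sum>j<k. d j)" for k unfolding d_def by (simp add: sum_lessThan_telescope x0)
  have lim: "x \<longlonglongrightarrow> suminf d"
    using summable_LIMSEQ[OF summable_norm_cancel[OF sd]] by (simp add: xsum[abs_def])
  define w where "w = suminf d"
  have wW: "w \<in> W" unfolding w_def using lim by (rule limit_in) (simp_all add: xW)
  have near: "norm (w - x (Suc k)) \<le> 1/2 * (1/3) ^ k" for k
  proof -
    have "w - x (Suc k) = (\<Sum>j. d (j + Suc k))"
      unfolding w_def xsum using suminf_minus_initial_segment[OF summable_norm_cancel[OF sd], of "Suc k"] by simp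
    also have "norm \<dots> \<le> (\<Sum>j. (1/3) ^ Suc k * (1/3) ^ j)"
      by (rule norm_suminf_le) (auto simp: nd power_add intro!: summable_mult summable_geometric)
    also have "\<dots> = (1/3) ^ Suc k * (1 / (1 - 1/3))"
      by (subst suminf_mult) (auto intro!: summable_geometric simp: suminf_geometric)
    finally show ?thesis by simp
  qed
  have grow: "norm (A k w) \<ge> 1/6 * (4/3) ^ k" for k
  proof -
    have mk: "0 < m k" using m[of k] by (meson less_trans zero_less_numeral zero_less_power)
    have "norm (A k (w - x (Suc k))) \<le> m k * (1/2 * (1/3) ^ k)"
      using order_trans[OF mx[OF W_simps(2)[OF wW xW]] mult_left_mono[OF near[of k] less_imp_le[OF mk]]] .
    moreover have "norm (A k (x (Suc k))) \<ge> 2/3 * m k * (1/3) ^ k" using big v(3) order_trans by blast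
    moreover have "A k (w - x (Suc k)) = A k w - A k (x (Suc k))"
      by (rule linear_map_on_diff[OF lin subspace wW xW])
    then have "norm (A k (x (Suc k))) \<le> norm (A k w) + norm (A k (w - x (Suc k)))"
      by (metis norm_minus_commute norm_triangle_sub)
    ultimately have "norm (A k w) \<ge> 1/6 * (m k * (1/3) ^ k)" by simp
    moreover have "m k * (1/3) ^ k \<ge> 4 ^ k * (1/3) ^ k"
      using m[of k] by (intro mult_right_mono) auto
    moreover have "(4::real) ^ k * (1/3) ^ k = (4/3) ^ k" by (simp flip: power_mult_distrib)
    ultimately show ?thesis by linarith
  qed
  obtain B where B: "\<And>n. norm (A n w) \<le> B" using pw[OF wW] by blast
  obtain k where "6 * B < (4/3) ^ k" using real_arch_pow[of "4/3" "6 * B"] by auto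
  with grow[of k] B[of k] show False by simp
qed

text \<open>
  Strong continuity bounds each orbit along a null sequence of times, so large operators at times
  tending to zero would contradict uniform boundedness.
\<close>

lemma C0_bounded_near_zero:
  assumes T: "C0_on W T"
  obtains \<delta> C where "\<delta> > 0" "C \<ge> 1" "\<And>h x. 0 \<le> h \<Longrightarrow> h \<le> \<delta> \<Longrightarrow> x \<in> W \<Longrightarrow> norm (T h x) \<le> C * norm x"
proof -
  have "\<exists>n::nat. \<forall>h. 0 < h \<and> h \<le> 1 / real (Suc n) \<longrightarrow> (\<forall>x\<in>W. norm (T h x) \<le> 4 ^ n * norm x)"
  proof (rule ccontr)
    assume "\<not> ?thesis"
    then have "\<forall>n. \<exists>h. 0 < h \<and> h \<le> 1 / real (Suc n) \<and> (\<exists>x\<in>W. norm (T h x) > 4 ^ n * norm x)"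
      by (meson not_le)
    then obtain h where h: "\<And>n. 0 < h n" "\<And>n. h n \<le> 1 / real (Suc n)"
      "\<And>n. \<exists>x\<in>W. norm (T (h n) x) > 4 ^ n * norm x" by metis
    have "h \<longlonglongrightarrow> 0"
      by (rule tendsto_sandwich[OF _ _ tendsto_const LIMSEQ_Suc[OF lim_1_over_n]])
        (use h in \<open>auto intro!: always_eventually less_imp_le\<close>)
    moreover have "h n \<in> {0<..} \<and> h n \<noteq> 0" for n using h(1)[of n] by simp
    ultimately have hl: "filterlim h (at_right 0) sequentially"
      by (auto simp: filterlim_at intro!: always_eventually)
    have pw: "\<exists>B. \<forall>n. norm (T (h n) x) \<le> B" if "x \<in> W" for x
    proof -
      have "(\<lambda>n. T (h n) x) \<longlonglongrightarrow> x" using C0_onD(6)[OF T that] hl by (rule filterlim_compose)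
      then have "Bseq (\<lambda>n. T (h n) x)" using convergent_def convergent_imp_Bseq by blast
      then show ?thesis by (auto simp: Bseq_def)
    qed
    show False
      using uniform_boundedness[of "\<lambda>n. T (h n)"] C0_onD(1)[OF T less_imp_le[OF h(1)]] pw h(3) by blast
  qed
  then obtain n :: nat where n: "\<And>h x. 0 < h \<Longrightarrow> h \<le> 1 / real (Suc n) \<Longrightarrow> x \<in> W \<Longrightarrow> norm (T h x) \<le> 4 ^ n * norm x"
    by blast
  have "norm (T h x) \<le> 4 ^ n * norm x" if "0 \<le> h" "h \<le> 1 / real (Suc n)" "x \<in> W" for h x
  proof (cases "h = 0")
    case True
    then show ?thesis using C0_onD(4)[OF T that(3)] mult_right_mono[of 1 "4 ^ n" "norm x"] by simp
  qed (use n that in auto)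
  then show ?thesis by (intro that[of "1 / real (Suc n)" "4 ^ n"]) auto
qed

lemma C0_locally_bounded:
  assumes T: "C0_on W T" and "0 \<le> t"
  obtains C where "C \<ge> 0" "\<And>s x. 0 \<le> s \<Longrightarrow> s \<le> t \<Longrightarrow> x \<in> W \<Longrightarrow> norm (T s x) \<le> C * norm x"
proof -
  obtain \<delta> C where C: "\<delta> > 0" "C \<ge> 1" "\<And>h x. 0 \<le> h \<Longrightarrow> h \<le> \<delta> \<Longrightarrow> x \<in> W \<Longrightarrow> norm (T h x) \<le> C * norm x"
    using C0_bounded_near_zero[OF T] by blast
  have step: "norm (T (real k * h) x) \<le> C ^ k * norm x" if "0 \<le> h" "h \<le> \<delta>" "x \<in> W" for k h x
  proof (induction k)
    case 0 then show ?case by (simp add: C0_onD(4)[OF T that(3)])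
  next
    case (Suc k)
    have "T (real (Suc k) * h) x = T h (T (real k * h) x)"
      using C0_onD(5)[OF T that(1) _ that(3), of "real k * h"] that(1) by (simp add: algebra_simps)
    also have "norm \<dots> \<le> C * norm (T (real k * h) x)"
      using C(3)[OF that(1,2)] C0_onD(3)[OF T _ that(3)] that(1) by simp
    also have "\<dots> \<le> C * (C ^ k * norm x)" using Suc C(2) by (intro mult_left_mono) auto
    finally show ?case by simp
  qed
  obtain m :: nat where m: "t / \<delta> < real m" using reals_Archimedean2 by blast
  have m0: "real m > 0" using m assms(2) C(1) by (meson divide_nonneg_pos order_le_less_trans)
  show ?thesis
  proof (rule that[of "C ^ m"])
    fix s x assume s: "0 \<le> s" "s \<le> t" "x \<in> W"
    have "s \<le> \<delta> * real m" using m C(1) s(2) by (simp add: field_simps)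
    then have "s / real m \<le> \<delta>" using m0 by (simp add: field_simps)
    from step[OF _ this s(3), of m] s(1) m0 show "norm (T s x) \<le> C ^ m * norm x" by simp
  qed (use C in auto)
qed

text \<open>
  Telescoping with step \<open>h = t/n\<close>: two commuting semigroups differ at time
  \<open>t\<close> by \<open>n\<close> terms, each the difference at time \<open>h\<close> with
  bounded operators applied. Only the behaviour of $(T_h - S_h)x/h$ as $h\to0$ enters, so that no
  integral of vector-valued functions is needed.
\<close>

lemma semigroup_comparison:
  assumes T: "C0_on W T" and S: "C0_on W S" and t: "0 < t"
    and T_bd: "\<And>s x. 0 \<le> s \<Longrightarrow> s \<le> t \<Longrightarrow> x \<in> W \<Longrightarrow> norm (T s x) \<le> C * norm x" and "C \<ge> 0"
    and S_bd: "\<And>s x. 0 \<le> s \<Longrightarrow> x \<in> W \<Longrightarrow> norm (S s x) \<le> norm x"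
    and comm: "\<And>s r x. 0 \<le> s \<Longrightarrow> 0 \<le> r \<Longrightarrow> x \<in> W \<Longrightarrow> T s (S r x) = S r (T s x)"
    and x: "x \<in> W" and lim: "((\<lambda>h. (T h x - S h x) /\<^sub>R h) \<longlongrightarrow> g) (at_right 0)"
  shows "norm (T t x - S t x) \<le> C * t * norm g"
proof -
  have step: "norm (T (real j * h) x - S (real j * h) x) \<le> real j * C * norm (T h x - S h x)"
    if "0 \<le> h" "real j * h \<le> t" for j h
    using that(2)
  proof (induction j)
    case 0 then show ?case by (simp add: C0_onD(4)[OF T x] C0_onD(4)[OF S x])
  next
    case (Suc j)
    have jh: "0 \<le> real j * h" "real j * h \<le> t" using Suc.prems that(1) by (auto simp: algebra_simps)
    have h': "real (Suc j) * h = real j * h + h" by (simp add: algebra_simps)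
    have inW: "T h x \<in> W" "S h x \<in> W" "T (real j * h) x \<in> W" "S (real j * h) x \<in> W"
      using C0_onD(3)[OF T _ x] C0_onD(3)[OF S _ x] that(1) jh by auto
    have "T (real (Suc j) * h) x - S (real (Suc j) * h) x
        = T (real j * h) (T h x) - S h (S (real j * h) x)"
      unfolding h' using C0_onD(5)[OF T jh(1) that(1) x] C0_onD(5)[OF S that(1) jh(1) x]
      by (simp add: add.commute)
    also have "\<dots> = T (real j * h) (T h x - S h x) + S h (T (real j * h) x - S (real j * h) x)"
      using linear_map_on_diff[OF C0_onD(2)[OF T jh(1)] subspace inW(1,2)]
        linear_map_on_diff[OF C0_onD(2)[OF S that(1)] subspace inW(3,4)] comm[OF jh(1) that(1) x]
      by simp
    also have "norm \<dots> \<le> C * norm (T h x - S h x) + real j * C * norm (T h x - S h x)"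
      using T_bd[OF jh, of "T h x - S h x"] S_bd[OF that(1), of "T (real j * h) x - S (real j * h) x"]
        Suc.IH[OF jh(2)] inW by (intro norm_triangle_le add_mono) auto
    finally show ?case by (simp add: algebra_simps)
  qed
  let ?h = "\<lambda>n. t / real (Suc n)"
  have "norm (T t x - S t x) \<le> C * t * norm ((T (?h n) x - S (?h n) x) /\<^sub>R ?h n)" for n
  proof -
    have h: "0 < ?h n" "real (Suc n) * ?h n = t" using t by simp_all
    have "norm (T t x - S t x) \<le> real (Suc n) * C * norm (T (?h n) x - S (?h n) x)"
      using step[of "?h n" "Suc n"] h(1) unfolding h(2) by simp
    also have "\<dots> = C * (real (Suc n) * ?h n) * (norm (T (?h n) x - S (?h n) x) / ?h n)"
      using t by (simp only: times_divide_eq_right) simp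
    also have "norm (T (?h n) x - S (?h n) x) / ?h n = norm ((T (?h n) x - S (?h n) x) /\<^sub>R ?h n)"
      using h(1) by (simp only: norm_scaleR divide_inverse abs_inverse) simp
    finally show ?thesis unfolding h(2) .
  qed
  moreover have "(\<lambda>n. C * t * norm ((T (?h n) x - S (?h n) x) /\<^sub>R ?h n)) \<longlonglongrightarrow> C * t * norm g"
  proof (intro tendsto_intros filterlim_compose[OF lim])
    have "?h \<longlonglongrightarrow> t * 0"
      using tendsto_mult[OF tendsto_const[of t] LIMSEQ_Suc[OF lim_1_over_n]] by simp
    then show "filterlim ?h (at_right 0) sequentially"
      using t by (auto simp: filterlim_at intro!: always_eventually)
  qed
  ultimately show ?thesis by (intro LIMSEQ_le_const) auto
qed

lemma norm_add_diff_le: "norm (a + b - c) \<le> norm a + norm b + norm (c :: 'b)"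
  using norm_triangle_ineq4[of "a + b" c] norm_triangle_ineq[of a b] by linarith

text \<open>
  The usual argument with thirds of \<open>e\<close>: contractions do not enlarge the error made in
  replacing \<open>x\<close> by \<open>u\<close>.
\<close>

lemma tendsto_dense:
  assumes "\<forall>\<^sub>F i in F. contraction_on W (f i)" "contraction_on W g" "x \<in> W"
    and dense: "\<And>e. e > 0 \<Longrightarrow> \<exists>u\<in>W. norm (x - u) < e \<and> ((\<lambda>i. f i u) \<longlongrightarrow> g u) F"
  shows "((\<lambda>i. f i x) \<longlongrightarrow> g x) F"
proof (rule tendstoI)
  fix e :: real assume "e > 0"
  then obtain u where u: "u \<in> W" "norm (x - u) < e / 3" "((\<lambda>i. f i u) \<longlongrightarrow> g u) F"
    using dense[of "e / 3"] by auto
  have "\<forall>\<^sub>F i in F. dist (f i u) (g u) < e / 3" using u(3) \<open>e > 0\<close> by (intro tendstoD) auto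
  with assms(1) show "\<forall>\<^sub>F i in F. dist (f i x) (g x) < e"
  proof eventually_elim
    case (elim i)
    have "norm (f i x - f i u) \<le> norm (x - u)" "norm (g x - g u) \<le> norm (x - u)"
      using contraction_onD(2)[OF elim(1) W_simps(2)[OF assms(3) u(1)]]
        contraction_onD(2)[OF assms(2) W_simps(2)[OF assms(3) u(1)]]
      by (simp_all only: linear_map_on_diff[OF contraction_onD(1)[OF elim(1)] subspace assms(3) u(1)]
        linear_map_on_diff[OF contraction_onD(1)[OF assms(2)] subspace assms(3) u(1)])
    moreover have "norm (f i x - g x) \<le> norm (f i x - f i u) + norm (f i u - g u) + norm (g x - g u)"
      using norm_add_diff_le[of "f i x - f i u" "f i u - g u" "g x - g u"] by simp
    ultimately show ?case using elim(2) u(2) by (simp add: dist_norm)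
  qed
qed

text \<open>
  If the generators agree at enough vectors, the difference quotient in the comparison of the two
  semigroups tends to zero. The bound that the comparison asks of \<open>T\<close> comes from the
  uniform boundedness principle.
\<close>

lemma generator_unique:
  assumes T: "C0_on W T" and S: "C0_on W S"
    and S_bd: "\<And>s x. 0 \<le> s \<Longrightarrow> x \<in> W \<Longrightarrow> norm (S s x) \<le> norm x"
    and comm: "\<And>s r x. 0 \<le> s \<Longrightarrow> 0 \<le> r \<Longrightarrow> x \<in> W \<Longrightarrow> T s (S r x) = S r (T s x)"
    and dense: "\<And>x e. x \<in> W \<Longrightarrow> e > 0 \<Longrightarrow> \<exists>u g. norm (x - u) < e \<and> generator_on W T u g \<and> generator_on W S u g"
    and x: "x \<in> W" and t: "0 \<le> t"
  shows "T t x = S t x"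
proof (cases "t = 0")
  case True then show ?thesis by (simp add: C0_onD(4)[OF T x] C0_onD(4)[OF S x])
next
  case False
  with t have t: "0 < t" by simp
  obtain C where C: "C \<ge> 0" "\<And>s x. 0 \<le> s \<Longrightarrow> s \<le> t \<Longrightarrow> x \<in> W \<Longrightarrow> norm (T s x) \<le> C * norm x"
    using C0_locally_bounded[OF T less_imp_le[OF t]] by blast
  have eq: "T t u = S t u" if g: "generator_on W T u g" "generator_on W S u g" for u g
  proof -
    have "((\<lambda>h. (T h u - u) /\<^sub>R h - (S h u - u) /\<^sub>R h) \<longlongrightarrow> g - g) (at_right 0)"
      using g by (intro tendsto_diff) (auto simp: generator_on_def)
    then have "((\<lambda>h. (T h u - S h u) /\<^sub>R h) \<longlongrightarrow> 0) (at_right 0)"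
      by (simp flip: scaleR_diff_right)
    from semigroup_comparison[OF T S t C(2,1) S_bd comm _ this] g show ?thesis
      by (auto simp: generator_on_def)
  qed
  have "norm (T t x - S t x) \<le> 0 + e" if "e > 0" for e
  proof -
    have "0 < e / (C + 1)" using that C(1) by simp
    then obtain u g where u: "norm (x - u) < e / (C + 1)" "generator_on W T u g" "generator_on W S u g"
      using dense[OF x] by blast
    then have uW: "u \<in> W" by (simp add: generator_on_def)
    have "T t x - S t x = T t (x - u) - S t (x - u)"
      using eq[OF u(2,3)] linear_map_on_diff[OF C0_onD(2)[OF T] subspace x uW]
        linear_map_on_diff[OF C0_onD(2)[OF S] subspace x uW] t by simp
    also have "norm \<dots> \<le> C * norm (x - u) + norm (x - u)"
      using C(2)[of t "x - u"] S_bd[of t "x - u"] t x uW by (intro norm_triangle_le_diff add_mono) auto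
    also have "\<dots> = (C + 1) * norm (x - u)" by (simp add: algebra_simps)
    also have "\<dots> \<le> e" using u(1) C(1) by (simp add: field_simps)
    finally show ?thesis by simp
  qed
  then have "norm (T t x - S t x) \<le> 0" by (rule field_le_epsilon)
  then show ?thesis by simp
qed

text \<open>
  A semigroup commutes with its generator. This is what makes it commute with everything that is
  built from the generator, such as resolvents.
\<close>

lemma generator_invariant:
  assumes T: "C0_on W T" and g: "generator_on W T x g" and t: "0 \<le> t"
  shows "generator_on W T (T t x) (T t g)"
proof -
  have x: "x \<in> W" "g \<in> W" and lim0: "((\<lambda>h. (T h x - x) /\<^sub>R h) \<longlongrightarrow> g) (at_right 0)"
    using g unfolding generator_on_def by blast+
  have "\<forall>\<^sub>F h in at_right 0. (T h x - x) /\<^sub>R h = (if 0 < h then (T h x - x) /\<^sub>R h else x)"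
    using eventually_at_right_less[of "0::real"] by eventually_elim simp
  with lim0 have lim: "((\<lambda>h. if 0 < h then (T h x - x) /\<^sub>R h else x) \<longlongrightarrow> g) (at_right 0)"
    by (rule Lim_transform_eventually)
  have "((\<lambda>h. T t (if 0 < h then (T h x - x) /\<^sub>R h else x)) \<longlongrightarrow> T t g) (at_right 0)"
    by (rule bounded_map_on_tendsto[OF C0_onD(1)[OF T t] subspace _ x(2) lim])
      (use x C0_onD(3)[OF T] in auto)
  moreover have "\<forall>\<^sub>F h in at_right 0. T t (if 0 < h then (T h x - x) /\<^sub>R h else x) = (T h (T t x) - T t x) /\<^sub>R h"
    unfolding eventually_at_filter
  proof (intro always_eventually allI impI)
    fix h :: real assume "h \<in> {0<..}"
    then have h: "0 < h" by simp
    have Th: "T h x \<in> W" using C0_onD(3)[OF T _ x(1)] h by simp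
    have "T t (T h x) = T h (T t x)"
      using C0_onD(5)[OF T t _ x(1), of h] C0_onD(5)[OF T _ t x(1), of h] h by (simp add: add.commute)
    then show "T t (if 0 < h then (T h x - x) /\<^sub>R h else x) = (T h (T t x) - T t x) /\<^sub>R h"
      using h linear_map_onD(3)[OF C0_onD(2)[OF T t], of "T h x - x"]
        linear_map_on_diff[OF C0_onD(2)[OF T t] subspace Th x(1)] Th x by simp
  qed
  ultimately show ?thesis
    using x C0_onD(3)[OF T t] unfolding generator_on_def by (blast intro: Lim_transform_eventually)
qed

lemma poisson_C0:
  assumes A: "contraction_on W A" and c: "0 \<le> c"
  shows "C0_on W (\<lambda>t. poisson A (c * t))"
  unfolding C0_on_def
proof (intro conjI allI impI ballI)
  show "bounded_map_on W (poisson A (c * t))" if "0 \<le> t" for t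
    using that c by (intro contraction_on_bounded poisson_contraction A) simp
  show "poisson A (c * 0) x = x" if "x \<in> W" for x
    using poisson_zero[OF A that] by simp
  show "poisson A (c * (s + t)) x = poisson A (c * s) (poisson A (c * t) x)"
    if "0 \<le> s" "0 \<le> t" "x \<in> W" for s t x
    using poisson_add[OF A _ _ that(3), of "c * s" "c * t"] that c by (simp add: distrib_left)
  show "((\<lambda>h. poisson A (c * h) x) \<longlongrightarrow> x) (at_right 0)" if "x \<in> W" for x
  proof (rule LIM_zero_cancel, rule Lim_null_comparison)
    show "\<forall>\<^sub>F h in at_right 0. norm (poisson A (c * h) x - x) \<le> c * h * norm (x - A x)"
      unfolding eventually_at_filter
      using poisson_first_order[OF A _ that] c by (auto intro!: always_eventually)
    have "((\<lambda>h. c * h * norm (x - A x)) \<longlongrightarrow> c * 0 * norm (x - A x)) (at_right 0)"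
      by (intro tendsto_intros)
    then show "((\<lambda>h. c * h * norm (x - A x)) \<longlongrightarrow> 0) (at_right 0)" by simp
  qed
qed

lemma poisson_generator:
  assumes A: "contraction_on W A" and c: "0 \<le> c" and x: "x \<in> W"
  shows "generator_on W (\<lambda>t. poisson A (c * t)) x (- (c *\<^sub>R (x - A x)))"
  unfolding generator_on_def
proof (intro conjI x)
  show "- (c *\<^sub>R (x - A x)) \<in> W"
    using contraction_onD(3)[OF A x] x subspace by (auto simp: subspace_neg)
  let ?C = "norm ((x - A x) - A (x - A x))"
  show "((\<lambda>h. (poisson A (c * h) x - x) /\<^sub>R h) \<longlongrightarrow> - (c *\<^sub>R (x - A x))) (at_right 0)"
  proof (rule LIM_zero_cancel, rule Lim_null_comparison)
    show "\<forall>\<^sub>F h in at_right 0. norm ((poisson A (c * h) x - x) /\<^sub>R h - - (c *\<^sub>R (x - A x))) \<le> c\<^sup>2 * h / 2 * ?C"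
      unfolding eventually_at_filter
    proof (intro always_eventually allI impI)
      fix h :: real assume "h \<in> {0<..}"
      then have h: "0 < h" by simp
      have "(poisson A (c * h) x - x) /\<^sub>R h - - (c *\<^sub>R (x - A x))
        = (poisson A (c * h) x - x + (c * h) *\<^sub>R (x - A x)) /\<^sub>R h"
        using h by (simp add: scaleR_add_right)
      also have "norm \<dots> \<le> ((c * h)\<^sup>2 / 2 * ?C) / h"
        using divide_right_mono[OF poisson_second_order[OF A _ x, of "c * h"] less_imp_le[OF h]] c h
        by (simp only: norm_scaleR abs_inverse abs_of_pos divide_inverse mult_ac) simp
      also have "\<dots> = c\<^sup>2 * h / 2 * ?C" using h by (simp add: power2_eq_square)
      finally show "norm ((poisson A (c * h) x - x) /\<^sub>R h - - (c *\<^sub>R (x - A x))) \<le> c\<^sup>2 * h / 2 * ?C" .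
    qed
    have "((\<lambda>h. c\<^sup>2 * h / 2 * ?C) \<longlongrightarrow> c\<^sup>2 * 0 / 2 * ?C) (at_right 0)"
      by (intro tendsto_intros) auto
    then show "((\<lambda>h. c\<^sup>2 * h / 2 * ?C) \<longlongrightarrow> 0) (at_right 0)" by simp
  qed
qed

text \<open>
  A semigroup whose generator is $-c(1-A)$ commutes with the generator, hence with \<open>A\<close>
  and with the Poisson mixtures of \<open>A\<close>, so that the two semigroups can be compared.
\<close>

lemma poisson_unique:
  assumes A: "contraction_on W A" and c: "0 < c" and T: "C0_on W T"
    and gen: "\<And>x. x \<in> W \<Longrightarrow> generator_on W T x (- (c *\<^sub>R (x - A x)))"
    and "x \<in> W" "0 \<le> t"
  shows "T t x = poisson A (c * t) x"
proof (rule generator_unique[OF T poisson_C0[OF A less_imp_le[OF c]] _ _ _ assms(5,6)])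
  show "norm (poisson A (c * s) x) \<le> norm x" if "0 \<le> s" "x \<in> W" for s x
    using contraction_onD(2)[OF poisson_contraction[OF A] that(2)] that c by simp
  show "T s (poisson A (c * r) x) = poisson A (c * r) (T s x)" if s: "0 \<le> s" "0 \<le> r" "x \<in> W" for s r x
  proof (rule poisson_commute[OF A _ C0_onD(1)[OF T s(1)] _ s(3)])
    fix y assume y: "y \<in> W"
    note Ty = C0_onD(3)[OF T s(1) y] and Ay = contraction_onD(3)[OF A y]
    have "T s (- (c *\<^sub>R (y - A y))) = - (c *\<^sub>R (T s y - A (T s y)))"
      using generator_invariant[OF T gen[OF y] s(1)] gen[OF Ty]
      unfolding generator_on_def by (meson tendsto_unique trivial_limit_at_right_real)
    moreover have "T s (- (c *\<^sub>R (y - A y))) = - (c *\<^sub>R (T s y - T s (A y)))"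
      using linear_map_onD(3)[OF C0_onD(2)[OF T s(1)], of "y - A y" "-c"]
        linear_map_on_diff[OF C0_onD(2)[OF T s(1)] subspace y Ay] y Ay by simp
    ultimately show "T s (A y) = A (T s y)" using c by simp
  qed (use s c in auto)
  show "\<exists>u g. norm (x - u) < e \<and> generator_on W T u g \<and> generator_on W (\<lambda>t. poisson A (c * t)) u g"
    if "x \<in> W" "e > 0" for x e
    using gen[OF that(1)] poisson_generator[OF A less_imp_le[OF c] that(1)] that(2)
    by (intro exI[of _ x] exI[of _ "- (c *\<^sub>R (x - A x))"]) simp
qed

end

section \<open>From resolvents to semigroups\<close>

text \<open>
  The data of the Hille-Yosida theorem: a strongly continuous contraction resolvent. Density of the
  domain is expressed by the strong convergence of $\beta K_\beta$ to the identity.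
\<close>

locale resolvent_family = closed_subspace W for W :: "'b::banach set" +
  fixes K :: "real \<Rightarrow> 'b \<Rightarrow> 'b"
  assumes K_linear: "0 < \<beta> \<Longrightarrow> linear_map_on W (K \<beta>)"
    and K_norm: "0 < \<beta> \<Longrightarrow> x \<in> W \<Longrightarrow> norm (\<beta> *\<^sub>R K \<beta> x) \<le> norm x"
    and K_resolvent: "0 < \<beta> \<Longrightarrow> 0 < \<gamma> \<Longrightarrow> x \<in> W \<Longrightarrow> K \<gamma> x = K \<beta> x + (\<beta> - \<gamma>) *\<^sub>R K \<beta> (K \<gamma> x)"
    and K_approx: "x \<in> W \<Longrightarrow> ((\<lambda>\<beta>. \<beta> *\<^sub>R K \<beta> x) \<longlongrightarrow> x) at_top"
begin

abbreviation A :: "real \<Rightarrow> 'b \<Rightarrow> 'b" where "A \<beta> x \<equiv> \<beta> *\<^sub>R K \<beta> x"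

text \<open>
  The graph of the operator \<open>L\<close> with $K_\beta = (L+\beta)^{-1}$, read off from the
  resolvent at \<open>\<beta> = 1\<close>.
\<close>

definition L_rel :: "'b \<Rightarrow> 'b \<Rightarrow> bool" where
  "L_rel u f \<longleftrightarrow> u \<in> W \<and> f \<in> W \<and> u = K 1 (f + u)"

text \<open>
  The semigroup generated by $-\beta(1-\beta K_\beta)$, the Yosida approximation of
  \<open>-L\<close>.
\<close>

definition P :: "real \<Rightarrow> real \<Rightarrow> 'b \<Rightarrow> 'b" where
  "P \<beta> t = poisson (A \<beta>) (\<beta> * t)"

definition T :: "real \<Rightarrow> 'b \<Rightarrow> 'b" where
  "T t x = lim (\<lambda>n. P (real (Suc n)) t x)"

lemma K_in: "0 < \<beta> \<Longrightarrow> x \<in> W \<Longrightarrow> K \<beta> x \<in> W"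
  using K_linear linear_map_onD(1) by blast

lemmas K_add = linear_map_onD(2)[OF K_linear]
lemmas K_scale = linear_map_onD(3)[OF K_linear]
lemmas K_diff = linear_map_on_diff[OF K_linear subspace]

lemma K_commute: 
  assumes "0 < \<beta>" "0 < \<gamma>" "x \<in> W" shows "K \<beta> (K \<gamma> x) = K \<gamma> (K \<beta> x)"
proof (cases "\<beta> = \<gamma>")
  case False
  have "(\<beta> - \<gamma>) *\<^sub>R K \<beta> (K \<gamma> x) = K \<gamma> x - K \<beta> x"
    using K_resolvent[OF assms] by (metis add_diff_cancel_left')
  moreover have "(\<beta> - \<gamma>) *\<^sub>R K \<gamma> (K \<beta> x) = K \<gamma> x - K \<beta> x"
    using K_resolvent[OF assms(2,1,3)] by (metis add_diff_cancel_left' minus_diff_eq scaleR_minus_left)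
  ultimately show ?thesis using False
    by (metis eq_iff_diff_eq_0 scaleR_cancel_left)
qed simp

lemma A_contraction: assumes "0 < \<beta>" shows "contraction_on W (A \<beta>)"
  unfolding contraction_on_def linear_map_on_def using K_norm[OF assms]
  by (auto simp: K_in K_add K_scale assms scaleR_add_right)

lemma A_in: "0 < \<beta> \<Longrightarrow> x \<in> W \<Longrightarrow> A \<beta> x \<in> W"
  by (simp add: K_in)

lemma L_rel_in: "L_rel u f \<Longrightarrow> u \<in> W" "L_rel u f \<Longrightarrow> f \<in> W"
  by (auto simp: L_rel_def)

lemma L_rel_scale: "L_rel u f \<Longrightarrow> L_rel (c *\<^sub>R u) (c *\<^sub>R f)"
  unfolding L_rel_def using K_scale[of 1 "f + u" c] by (auto simp: scaleR_add_right)

lemma L_rel_resolvent: 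
  assumes "L_rel u f" "0 < \<beta>" shows "u = K \<beta> (f + \<beta> *\<^sub>R u)"
proof -
  have W: "u \<in> W" "f \<in> W" and u: "u = K 1 (f + u)" using assms(1) by (auto simp: L_rel_def)
  have "u = K \<beta> (f + u) + (\<beta> - 1) *\<^sub>R K \<beta> u"
    using K_resolvent[OF assms(2), of 1 "f + u"] W u by simp
  also have "\<dots> = K \<beta> (f + \<beta> *\<^sub>R u)"
    using W by (simp add: K_add K_scale assms(2) algebra_simps)
  finally show ?thesis .
qed

lemma L_rel_K: assumes "x \<in> W" "0 < \<beta>" shows "L_rel (K \<beta> x) (x - A \<beta> x)"
proof -
  have "K \<beta> x = K 1 x + (1 - \<beta>) *\<^sub>R K 1 (K \<beta> x)"
    using K_resolvent[of 1 \<beta> x] assms by simp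
  also have "\<dots> = K 1 (x - A \<beta> x + K \<beta> x)"
    using assms by (simp add: K_add K_scale K_diff K_in scaleR_diff_left)
  finally show ?thesis using assms by (simp add: L_rel_def K_in)
qed

text \<open>
  On the domain the Yosida approximation is $\beta K_\beta L$. This is a contraction applied to
  \<open>Lu\<close>, and it tends to \<open>Lu\<close>.
\<close>

lemma yosida_L: assumes "L_rel u f" "0 < \<beta>" shows "\<beta> *\<^sub>R (u - A \<beta> u) = A \<beta> f"
proof -
  have "u = K \<beta> f + A \<beta> u"
    using L_rel_resolvent[OF assms] L_rel_in[OF assms(1)] by (simp add: K_add K_scale assms(2))
  then have "u - A \<beta> u = K \<beta> f" by (metis add_diff_cancel_right')
  then show ?thesis by simp
qed

lemma L_rel_A: assumes "L_rel u f" "0 < \<beta>" shows "L_rel (A \<beta> u) (A \<beta> f)"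
  using L_rel_scale[OF L_rel_K[OF L_rel_in(1)[OF assms(1)] assms(2)], of \<beta>] yosida_L[OF assms] by simp

lemma L_rel_dense: assumes "x \<in> W" "e > 0" shows "\<exists>u f. L_rel u f \<and> norm (x - u) < e"
proof -
  have "\<forall>\<^sub>F \<beta> in at_top. norm (x - A \<beta> x) < e \<and> \<beta> > 0"
    using tendstoD[OF K_approx[OF assms(1)] assms(2)] eventually_gt_at_top[of "0::real"]
    by eventually_elim (simp add: dist_norm norm_minus_commute)
  then obtain \<beta> where "norm (x - A \<beta> x) < e" "\<beta> > 0"
    using eventually_happens trivial_limit_at_top_linorder by blast
  then show ?thesis using L_rel_scale[OF L_rel_K[OF assms(1)]] by blast
qed

lemma P_contraction: "0 < \<beta> \<Longrightarrow> 0 \<le> t \<Longrightarrow> contraction_on W (P \<beta> t)"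
  unfolding P_def by (intro poisson_contraction A_contraction) auto

lemma P_C0: "0 < \<beta> \<Longrightarrow> C0_on W (P \<beta>)"
  unfolding P_def using poisson_C0[OF A_contraction] by (simp add: less_imp_le)

lemma P_comm:
  assumes "0 < \<beta>" "0 \<le> t" "bounded_map_on W B" "\<And>x. x \<in> W \<Longrightarrow> B (K \<beta> x) = K \<beta> (B x)" "x \<in> W"
  shows "B (P \<beta> t x) = P \<beta> t (B x)"
  unfolding P_def
proof (rule poisson_commute[OF A_contraction])
  have "linear_map_on W B" using assms(3) by (simp add: bounded_map_on_def)
  then show "B (A \<beta> x) = A \<beta> (B x)" if "x \<in> W" for x
    using assms(4)[OF that] linear_map_onD(3)[of W B "K \<beta> x" \<beta>] K_in[OF assms(1) that] by simp
qed (use assms in auto)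

lemma P_commute:
  assumes "0 < \<beta>" "0 < \<gamma>" "0 \<le> t" "0 \<le> s" "x \<in> W"
  shows "P \<beta> s (P \<gamma> t x) = P \<gamma> t (P \<beta> s x)"
proof (rule P_comm[OF assms(2,3) _ _ assms(5)])
  show "bounded_map_on W (P \<beta> s)" using P_contraction assms contraction_on_bounded by blast
  show "P \<beta> s (K \<gamma> y) = K \<gamma> (P \<beta> s y)" if "y \<in> W" for y
  proof (rule P_comm[OF assms(1,4) _ _ that, symmetric])
    have "norm (K \<gamma> x) \<le> 1 / \<gamma> * norm x" if "x \<in> W" for x
      using K_norm[OF assms(2) that] assms(2) by (simp add: field_simps)
    then show "bounded_map_on W (K \<gamma>)"
      unfolding bounded_map_on_def using K_linear assms(2) by blast
  qed (use assms K_commute in auto)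
qed

text \<open>
  Instance of the comparison of semigroups; the Yosida semigroups commute because the resolvents do.
\<close>

lemma P_diff:
  assumes "L_rel u f" "0 < \<beta>" "0 < \<gamma>" "0 \<le> t"
  shows "norm (P \<beta> t u - P \<gamma> t u) \<le> t * norm (A \<beta> f - A \<gamma> f)"
proof (cases "t = 0")
  case True
  then show ?thesis using C0_onD(4)[OF P_C0] L_rel_in[OF assms(1)] assms by simp
next
  case False
  with assms(4) have t: "0 < t" by simp
  have u: "u \<in> W" by (rule L_rel_in[OF assms(1)])
  have "norm (P \<gamma> t u - P \<beta> t u) \<le> 1 * t * norm (A \<beta> f - A \<gamma> f)"
  proof (rule semigroup_comparison[OF P_C0[OF assms(3)] P_C0[OF assms(2)] t])
    show "((\<lambda>h. (P \<gamma> h u - P \<beta> h u) /\<^sub>R h) \<longlongrightarrow> A \<beta> f - A \<gamma> f) (at_right 0)"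
    proof -
      have "((\<lambda>h. (P \<gamma> h u - u) /\<^sub>R h - (P \<beta> h u - u) /\<^sub>R h) \<longlongrightarrow> - A \<gamma> f - - A \<beta> f) (at_right 0)"
        using poisson_generator[OF A_contraction[OF assms(3)] _ u, of \<gamma>] 
          poisson_generator[OF A_contraction[OF assms(2)] _ u, of \<beta>] assms
        unfolding generator_on_def P_def[symmetric] 
        by (intro tendsto_diff) (simp_all add: yosida_L)
      then show ?thesis by (simp flip: scaleR_diff_right)
    qed
    show "norm (P \<gamma> s x) \<le> 1 * norm x" if "0 \<le> s" "s \<le> t" "x \<in> W" for s x
      using contraction_onD(2)[OF P_contraction[OF assms(3) that(1)] that(3)] by simp
  qed (use assms u P_commute contraction_onD(2)[OF P_contraction] in auto)
  then show ?thesis by (simp add: norm_minus_commute)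
qed

lemma filterlim_Suc_at_top: "filterlim (\<lambda>n. real (Suc n)) at_top sequentially"
  by (rule filterlim_compose[OF filterlim_real_sequentially filterlim_Suc])

lemma P_convergent:
  assumes "x \<in> W" "0 \<le> t" shows "convergent (\<lambda>n. P (real (Suc n)) t x)"
proof (rule Cauchy_convergent, rule CauchyI)
  fix e :: real assume e: "e > 0"
  obtain u f where u: "L_rel u f" "norm (x - u) < e / 4" using L_rel_dense[OF assms(1), of "e/4"] e by auto
  have uf: "u \<in> W" "f \<in> W" using L_rel_in[OF u(1)] by auto
  have "(\<lambda>n. A (real (Suc n)) f) \<longlonglongrightarrow> f"
    by (rule filterlim_compose[OF K_approx[OF uf(2)] filterlim_Suc_at_top])
  then have "Cauchy (\<lambda>n. A (real (Suc n)) f)" by (rule LIMSEQ_imp_Cauchy)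
  moreover have "e / (2 * (t + 1)) > 0" using e assms(2) by simp
  ultimately obtain N where N: "\<And>m n. m \<ge> N \<Longrightarrow> n \<ge> N \<Longrightarrow> norm (A (real (Suc m)) f - A (real (Suc n)) f) < e / (2 * (t + 1))"
    by (meson CauchyD)
  show "\<exists>N. \<forall>m\<ge>N. \<forall>n\<ge>N. norm (P (real (Suc m)) t x - P (real (Suc n)) t x) < e"
  proof (intro exI[of _ N] allI impI)
    fix m n assume mn: "N \<le> m" "N \<le> n"
    have c: "norm (P (real (Suc k)) t x - P (real (Suc k)) t u) < e / 4" for k
    proof -
      have C: "contraction_on W (P (real (Suc k)) t)" using P_contraction assms(2) by simp
      have "norm (P (real (Suc k)) t (x - u)) < e / 4"
        using contraction_onD(2)[OF C, of "x - u"] u(2) assms(1) uf(1) by fastforce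
      then show ?thesis
        using linear_map_on_diff[OF contraction_onD(1)[OF C] subspace assms(1) uf(1)] by simp
    qed
    have "norm (P (real (Suc m)) t u - P (real (Suc n)) t u) \<le> t * norm (A (real (Suc m)) f - A (real (Suc n)) f)"
      using P_diff[OF u(1)] assms(2) by simp
    also have "\<dots> \<le> (t + 1) * (e / (2 * (t + 1)))"
      using N[OF mn] assms(2) by (intro mult_mono) auto
    also have "\<dots> = e / 2"
    proof -
      have "r * (e / (2 * r)) = e / 2" if "0 < r" for r :: real using that by simp
      from this[of "t + 1"] assms(2) show ?thesis by simp
    qed
    finally have "norm (P (real (Suc m)) t u - P (real (Suc n)) t u) \<le> e / 2" .
    then have "norm ((P (real (Suc m)) t x - P (real (Suc m)) t u) + (P (real (Suc m)) t u - P (real (Suc n)) t u)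
        - (P (real (Suc n)) t x - P (real (Suc n)) t u)) < e"
      using c[of m] c[of n] norm_add_diff_le[of "P (real (Suc m)) t x - P (real (Suc m)) t u"
          "P (real (Suc m)) t u - P (real (Suc n)) t u" "P (real (Suc n)) t x - P (real (Suc n)) t u"]
      by linarith
    then show "norm (P (real (Suc m)) t x - P (real (Suc n)) t x) < e" by simp
  qed
qed

lemma P_tendsto_seq: "x \<in> W \<Longrightarrow> 0 \<le> t \<Longrightarrow> (\<lambda>n. P (real (Suc n)) t x) \<longlonglongrightarrow> T t x"
  unfolding T_def using P_convergent convergent_LIMSEQ_iff by blast

lemma T_contraction: assumes "0 \<le> t" shows "contraction_on W (T t)"
  unfolding contraction_on_def linear_map_on_def
proof (intro conjI ballI allI)
  fix x assume x: "x \<in> W"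
  have C: "contraction_on W (P (real (Suc n)) t)" for n using P_contraction assms by simp
  note lim = P_tendsto_seq[OF _ assms]
  show "T t x \<in> W" using lim[OF x] by (rule limit_in[OF _ _ contraction_onD(3)[OF C x]]) simp
  show "norm (T t x) \<le> norm x"
    by (rule LIMSEQ_le_const2[OF tendsto_norm[OF lim[OF x]]]) (use contraction_onD(2)[OF C x] in blast)
  show "T t (c *\<^sub>R x) = c *\<^sub>R T t x" for c
    by (rule LIMSEQ_unique[OF lim[OF W_simps(3)[OF x]]])
      (simp only: linear_map_onD(3)[OF contraction_onD(1)[OF C] x] tendsto_scaleR[OF tendsto_const lim[OF x]])
  show "T t (x + y) = T t x + T t y" if y: "y \<in> W" for y
    by (rule LIMSEQ_unique[OF lim[OF W_simps(1)[OF x y]]])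
      (simp only: linear_map_onD(2)[OF contraction_onD(1)[OF C] x y] tendsto_add[OF lim[OF x] lim[OF y]])
qed

text \<open>
  The limit over the integers defines the semigroup; letting one parameter in the Cauchy estimate
  tend to infinity along the integers gives convergence for real parameters, which allows to choose
  them freely later.
\<close>

lemma P_tendsto: assumes "x \<in> W" "0 \<le> t" shows "((\<lambda>\<beta>. P \<beta> t x) \<longlongrightarrow> T t x) at_top"
proof (rule tendsto_dense[OF _ T_contraction[OF assms(2)] assms(1)])
  show "\<forall>\<^sub>F \<beta> in at_top. contraction_on W (P \<beta> t)"
    using eventually_gt_at_top[of "0::real"] by eventually_elim (rule P_contraction[OF _ assms(2)])
  fix e :: real assume "e > 0"
  then obtain u f where u: "L_rel u f" "norm (x - u) < e" using L_rel_dense[OF assms(1)] by blast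
  have uf: "u \<in> W" "f \<in> W" using L_rel_in[OF u(1)] by auto
  have bd: "norm (P \<beta> t u - T t u) \<le> t * norm (A \<beta> f - f)" if "0 < \<beta>" for \<beta>
  proof (rule tendsto_le[OF sequentially_bot])
    show "(\<lambda>n. norm (P \<beta> t u - P (real (Suc n)) t u)) \<longlonglongrightarrow> norm (P \<beta> t u - T t u)"
      by (intro tendsto_intros P_tendsto_seq uf assms)
    show "(\<lambda>n. t * norm (A \<beta> f - A (real (Suc n)) f)) \<longlonglongrightarrow> t * norm (A \<beta> f - f)"
      by (intro tendsto_intros filterlim_compose[OF K_approx[OF uf(2)] filterlim_Suc_at_top])
    show "\<forall>\<^sub>F n in sequentially. norm (P \<beta> t u - P (real (Suc n)) t u) \<le> t * norm (A \<beta> f - A (real (Suc n)) f)"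
      using P_diff[OF u(1) that _ assms(2)] by (intro always_eventually) auto
  qed
  have "((\<lambda>\<beta>. P \<beta> t u) \<longlongrightarrow> T t u) at_top"
  proof (rule LIM_zero_cancel, rule Lim_null_comparison)
    show "\<forall>\<^sub>F \<beta> in at_top. norm (P \<beta> t u - T t u) \<le> t * norm (A \<beta> f - f)"
      using eventually_gt_at_top[of "0::real"] by eventually_elim (rule bd)
    have "((\<lambda>\<beta>. t * norm (A \<beta> f - f)) \<longlongrightarrow> t * norm (f - f)) at_top"
      by (intro tendsto_intros K_approx uf)
    then show "((\<lambda>\<beta>. t * norm (A \<beta> f - f)) \<longlongrightarrow> 0) at_top" by simp
  qed
  then show "\<exists>u\<in>W. norm (x - u) < e \<and> ((\<lambda>\<beta>. P \<beta> t u) \<longlongrightarrow> T t u) at_top"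
    using u uf by blast
qed

lemma T_first_order: assumes "L_rel u f" "0 \<le> h" shows "norm (T h u - u) \<le> h * norm f"
proof -
  have uf: "u \<in> W" "f \<in> W" using L_rel_in[OF assms(1)] by auto
  have b: "norm (P \<beta> h u - u) \<le> h * norm f" if \<beta>: "0 < \<beta>" for \<beta>
  proof -
    have "norm (P \<beta> h u - u) \<le> \<beta> * h * norm (u - A \<beta> u)"
      unfolding P_def using poisson_first_order[OF A_contraction[OF \<beta>] _ uf(1)] \<beta> assms(2) by simp
    also have "\<dots> = h * norm (A \<beta> f)"
      using \<beta> unfolding yosida_L[OF assms(1) \<beta>, symmetric] by simp
    also have "\<dots> \<le> h * norm f" using K_norm[OF \<beta> uf(2)] assms(2) by (intro mult_left_mono)
    finally show ?thesis .
  qed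
  have "(\<lambda>n. norm (P (real (Suc n)) h u - u)) \<longlonglongrightarrow> norm (T h u - u)"
    by (intro tendsto_intros P_tendsto_seq uf assms)
  then show ?thesis by (rule LIMSEQ_le_const2) (use b in auto)
qed

text \<open>
  On the domain of the square of the operator \<open>L\<close> the semigroup is differentiable at
  zero with an explicit rate, by passing to the limit in the second order estimate for Poisson
  mixtures.
\<close>

lemma T_second_order:
  assumes "L_rel u f" "L_rel f g" "0 \<le> h"
  shows "norm (T h u - u + h *\<^sub>R f) \<le> h\<^sup>2 / 2 * norm g"
proof -
  have W: "u \<in> W" "f \<in> W" "g \<in> W" using L_rel_in[OF assms(1)] L_rel_in[OF assms(2)] by auto
  have b: "norm (P \<beta> h u - u + h *\<^sub>R A \<beta> f) \<le> h\<^sup>2 / 2 * norm g" if \<beta>: "0 < \<beta>" for \<beta>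
  proof -
    let ?d = "u - A \<beta> u"
    have d: "\<beta> *\<^sub>R ?d = A \<beta> f" by (rule yosida_L[OF assms(1) \<beta>])
    have dW: "?d \<in> W" using W A_in[OF \<beta>] by simp
    have "\<beta>\<^sup>2 *\<^sub>R (?d - A \<beta> ?d) = \<beta> *\<^sub>R (\<beta> *\<^sub>R ?d - A \<beta> (\<beta> *\<^sub>R ?d))"
      using K_scale[OF \<beta> dW, of \<beta>] by (simp add: power2_eq_square scaleR_diff_right mult.assoc)
    also have "\<dots> = A \<beta> (\<beta> *\<^sub>R (f - A \<beta> f))"
      unfolding d using W A_in[OF \<beta>] K_in[OF \<beta>]
      by (simp add: K_scale[OF \<beta>] K_diff[OF \<beta>] scaleR_diff_right)
    also have "\<dots> = A \<beta> (A \<beta> g)" by (simp only: yosida_L[OF assms(2) \<beta>])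
    finally have e: "\<beta>\<^sup>2 *\<^sub>R (?d - A \<beta> ?d) = A \<beta> (A \<beta> g)" .
    have "norm (P \<beta> h u - u + (\<beta> * h) *\<^sub>R ?d) \<le> (\<beta> * h)\<^sup>2 / 2 * norm (?d - A \<beta> ?d)"
      unfolding P_def using poisson_second_order[OF A_contraction[OF \<beta>] _ W(1)] \<beta> assms(3) by simp
    also have "(\<beta> * h) *\<^sub>R ?d = h *\<^sub>R A \<beta> f" unfolding d[symmetric] by (simp add: mult.commute)
    also have "(\<beta> * h)\<^sup>2 / 2 * norm (?d - A \<beta> ?d) = h\<^sup>2 / 2 * norm (\<beta>\<^sup>2 *\<^sub>R (?d - A \<beta> ?d))"
      by (simp add: power_mult_distrib)
    also have "\<dots> \<le> h\<^sup>2 / 2 * norm g"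
      unfolding e using order_trans[OF K_norm[OF \<beta> A_in[OF \<beta> W(3)]] K_norm[OF \<beta> W(3)]]
      by (intro mult_left_mono) auto
    finally show ?thesis .
  qed
  have "(\<lambda>n. norm (P (real (Suc n)) h u - u + h *\<^sub>R A (real (Suc n)) f)) \<longlonglongrightarrow> norm (T h u - u + h *\<^sub>R f)"
    by (intro tendsto_intros P_tendsto_seq W assms
        filterlim_compose[OF K_approx[OF W(2)] filterlim_Suc_at_top])
  then show ?thesis by (rule LIMSEQ_le_const2) (use b in auto)
qed

lemma identity_contraction: "contraction_on W (\<lambda>x. x)"
  by (simp add: contraction_on_def linear_map_on_def)

lemma T_C0: "C0_on W T"
  unfolding C0_on_def
proof (intro conjI allI impI ballI)
  show "bounded_map_on W (T t)" if "0 \<le> t" for t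
    using that by (intro contraction_on_bounded T_contraction)
  show "T 0 x = x" if "x \<in> W" for x
    using P_tendsto_seq[OF that, of 0] C0_onD(4)[OF P_C0 that] by (simp add: LIMSEQ_const_iff)
  show "T (s + t) x = T s (T t x)" if st: "0 \<le> s" "0 \<le> t" and x: "x \<in> W" for s t x
  proof -
    let ?P = "\<lambda>n. P (real (Suc n))"
    have C: "contraction_on W (?P n s)" for n using P_contraction st by simp
    have Tx: "T t x \<in> W" and Px: "\<And>n. ?P n t x \<in> W"
      using contraction_onD(3)[OF T_contraction] contraction_onD(3)[OF P_contraction] st x by auto
    have "(\<lambda>n. ?P n s (?P n t x - T t x)) \<longlonglongrightarrow> 0"
    proof (rule Lim_null_comparison[OF always_eventually])
      show "\<forall>n. norm (?P n s (?P n t x - T t x)) \<le> norm (?P n t x - T t x)"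
        using contraction_onD(2)[OF C W_simps(2)[OF Px Tx]] by blast
      show "(\<lambda>n. norm (?P n t x - T t x)) \<longlonglongrightarrow> 0"
        using P_tendsto_seq[OF x st(2)] by (simp add: LIM_zero tendsto_norm_zero)
    qed
    from tendsto_add[OF this P_tendsto_seq[OF Tx st(1)]]
    have "(\<lambda>n. ?P n s (?P n t x)) \<longlonglongrightarrow> T s (T t x)"
      using linear_map_on_diff[OF contraction_onD(1)[OF C] subspace Px Tx] by simp
    moreover have "?P n s (?P n t x) = ?P n (s + t) x" for n
      using C0_onD(5)[OF P_C0 st x] by simp
    ultimately show ?thesis using P_tendsto_seq[OF x, of "s + t"] st LIMSEQ_unique by fastforce
  qed
  show "((\<lambda>h. T h x) \<longlongrightarrow> x) (at_right 0)" if x: "x \<in> W" for x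
  proof (rule tendsto_dense[OF _ identity_contraction x])
    show "\<forall>\<^sub>F h in at_right 0. contraction_on W (T h)"
      unfolding eventually_at_filter by (intro always_eventually) (auto intro: T_contraction)
    fix e :: real assume "e > 0"
    then obtain u f where u: "L_rel u f" "norm (x - u) < e" using L_rel_dense[OF x] by blast
    have "((\<lambda>h. T h u) \<longlongrightarrow> u) (at_right 0)"
    proof (rule LIM_zero_cancel, rule Lim_null_comparison)
      show "\<forall>\<^sub>F h in at_right 0. norm (T h u - u) \<le> h * norm f"
        unfolding eventually_at_filter by (intro always_eventually) (auto intro: T_first_order[OF u(1)])
      have "((\<lambda>h. h * norm f) \<longlongrightarrow> 0 * norm f) (at_right 0)" by (intro tendsto_intros)
      then show "((\<lambda>h. h * norm f) \<longlongrightarrow> 0) (at_right 0)" by simp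
    qed
    then show "\<exists>u\<in>W. norm (x - u) < e \<and> ((\<lambda>h. T h u) \<longlongrightarrow> u) (at_right 0)"
      using u L_rel_in by blast
  qed
qed

text \<open>
  Approximate \<open>u\<close> by $v = \beta K_\beta u$, which lies in the domain of the square of
  \<open>L\<close>. The error of the approximation is controlled uniformly in \<open>h\<close> by
  the first order estimate, since $L(u-v) = Lu - \beta K_\beta Lu$ is small.
\<close>

lemma L_rel_generator: assumes "L_rel u f" shows "generator_on W T u (- f)"
  unfolding generator_on_def
proof (intro conjI)
  show u: "u \<in> W" and "- f \<in> W" using L_rel_in[OF assms] subspace_neg[OF subspace] by auto
  have f: "f \<in> W" by (rule L_rel_in[OF assms])
  show "((\<lambda>h. (T h u - u) /\<^sub>R h) \<longlongrightarrow> - f) (at_right 0)"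
  proof (rule tendstoI)
    fix e :: real assume e: "e > 0"
    have "\<forall>\<^sub>F \<beta> in at_top. norm (f - A \<beta> f) < e / 4 \<and> \<beta> > 0"
      using tendstoD[OF K_approx[OF f], of "e / 4"] eventually_gt_at_top[of "0::real"] e
      by (auto elim!: eventually_elim2 simp: dist_norm norm_minus_commute)
    then obtain \<beta> where \<beta>: "norm (f - A \<beta> f) < e / 4" "\<beta> > 0"
      using eventually_happens trivial_limit_at_top_linorder by blast
    let ?v = "A \<beta> u" and ?g = "\<beta> *\<^sub>R (f - A \<beta> f)"
    have v: "L_rel ?v (A \<beta> f)" by (rule L_rel_A[OF assms \<beta>(2)])
    have g: "L_rel (A \<beta> f) ?g" by (rule L_rel_scale[OF L_rel_K[OF f \<beta>(2)]])
    have uv: "L_rel (u - ?v) (f - A \<beta> f)"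
      using assms v unfolding L_rel_def
      using K_diff[of 1 "f + u" "A \<beta> f + ?v"] by (simp add: algebra_simps)
    have vW: "?v \<in> W" by (rule L_rel_in[OF v])
    have "\<forall>\<^sub>F h in at_right 0. h < e / (2 * (norm ?g + 1))"
      using e by (intro eventually_at_right_less[THEN eventually_mono, of 0] order_tendstoD(2)[OF tendsto_ident_at]) (auto intro!: divide_pos_pos add_nonneg_pos)
    then show "\<forall>\<^sub>F h in at_right 0. dist ((T h u - u) /\<^sub>R h) (- f) < e"
      using eventually_at_right_less[of "0::real"]
    proof eventually_elim
      case (elim h)
      have Th: "linear_map_on W (T h)" using contraction_onD(1)[OF T_contraction] elim by simp
      have "T h u - u + h *\<^sub>R f = (T h (u - ?v) - (u - ?v)) + (T h ?v - ?v + h *\<^sub>R A \<beta> f) + h *\<^sub>R (f - A \<beta> f)"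
        using linear_map_on_diff[OF Th subspace u vW] by (simp add: scaleR_diff_right)
      also have "norm \<dots> \<le> h * norm (f - A \<beta> f) + h\<^sup>2 / 2 * norm ?g + h * norm (f - A \<beta> f)"
        using T_first_order[OF uv, of h] T_second_order[OF v g, of h] elim
        by (intro norm_triangle_mono) auto
      also have "\<dots> = h * (2 * norm (f - A \<beta> f) + h / 2 * norm ?g)"
        by (simp add: power2_eq_square algebra_simps)
      also have "\<dots> < h * e"
      proof (rule mult_strict_left_mono)
        have "h * (norm ?g + 1) \<le> e / 2"
          using elim(1) by (simp add: pos_less_divide_eq add_nonneg_pos distrib_left)
        then have "h / 2 * norm ?g \<le> e / 4" using elim(2) by (simp add: algebra_simps)
        then show "2 * norm (f - A \<beta> f) + h / 2 * norm ?g < e" using \<beta>(1) e by linarith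
      qed (rule elim(2))
      finally have "norm (T h u - u + h *\<^sub>R f) / h < e" using elim(2) by (simp add: field_simps)
      moreover have "(T h u - u) /\<^sub>R h - - f = (T h u - u + h *\<^sub>R f) /\<^sub>R h"
        using elim(2) by (simp add: scaleR_add_right)
      ultimately show ?case using elim(2) by (simp add: dist_norm divide_inverse mult.commute)
    qed
  qed
qed

text \<open>
  Contractivity gives $\|w - h^{-1}(T_hw - w)\| \ge (1+h^{-1})\|w\| - h^{-1}\|w\|$.
\<close>

lemma generator_dissipative:
  assumes "generator_on W T w g" shows "norm w \<le> norm (w - g)"
proof -
  have w: "w \<in> W" using assms by (simp add: generator_on_def)
  have "((\<lambda>h. norm (w - (T h w - w) /\<^sub>R h)) \<longlongrightarrow> norm (w - g)) (at_right 0)"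
    using assms unfolding generator_on_def by (intro tendsto_intros) auto
  moreover have "\<forall>\<^sub>F h in at_right 0. norm w \<le> norm (w - (T h w - w) /\<^sub>R h)"
    unfolding eventually_at_filter
  proof (intro always_eventually allI impI)
    fix h :: real assume "h \<in> {0<..}"
    then have h: "0 < h" by simp
    have "(1 + 1 / h) * norm w = norm ((1 + 1 / h) *\<^sub>R w)" using h by simp
    also have "(1 + 1 / h) *\<^sub>R w = (w - (T h w - w) /\<^sub>R h) + (1 / h) *\<^sub>R T h w"
      by (simp add: algebra_simps divide_inverse)
    also have "norm \<dots> \<le> norm (w - (T h w - w) /\<^sub>R h) + 1 / h * norm w"
      using contraction_onD(2)[OF T_contraction w, of h] h
      by (intro norm_triangle_le add_left_mono) (simp add: divide_right_mono)
    finally show "norm w \<le> norm (w - (T h w - w) /\<^sub>R h)" by (simp add: algebra_simps)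
  qed
  ultimately show ?thesis by (intro tendsto_lowerbound) auto
qed

text \<open>
  The generator cannot be larger than \<open>-L\<close>: since \<open>1 + L\<close> is onto, a
  further element \<open>u\<close> of its domain would give a vector \<open>w\<close> with generator
  value \<open>w\<close>, and dissipativity forces \<open>w = 0\<close>.
\<close>

lemma generator_iff: "generator_on W T u g \<longleftrightarrow> L_rel u (- g)"
proof
  assume g: "generator_on W T u g"
  then have W: "u \<in> W" "g \<in> W" by (auto simp: generator_on_def)
  \<comment> \<open>The element of the domain of \<open>L\<close> on which \<open>1 + L\<close> takes the same value as \<open>1\<close> minus the generator does on \<open>u\<close>.\<close>
  define v where "v = K 1 (u - g)"
  have v: "generator_on W T v (- (u - g - v))"
    using L_rel_generator[OF L_rel_K[of "u - g" 1]] W by (simp add: v_def)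
  then have vW: "v \<in> W" by (simp add: generator_on_def)
  have "((\<lambda>h. (T h u - u) /\<^sub>R h - (T h v - v) /\<^sub>R h) \<longlongrightarrow> g - (- (u - g - v))) (at_right 0)"
    using g v by (intro tendsto_diff) (auto simp: generator_on_def)
  moreover have "\<forall>\<^sub>F h in at_right 0. (T h u - u) /\<^sub>R h - (T h v - v) /\<^sub>R h = (T h (u - v) - (u - v)) /\<^sub>R h"
    unfolding eventually_at_filter
  proof (intro always_eventually allI impI)
    fix h :: real assume "h \<in> {0<..}"
    then have "T h (u - v) = T h u - T h v"
      using linear_map_on_diff[OF C0_onD(2)[OF T_C0] subspace W(1) vW] by simp
    then have "(T h u - u) - (T h v - v) = T h (u - v) - (u - v)" by simp
    then show "(T h u - u) /\<^sub>R h - (T h v - v) /\<^sub>R h = (T h (u - v) - (u - v)) /\<^sub>R h"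
      by (metis scaleR_diff_right)
  qed
  ultimately have "generator_on W T (u - v) (u - v)"
    unfolding generator_on_def using W vW by (auto elim: Lim_transform_eventually)
  from generator_dissipative[OF this] have "u = v" by simp
  then show "L_rel u (- g)" unfolding L_rel_def using W subspace_neg[OF subspace] by (simp add: v_def)
next
  assume "L_rel u (- g)"
  from L_rel_generator[OF this] show "generator_on W T u g" by simp
qed

text \<open>
  A semigroup with the same generator leaves the graph of \<open>L\<close> invariant, so it commutes
  with the resolvents and with the semigroup constructed from them.
\<close>

lemma semigroup_unique:
  assumes S: "C0_on W S" and gen: "\<And>u g. generator_on W S u g \<longleftrightarrow> L_rel u (- g)"
    and x: "x \<in> W" and t: "0 \<le> t"
  shows "S t x = T t x"
proof (rule generator_unique[OF S T_C0 _ _ _ x t])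
  show "norm (T s x) \<le> norm x" if "0 \<le> s" "x \<in> W" for s x
    using contraction_onD(2)[OF T_contraction] that by blast
  show "S s (T r x) = T r (S s x)" if s: "0 \<le> s" and r: "0 \<le> r" and x: "x \<in> W" for s r x
  proof -
    note Sin = C0_onD(3)[OF S s] and Slin = C0_onD(2)[OF S s]
    have K: "S s (K \<beta> y) = K \<beta> (S s y)" if \<beta>: "0 < \<beta>" and y: "y \<in> W" for \<beta> y
    proof -
      have "generator_on W S (K \<beta> y) (- (y - A \<beta> y))" using gen L_rel_K[OF y \<beta>] by simp
      from generator_invariant[OF S this s]
      have "L_rel (S s (K \<beta> y)) (- S s (- (y - A \<beta> y)))" by (simp add: gen)
      moreover have "- S s (- (y - A \<beta> y)) = S s y - \<beta> *\<^sub>R S s (K \<beta> y)"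
        using linear_map_onD(3)[OF Slin, of "y - A \<beta> y" "-1"] linear_map_onD(3)[OF Slin, of "K \<beta> y" \<beta>]
          linear_map_on_diff[OF Slin subspace y A_in[OF \<beta> y]] y A_in[OF \<beta> y] K_in[OF \<beta> y] by simp
      ultimately have "L_rel (S s (K \<beta> y)) (S s y - \<beta> *\<^sub>R S s (K \<beta> y))" by simp
      from L_rel_resolvent[OF this \<beta>] show ?thesis by simp
    qed
    have "(\<lambda>n. S s (P (real (Suc n)) r x)) \<longlonglongrightarrow> S s (T r x)"
      by (rule bounded_map_on_tendsto[OF C0_onD(1)[OF S s] subspace _ _ P_tendsto_seq[OF x r]])
        (use contraction_onD(3)[OF P_contraction] contraction_onD(3)[OF T_contraction] r x in auto)
    moreover have "S s (P (real (Suc n)) r x) = P (real (Suc n)) r (S s x)" for n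
      by (rule P_comm[OF _ r C0_onD(1)[OF S s] K x]) simp_all
    ultimately show ?thesis using P_tendsto_seq[OF Sin[OF x] r] LIMSEQ_unique by simp
  qed
  show "\<exists>u g. norm (x - u) < e \<and> generator_on W S u g \<and> generator_on W T u g"
    if "x \<in> W" "e > 0" for x e
  proof -
    obtain u f where "L_rel u f" "norm (x - u) < e" using L_rel_dense[OF \<open>x \<in> W\<close> \<open>e > 0\<close>] by blast
    then show ?thesis by (intro exI[of _ u] exI[of _ "- f"]) (simp add: gen generator_iff)
  qed
qed

end

section \<open>Square-integrable functions as a subspace of a Banach space\<close>

instance bcontfun :: (metric_space, banach) banach ..

text \<open>
  A quadratic polynomial without negative values has nonpositive discriminant. Besides the
  Cauchy-Schwarz inequality this also serves for almost minimisers of a quadratic functional.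
\<close>

lemma discriminant_nonpos:
  fixes a b e :: real
  assumes q: "\<And>c. 0 \<le> e + 2 * c * a + c\<^sup>2 * b" and b: "0 \<le> b"
  shows "a\<^sup>2 \<le> e * b"
proof (cases "b = 0")
  case True
  have "a = 0"
  proof (rule ccontr)
    assume n: "a \<noteq> 0"
    have "0 \<le> e + 2 * (- (e + 1) / (2 * a)) * a"
      using q[of "- (e + 1) / (2 * a)"] True by simp
    also have "\<dots> = -1" using n by (simp add: field_simps)
    finally show False by simp
  qed
  then show ?thesis using True by simp
next
  case False
  then have p: "b > 0" using b by simp
  have "0 \<le> e + 2 * (- a / b) * a + (- a / b)\<^sup>2 * b" by (rule q)
  also have "\<dots> = e - a\<^sup>2 / b" using p by (simp add: power2_eq_square field_simps)
  finally show ?thesis using p by (simp add: field_simps)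
qed

text \<open>
  Both the scalar product of $L^2$ and the form itself, with or without a multiple of the scalar
  product added, are semi-inner products on a space of functions; no identification of functions is
  made.
\<close>

locale semi_inner_space =
  fixes D :: "('a \<Rightarrow> real) set" and B :: "('a \<Rightarrow> real) \<Rightarrow> ('a \<Rightarrow> real) \<Rightarrow> real"
  assumes add: "u \<in> D \<Longrightarrow> v \<in> D \<Longrightarrow> (\<lambda>x. u x + v x) \<in> D"
    and scale: "u \<in> D \<Longrightarrow> (\<lambda>x. c * u x) \<in> D"
    and sym: "u \<in> D \<Longrightarrow> v \<in> D \<Longrightarrow> B u v = B v u"
    and B_add: "u \<in> D \<Longrightarrow> v \<in> D \<Longrightarrow> w \<in> D \<Longrightarrow> B (\<lambda>x. u x + v x) w = B u w + B v w"
    and B_scale: "u \<in> D \<Longrightarrow> w \<in> D \<Longrightarrow> B (\<lambda>x. c * u x) w = c * B u w"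
    and pos: "u \<in> D \<Longrightarrow> 0 \<le> B u u"
begin

lemma diff: assumes "u \<in> D" "v \<in> D" shows "(\<lambda>x. u x - v x) \<in> D"
  using add[OF assms(1) scale[OF assms(2), of "-1"]] by simp

lemma B_diff:
  assumes "u \<in> D" "v \<in> D" "w \<in> D" shows "B (\<lambda>x. u x - v x) w = B u w - B v w"
  using B_add[OF assms(1) scale[OF assms(2), of "-1"] assms(3)] B_scale[OF assms(2,3), of "-1"] by simp

lemma B_add_right:
  "u \<in> D \<Longrightarrow> v \<in> D \<Longrightarrow> w \<in> D \<Longrightarrow> B w (\<lambda>x. u x + v x) = B w u + B w v"
  using B_add[of u v w] sym[OF add, of u v w] sym[of u w] sym[of v w] by simp

lemma B_diff_right:
  "u \<in> D \<Longrightarrow> v \<in> D \<Longrightarrow> w \<in> D \<Longrightarrow> B w (\<lambda>x. u x - v x) = B w u - B w v"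
  using B_diff[of u v w] sym[OF diff, of u v w] sym[of u w] sym[of v w] by simp

lemma B_scale_right: "u \<in> D \<Longrightarrow> w \<in> D \<Longrightarrow> B w (\<lambda>x. c * u x) = c * B w u"
  using B_scale[of u w c] sym[OF scale, of u w c] sym[of u w] by simp

lemma B_expand:
  assumes "u \<in> D" "v \<in> D"
  shows "B (\<lambda>x. u x + c * v x) (\<lambda>x. u x + c * v x) = B u u + 2 * c * B u v + c\<^sup>2 * B v v"
proof -
  note s = scale[OF assms(2), of c]
  have "B (\<lambda>x. u x + c * v x) (\<lambda>x. u x + c * v x)
      = B u u + B u (\<lambda>x. c * v x) + (B (\<lambda>x. c * v x) u + B (\<lambda>x. c * v x) (\<lambda>x. c * v x))"
    using assms s add[OF assms(1) s] by (simp only: B_add B_add_right)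
  then show ?thesis
    using assms s by (simp add: B_scale B_scale_right sym[of v u] power2_eq_square algebra_simps)
qed

lemma B_expand_diff:
  assumes "u \<in> D" "v \<in> D"
  shows "B (\<lambda>x. u x - v x) (\<lambda>x. u x - v x) = B u u - 2 * B u v + B v v"
  using B_expand[OF assms, of "-1"] by simp

lemma cauchy_schwarz: assumes "u \<in> D" "v \<in> D" shows "(B u v)\<^sup>2 \<le> B u u * B v v"
proof (rule discriminant_nonpos[OF _ pos[OF assms(2)]])
  show "0 \<le> B u u + 2 * c * B u v + c\<^sup>2 * B v v" for c
    using pos[OF add[OF assms(1) scale[OF assms(2), of c]]] unfolding B_expand[OF assms] .
qed

definition nrm where "nrm u = sqrt (B u u)"

lemma cauchy_schwarz_abs: assumes "u \<in> D" "v \<in> D" shows "\<bar>B u v\<bar> \<le> nrm u * nrm v"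
  using real_sqrt_le_mono[OF cauchy_schwarz[OF assms]] by (simp add: nrm_def real_sqrt_mult)

lemma nrm_sq: "u \<in> D \<Longrightarrow> (nrm u)\<^sup>2 = B u u"
  by (simp add: nrm_def pos)

lemma nrm_nonneg: "u \<in> D \<Longrightarrow> 0 \<le> nrm u"
  by (simp add: nrm_def pos)

end

lemma L2_measurable [measurable_dest]: "u \<in> L2 M \<Longrightarrow> u \<in> borel_measurable M"
  by (simp add: L2_def)

lemma L2_square_integrable: "u \<in> L2 M \<Longrightarrow> integrable M (\<lambda>x. (u x)\<^sup>2)"
  by (simp add: L2_def)

lemma L2_dominated:
  assumes "v \<in> borel_measurable M" "u \<in> L2 M" "AE x in M. \<bar>v x\<bar> \<le> \<bar>u x\<bar>"
  shows "v \<in> L2 M"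
  unfolding L2_def
proof (intro CollectI conjI assms(1))
  note [measurable] = assms(1)
  show "integrable M (\<lambda>x. (v x)\<^sup>2)"
    by (rule Bochner_Integration.integrable_bound[OF L2_square_integrable[OF assms(2)]])
      (use assms(3) in \<open>auto simp: abs_le_square_iff\<close>)
qed

lemma L2_mult_integrable:
  assumes "u \<in> L2 M" "v \<in> L2 M" shows "integrable M (\<lambda>x. u x * v x)"
proof (rule Bochner_Integration.integrable_bound)
  note [measurable] = L2_measurable[OF assms(1)] L2_measurable[OF assms(2)]
  show "integrable M (\<lambda>x. (u x)\<^sup>2 + (v x)\<^sup>2)" by (intro Bochner_Integration.integrable_add L2_square_integrable assms)
  show "(\<lambda>x. u x * v x) \<in> borel_measurable M" by simp
  have "\<bar>u x * v x\<bar> \<le> (u x)\<^sup>2 + (v x)\<^sup>2" for x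
    using sum_squares_bound[of "\<bar>u x\<bar>" "\<bar>v x\<bar>"] zero_le_power2[of "u x"] zero_le_power2[of "v x"]
      mult_nonneg_nonneg[OF abs_ge_zero[of "u x"] abs_ge_zero[of "v x"]]
    unfolding abs_mult power2_abs by linarith
  then show "AE x in M. norm (u x * v x) \<le> norm ((u x)\<^sup>2 + (v x)\<^sup>2)" by simp
qed

lemma L2_zero: "(\<lambda>x. 0) \<in> L2 M"
  by (simp add: L2_def)

lemma L2_scale: "u \<in> L2 M \<Longrightarrow> (\<lambda>x. c * u x) \<in> L2 M"
  by (auto simp: L2_def power_mult_distrib)

lemma L2_add: assumes "u \<in> L2 M" "v \<in> L2 M" shows "(\<lambda>x. u x + v x) \<in> L2 M"
  unfolding L2_def
proof (intro CollectI conjI)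
  note [measurable] = L2_measurable[OF assms(1)] L2_measurable[OF assms(2)]
  show "(\<lambda>x. u x + v x) \<in> borel_measurable M" by simp
  have "integrable M (\<lambda>x. (u x)\<^sup>2 + (v x)\<^sup>2 + 2 * (u x * v x))"
    by (intro Bochner_Integration.integrable_add integrable_mult_right L2_square_integrable L2_mult_integrable assms)
  then show "integrable M (\<lambda>x. (u x + v x)\<^sup>2)" by (simp add: power2_sum mult.assoc)
qed

interpretation L2: semi_inner_space "L2 M" "L2_inner M" for M
proof
  show "L2_inner M (\<lambda>x. u x + v x) w = L2_inner M u w + L2_inner M v w"
    if "u \<in> L2 M" "v \<in> L2 M" "w \<in> L2 M" for u v w
    using L2_mult_integrable[OF that(1,3)] L2_mult_integrable[OF that(2,3)]
    by (simp add: L2_inner_def distrib_right)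
  show "L2_inner M (\<lambda>x. c * u x) w = c * L2_inner M u w" for u w c
    by (simp add: L2_inner_def mult.assoc)
qed (auto simp: L2_add L2_scale L2_inner_def mult.commute integral_nonneg_AE)

lemma L2_norm_eq: "L2_norm M u = L2.nrm M u"
  by (simp add: L2_norm_def L2.nrm_def)

lemmas L2_diff = L2.diff
lemmas L2_norm_sq = L2.nrm_sq[folded L2_norm_eq]
lemmas L2_norm_nonneg = L2.nrm_nonneg[folded L2_norm_eq]
lemmas L2_cauchy_schwarz = L2.cauchy_schwarz_abs[folded L2_norm_eq]

lemma L2_sum: "(\<And>i. i \<in> I \<Longrightarrow> f i \<in> L2 M) \<Longrightarrow> (\<lambda>x. \<Sum>i\<in>I. f i x) \<in> L2 M"
  by (induction I rule: infinite_finite_induct) (auto simp: L2_zero L2_add)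

lemma L2_inner_AE_cong:
  assumes "u \<in> L2 M" "u' \<in> L2 M" "v \<in> L2 M" "v' \<in> L2 M" "AE x in M. u x = u' x" "AE x in M. v x = v' x"
  shows "L2_inner M u v = L2_inner M u' v'"
  unfolding L2_inner_def by (rule integral_cong_AE) (use assms in \<open>auto intro!: borel_measurable_times L2_measurable\<close>)

lemma L2_norm_zero_iff:
  assumes "u \<in> L2 M" shows "L2_norm M u = 0 \<longleftrightarrow> (AE x in M. u x = 0)"
  using integral_nonneg_eq_0_iff_AE[OF L2_square_integrable[OF assms]]
  by (simp add: L2_norm_def L2_inner_def power2_eq_square)

lemma L2_norm_minus_commute: "L2_norm M (\<lambda>x. u x - v x) = L2_norm M (\<lambda>x. v x - u x)"
proof -
  have "(u x - v x) * (u x - v x) = (v x - u x) * (v x - u x)" for x by (simp add: algebra_simps)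
  then show ?thesis by (simp add: L2_norm_def L2_inner_def)
qed

text \<open>
  Apply the corresponding fact for $L^1$ to the squares of the differences.
\<close>

lemma L2_tendsto_AE_subseq:
  assumes u: "\<And>n::nat. u n \<in> L2 M" and v: "v \<in> L2 M" and lim: "(\<lambda>n. L2_norm M (\<lambda>x. u n x - v x)) \<longlonglongrightarrow> 0"
  obtains r where "strict_mono r" "AE x in M. (\<lambda>n. u (r n) x) \<longlonglongrightarrow> v x"
proof -
  have "(\<lambda>n. (L2_norm M (\<lambda>x. u n x - v x))\<^sup>2) \<longlonglongrightarrow> 0\<^sup>2" by (intro tendsto_intros lim)
  then have "(\<lambda>n. LINT x|M. norm ((u n x - v x)\<^sup>2)) \<longlonglongrightarrow> 0"
    unfolding L2_norm_sq[OF L2_diff[OF u v]] L2_inner_def by (simp add: power2_eq_square)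
  from tendsto_L1_AE_subseq[OF L2_square_integrable[OF L2_diff[OF u v]] this]
  obtain r where r: "strict_mono r" "AE x in M. (\<lambda>n. (u (r n) x - v x)\<^sup>2) \<longlonglongrightarrow> 0" by blast
  have "AE x in M. (\<lambda>n. u (r n) x) \<longlonglongrightarrow> v x"
    using r(2)
  proof eventually_elim
    case (elim x)
    from tendsto_real_sqrt[OF elim] show ?case by (simp add: tendsto_rabs_zero_iff LIM_zero_iff)
  qed
  with r(1) show ?thesis by (rule that)
qed

text \<open>
  Pointwise bounds survive limits in $L^2$. The bounds may vary with the index, as they do for
  partial sums of a series.
\<close>

lemma L2_limit_le:
  assumes "\<And>n::nat. u n \<in> L2 M" "v \<in> L2 M" "(\<lambda>n. L2_norm M (\<lambda>x. u n x - v x)) \<longlonglongrightarrow> 0"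
    and le: "\<And>n. AE x in M. u n x \<le> g n x" and g: "AE x in M. (\<lambda>n. g n x) \<longlonglongrightarrow> h x"
  shows "AE x in M. v x \<le> h x"
proof -
  obtain r where r: "strict_mono r" "AE x in M. (\<lambda>n. u (r n) x) \<longlonglongrightarrow> v x"
    using L2_tendsto_AE_subseq[OF assms(1-3)] by blast
  have "AE x in M. \<forall>n. u n x \<le> g n x" using le by (simp add: AE_all_countable)
  with r(2) g show ?thesis
  proof eventually_elim
    case (elim x)
    have "(\<lambda>n. g (r n) x) \<longlonglongrightarrow> h x" using LIMSEQ_subseq_LIMSEQ[OF elim(2) r(1)] by (simp add: o_def)
    with elim(1,3) show ?case by (intro LIMSEQ_le) auto
  qed
qed

lemma L2_limit_ge:
  assumes "\<And>n::nat. u n \<in> L2 M" "v \<in> L2 M" "(\<lambda>n. L2_norm M (\<lambda>x. u n x - v x)) \<longlonglongrightarrow> 0"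
    and ge: "\<And>n. AE x in M. g n x \<le> u n x" and g: "AE x in M. (\<lambda>n. g n x) \<longlonglongrightarrow> h x"
  shows "AE x in M. h x \<le> v x"
proof -
  obtain r where r: "strict_mono r" "AE x in M. (\<lambda>n. u (r n) x) \<longlonglongrightarrow> v x"
    using L2_tendsto_AE_subseq[OF assms(1-3)] by blast
  have "AE x in M. \<forall>n. g n x \<le> u n x" using ge by (simp add: AE_all_countable)
  with r(2) g show ?thesis
  proof eventually_elim
    case (elim x)
    have "(\<lambda>n. g (r n) x) \<longlonglongrightarrow> h x" using LIMSEQ_subseq_LIMSEQ[OF elim(2) r(1)] by (simp add: o_def)
    with elim(1,3) show ?case by (intro LIMSEQ_le) auto
  qed
qed

lemma L2_cutoff_tendsto:
  assumes g: "g \<in> L2 M" and [measurable]: "\<And>n::nat. \<psi> n \<in> borel_measurable M"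
    and b: "\<And>n. AE x in M. 0 \<le> \<psi> n x \<and> \<psi> n x \<le> 1" and lim: "AE x in M. (\<lambda>n. \<psi> n x) \<longlonglongrightarrow> 1"
  shows "\<And>n. (\<lambda>x. g x * \<psi> n x) \<in> L2 M" "(\<lambda>n. L2_norm M (\<lambda>x. g x * \<psi> n x - g x)) \<longlonglongrightarrow> 0"
proof -
  note [measurable] = L2_measurable[OF g]
  show m: "(\<lambda>x. g x * \<psi> n x) \<in> L2 M" for n
  proof (rule L2_dominated[OF _ g])
    show "AE x in M. \<bar>g x * \<psi> n x\<bar> \<le> \<bar>g x\<bar>"
      using b[of n] by eventually_elim (simp add: abs_mult mult_left_le)
  qed simp
  have "(\<lambda>n. LINT x|M. (g x * \<psi> n x - g x)\<^sup>2) \<longlonglongrightarrow> (LINT x|M. 0)"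
  proof (rule integral_dominated_convergence[where w="\<lambda>x. (g x)\<^sup>2"])
    show "integrable M (\<lambda>x. (g x)\<^sup>2)" by (rule L2_square_integrable[OF g])
    show "AE x in M. (\<lambda>n. (g x * \<psi> n x - g x)\<^sup>2) \<longlonglongrightarrow> 0"
      using lim
    proof eventually_elim
      case (elim x)
      have "(\<lambda>n. (g x * \<psi> n x - g x)\<^sup>2) \<longlonglongrightarrow> (g x * 1 - g x)\<^sup>2" by (intro tendsto_intros elim)
      then show ?case by simp
    qed
    show "AE x in M. norm ((g x * \<psi> n x - g x)\<^sup>2) \<le> (g x)\<^sup>2" for n
      using b[of n]
    proof eventually_elim
      case (elim x)
      have "\<bar>g x * \<psi> n x - g x\<bar> = \<bar>g x\<bar> * (1 - \<psi> n x)"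
      proof -
        have "g x * \<psi> n x - g x = - (g x * (1 - \<psi> n x))" by (simp add: algebra_simps)
        then show ?thesis using elim by (simp only: abs_minus_cancel abs_mult) simp
      qed
      also have "\<dots> \<le> \<bar>g x\<bar>" using elim by (simp add: mult_left_le)
      finally show ?case by (simp add: abs_le_square_iff)
    qed
  qed auto
  then have "(\<lambda>n. sqrt (LINT x|M. (g x * \<psi> n x - g x)\<^sup>2)) \<longlonglongrightarrow> sqrt 0" by (intro tendsto_intros) simp
  then show "(\<lambda>n. L2_norm M (\<lambda>x. g x * \<psi> n x - g x)) \<longlonglongrightarrow> 0"
    by (simp add: L2_norm_def L2_inner_def power2_eq_square)
qed

context sigma_finite_measure
begin

text \<open>
  A positive integrable weight \<open>f \<le> 1\<close> lies in $L^2$, so a Cauchy sequence in $L^2$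
  times \<open>f\<close> is Cauchy in $L^1$ and has a subsequence that converges almost everywhere.
  Fatou's lemma turns this pointwise limit into a limit in $L^2$.
\<close>

lemma L2_complete:
  assumes u: "\<And>n::nat. u n \<in> L2 M"
    and C: "\<And>e. e > 0 \<Longrightarrow> \<exists>N. \<forall>i\<ge>N. \<forall>j\<ge>N. L2_norm M (\<lambda>x. u i x - u j x) < e"
  obtains v where "v \<in> L2 M" "(\<lambda>n. L2_norm M (\<lambda>x. u n x - v x)) \<longlonglongrightarrow> 0"
proof -
  obtain f :: "'a \<Rightarrow> real" where f: "f \<in> borel_measurable M" "\<And>x. f x > 0" "\<And>x. f x \<le> 1" "integrable M f"
    using obtain_positive_integrable_function by blast
  note [measurable] = f(1) L2_measurable[OF u]
  have fL: "f \<in> L2 M" unfolding L2_def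
  proof (intro CollectI conjI f(1))
    show "integrable M (\<lambda>x. (f x)\<^sup>2)"
      by (rule Bochner_Integration.integrable_bound[OF f(4)])
        (use f(2,3) in \<open>auto simp: power2_eq_square mult_left_le less_imp_le\<close>)
  qed
  have f0: "L2_norm M f \<ge> 0" by (rule L2_norm_nonneg[OF fL])
  have int: "integrable M (\<lambda>x. u n x * f x)" for n by (rule L2_mult_integrable[OF u fL])
  have "\<exists>N. \<forall>i\<ge>N. \<forall>j\<ge>N. (LINT x|M. norm (u i x * f x - u j x * f x)) < e" if e: "e > 0" for e
  proof -
    have "e / (L2_norm M f + 1) > 0" using e f0 by simp
    then obtain N where N: "\<And>i j. i \<ge> N \<Longrightarrow> j \<ge> N \<Longrightarrow> L2_norm M (\<lambda>x. u i x - u j x) < e / (L2_norm M f + 1)"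
      using C by blast
    show ?thesis
    proof (intro exI[of _ N] allI impI)
      fix i j assume ij: "i \<ge> N" "j \<ge> N"
      let ?d = "\<lambda>x. \<bar>u i x - u j x\<bar>"
      have d: "?d \<in> L2 M" by (rule L2_dominated[OF _ L2_diff[OF u u]]) auto
      have nd: "L2_norm M ?d = L2_norm M (\<lambda>x. u i x - u j x)" by (simp add: L2_norm_def L2_inner_def)
      have "(LINT x|M. norm (u i x * f x - u j x * f x)) = L2_inner M ?d f"
        unfolding L2_inner_def using f(2) by (simp add: abs_mult[symmetric] left_diff_distrib[symmetric])
          (simp add: abs_mult less_imp_le)
      also have "\<dots> \<le> L2_norm M ?d * L2_norm M f" using L2_cauchy_schwarz[OF d fL] by linarith
      also have "\<dots> \<le> e / (L2_norm M f + 1) * L2_norm M f"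
        unfolding nd using N[OF ij] f0 by (intro mult_right_mono) auto
      also have "\<dots> < e" using e f0 by (simp add: field_simps)
      finally show "(LINT x|M. norm (u i x * f x - u j x * f x)) < e" .
    qed
  qed
  from cauchy_L1_AE_cauchy_subseq[OF int this] obtain r
    where r: "strict_mono r" "AE x in M. Cauchy (\<lambda>i. u (r i) x * f x)" by auto
  define v where "v x = lim (\<lambda>i. u (r i) x)" for x
  have [measurable]: "v \<in> borel_measurable M" unfolding v_def by measurable
  have conv: "AE x in M. (\<lambda>i. u (r i) x) \<longlonglongrightarrow> v x"
    using r(2)
  proof eventually_elim
    case (elim x)
    then have "convergent (\<lambda>i. u (r i) x * f x)" by (rule Cauchy_convergent)
    then obtain l where "(\<lambda>i. u (r i) x * f x) \<longlonglongrightarrow> l" by (auto simp: convergent_def)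
    then have "(\<lambda>i. u (r i) x * f x / f x) \<longlonglongrightarrow> l / f x" using f(2)[of x] by (intro tendsto_intros) auto
    then have "(\<lambda>i. u (r i) x) \<longlonglongrightarrow> l / f x" using f(2)[of x] by simp
    then show ?case unfolding v_def by (simp add: limI)
  qed
  have bound: "integrable M (\<lambda>x. (u n x - v x)\<^sup>2) \<and> L2_norm M (\<lambda>x. u n x - v x) \<le> e"
    if e: "e > 0" and N: "\<And>i j. i \<ge> N \<Longrightarrow> j \<ge> N \<Longrightarrow> L2_norm M (\<lambda>x. u i x - u j x) < e" and n: "n \<ge> N" for e N n
  proof -
    have "(\<integral>\<^sup>+x. ennreal ((u n x - v x)\<^sup>2) \<partial>M) \<le> (\<integral>\<^sup>+x. liminf (\<lambda>i. ennreal ((u n x - u (r i) x)\<^sup>2)) \<partial>M)"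
    proof (rule nn_integral_mono_AE)
      show "AE x in M. ennreal ((u n x - v x)\<^sup>2) \<le> liminf (\<lambda>i. ennreal ((u n x - u (r i) x)\<^sup>2))"
        using conv
      proof eventually_elim
        case (elim x)
        have "(\<lambda>i. ennreal ((u n x - u (r i) x)\<^sup>2)) \<longlonglongrightarrow> ennreal ((u n x - v x)\<^sup>2)"
          by (intro tendsto_ennrealI tendsto_intros elim)
        then have "liminf (\<lambda>i. ennreal ((u n x - u (r i) x)\<^sup>2)) = ennreal ((u n x - v x)\<^sup>2)"
          by (rule lim_imp_Liminf[OF sequentially_bot])
        then show ?case by (simp only: order_refl)
      qed
    qed
    also have "\<dots> \<le> liminf (\<lambda>i. \<integral>\<^sup>+x. ennreal ((u n x - u (r i) x)\<^sup>2) \<partial>M)"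
      by (rule nn_integral_liminf) simp
    also have "\<dots> \<le> liminf (\<lambda>i. ennreal (e\<^sup>2))"
    proof (rule Liminf_mono)
      show "\<forall>\<^sub>F i in sequentially. (\<integral>\<^sup>+x. ennreal ((u n x - u (r i) x)\<^sup>2) \<partial>M) \<le> ennreal (e\<^sup>2)"
        using eventually_ge_at_top[of N]
      proof eventually_elim
        case (elim i)
        have ri: "r i \<ge> N" using seq_suble[OF r(1), of i] elim by linarith
        have "(\<integral>\<^sup>+x. ennreal ((u n x - u (r i) x)\<^sup>2) \<partial>M) = ennreal (LINT x|M. (u n x - u (r i) x)\<^sup>2)"
          by (rule nn_integral_eq_integral[OF L2_square_integrable[OF L2_diff[OF u u]]]) simp
        also have "(LINT x|M. (u n x - u (r i) x)\<^sup>2) = (L2_norm M (\<lambda>x. u n x - u (r i) x))\<^sup>2"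
          unfolding L2_norm_sq[OF L2_diff[OF u u]] L2_inner_def by (simp add: power2_eq_square)
        also have "ennreal \<dots> \<le> ennreal (e\<^sup>2)"
          using N[OF n ri] L2_norm_nonneg[OF L2_diff[OF u u]] by (intro ennreal_leI power_mono) auto
        finally show ?case .
      qed
    qed
    finally have le: "(\<integral>\<^sup>+x. ennreal ((u n x - v x)\<^sup>2) \<partial>M) \<le> ennreal (e\<^sup>2)"
      by (simp add: Liminf_const)
    then have "integrable M (\<lambda>x. (u n x - v x)\<^sup>2)"
      by (intro integrableI_bounded) (auto simp: le_less_trans[OF le])
    moreover from this have "(LINT x|M. (u n x - v x)\<^sup>2) \<le> e\<^sup>2"
      using le by (subst (asm) nn_integral_eq_integral) auto
    then have "L2_norm M (\<lambda>x. u n x - v x) \<le> sqrt (e\<^sup>2)"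
      unfolding L2_norm_def L2_inner_def power2_eq_square by (rule real_sqrt_le_mono)
    ultimately show ?thesis using e by simp
  qed
  obtain N0 where "\<And>i j. i \<ge> N0 \<Longrightarrow> j \<ge> N0 \<Longrightarrow> L2_norm M (\<lambda>x. u i x - u j x) < 1" using C[of 1] by auto
  from bound[OF _ this order_refl] have "(\<lambda>x. u N0 x - v x) \<in> L2 M" by (simp add: L2_def)
  from L2_diff[OF u[of N0] this] have vL: "v \<in> L2 M" by simp
  have "(\<lambda>n. L2_norm M (\<lambda>x. u n x - v x)) \<longlonglongrightarrow> 0"
  proof (rule LIMSEQ_I)
    fix e :: real assume "e > 0"
    then have e: "e / 2 > 0" by simp
    then obtain N where N: "\<And>i j. i \<ge> N \<Longrightarrow> j \<ge> N \<Longrightarrow> L2_norm M (\<lambda>x. u i x - u j x) < e / 2" using C by blast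
    show "\<exists>N. \<forall>n\<ge>N. norm (L2_norm M (\<lambda>x. u n x - v x) - 0) < e"
    proof (intro exI[of _ N] allI impI)
      fix n assume "n \<ge> N"
      from bound[OF e N this] show "norm (L2_norm M (\<lambda>x. u n x - v x) - 0) < e"
        using L2_norm_nonneg[OF L2_diff[OF u vL], of n] e by simp
    qed
  qed
  with vL show ?thesis by (rule that)
qed

end

text \<open>
  The class of \<open>u\<close> as the functional $v \mapsto (u,v)$ on the unit ball of $L^2$,
  extended by zero to all functions. It is an element of a Banach space whose type does not mention
  the measure. The discrete topology on the index type makes every bounded function continuous.
\<close>

definition L2_functional :: "'a measure \<Rightarrow> ('a \<Rightarrow> real) \<Rightarrow> (('a \<Rightarrow> real) discrete \<Rightarrow>\<^sub>C real)" where
  "L2_functional M u = Bcontfun (\<lambda>i. if of_discrete i \<in> L2 M \<and> L2_norm M (of_discrete i) \<le> 1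
     then L2_inner M u (of_discrete i) else 0)"

definition L2_space :: "'a measure \<Rightarrow> (('a \<Rightarrow> real) discrete \<Rightarrow>\<^sub>C real) set" where
  "L2_space M = L2_functional M ` L2 M"

lemma apply_L2_functional:
  assumes "u \<in> L2 M"
  shows "apply_bcontfun (L2_functional M u) = (\<lambda>i. if of_discrete i \<in> L2 M \<and> L2_norm M (of_discrete i) \<le> 1
     then L2_inner M u (of_discrete i) else 0)"
  unfolding L2_functional_def
proof (rule Bcontfun_inverse, rule bcontfun_normI)
  show "continuous_on UNIV (\<lambda>i. if of_discrete i \<in> L2 M \<and> L2_norm M (of_discrete i) \<le> 1
     then L2_inner M u (of_discrete i) else 0)"
    by (simp add: continuous_on_open_vimage open_discrete)
  show "norm (if of_discrete i \<in> L2 M \<and> L2_norm M (of_discrete i) \<le> 1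
     then L2_inner M u (of_discrete i) else 0) \<le> L2_norm M u" for i
    using L2_cauchy_schwarz[OF assms, of "of_discrete i"] L2_norm_nonneg[OF assms]
      mult_left_le[of "L2_norm M (of_discrete i)" "L2_norm M u"] by (auto intro: order_trans)
qed

lemma L2_functional_add:
  assumes "u \<in> L2 M" "v \<in> L2 M"
  shows "L2_functional M (\<lambda>x. u x + v x) = L2_functional M u + L2_functional M v"
  by (rule bcontfun_eqI) (simp add: apply_L2_functional assms L2_add L2.B_add)

lemma L2_functional_scale:
  assumes "u \<in> L2 M" shows "L2_functional M (\<lambda>x. c * u x) = c *\<^sub>R L2_functional M u"
  by (rule bcontfun_eqI) (simp add: apply_L2_functional assms L2_scale L2.B_scale)

lemma L2_functional_diff:
  assumes "u \<in> L2 M" "v \<in> L2 M"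
  shows "L2_functional M (\<lambda>x. u x - v x) = L2_functional M u - L2_functional M v"
  by (rule bcontfun_eqI) (simp add: apply_L2_functional assms L2_diff L2.B_diff)

lemma L2_functional_sum:
  assumes "\<And>i. i \<in> I \<Longrightarrow> f i \<in> L2 M"
  shows "L2_functional M (\<lambda>x. \<Sum>i\<in>I. f i x) = (\<Sum>i\<in>I. L2_functional M (f i))"
  using assms
proof (induction I rule: infinite_finite_induct)
  case (insert i I)
  then show ?case by (simp add: L2_functional_add L2_sum)
qed (use L2_functional_scale[OF L2_zero[of M], of 0] in simp_all)

text \<open>
  The supremum over the unit ball is attained at \<open>u\<close> divided by its norm.
\<close>

lemma norm_L2_functional:
  assumes u: "u \<in> L2 M" shows "norm (L2_functional M u) = L2_norm M u"
proof (rule antisym)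
  show "norm (L2_functional M u) \<le> L2_norm M u"
  proof (rule norm_bound)
    show "norm (apply_bcontfun (L2_functional M u) i) \<le> L2_norm M u" for i
      using L2_cauchy_schwarz[OF assms, of "of_discrete i"] L2_norm_nonneg[OF assms]
        mult_left_le[of "L2_norm M (of_discrete i)" "L2_norm M u"]
      by (auto simp: apply_L2_functional[OF u] intro: order_trans)
  qed
  show "L2_norm M u \<le> norm (L2_functional M u)"
  proof (cases "L2_norm M u = 0")
    case False
    then have p: "L2_norm M u > 0" using L2_norm_nonneg[OF u] by simp
    let ?v = "\<lambda>x. 1 / L2_norm M u * u x"
    have v: "?v \<in> L2 M" by (rule L2_scale[OF u])
    have "L2_inner M u ?v = 1 / L2_norm M u * (L2_norm M u)\<^sup>2"
      unfolding L2_norm_sq[OF u] by (rule L2.B_scale_right[OF u u])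
    then have uv: "L2_inner M u ?v = L2_norm M u" using p by (simp add: power2_eq_square)
    have "(L2_norm M ?v)\<^sup>2 = 1 / L2_norm M u * L2_inner M u ?v"
      using L2_norm_sq[OF v] L2.B_scale[OF u v, of "1 / L2_norm M u"] by simp
    then have "(L2_norm M ?v)\<^sup>2 = 1" using uv p by simp
    then have "L2_norm M ?v = 1" using L2_norm_nonneg[OF v] by (simp add: power2_eq_1_iff)
    then have "apply_bcontfun (L2_functional M u) (discrete ?v) = L2_norm M u"
      using v uv by (simp add: apply_L2_functional[OF u] discrete_inverse)
    then show ?thesis using norm_bounded[of "L2_functional M u" "discrete ?v"] p by simp
  qed simp
qed

lemma norm_L2_functional_diff:
  "u \<in> L2 M \<Longrightarrow> v \<in> L2 M \<Longrightarrow> norm (L2_functional M u - L2_functional M v) = L2_norm M (\<lambda>x. u x - v x)"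
  by (simp add: norm_L2_functional L2_diff flip: L2_functional_diff)

lemma L2_functional_eq_iff:
  assumes "u \<in> L2 M" "v \<in> L2 M"
  shows "L2_functional M u = L2_functional M v \<longleftrightarrow> (AE x in M. u x = v x)"
proof -
  have "L2_functional M u = L2_functional M v \<longleftrightarrow> L2_norm M (\<lambda>x. u x - v x) = 0"
    unfolding norm_L2_functional_diff[OF assms, symmetric] by simp
  then show ?thesis using L2_norm_zero_iff[OF L2_diff[OF assms]] by simp
qed

lemma L2_functional_tendsto_iff:
  assumes "\<And>i. u i \<in> L2 M" "v \<in> L2 M"
  shows "((\<lambda>i. L2_functional M (u i)) \<longlongrightarrow> L2_functional M v) F
    \<longleftrightarrow> ((\<lambda>i. L2_norm M (\<lambda>x. u i x - v x)) \<longlongrightarrow> 0) F"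
proof -
  have "((\<lambda>i. L2_functional M (u i)) \<longlongrightarrow> L2_functional M v) F
    \<longleftrightarrow> ((\<lambda>i. norm (L2_functional M (u i) - L2_functional M v)) \<longlongrightarrow> 0) F"
    by (simp add: tendsto_norm_zero_iff LIM_zero_iff)
  then show ?thesis by (simp only: norm_L2_functional_diff[OF assms])
qed

lemma (in sigma_finite_measure) L2_space_closed_subspace: "closed_subspace (L2_space M)"
proof
  show "subspace (L2_space M)"
  proof (rule subspaceI)
    show "0 \<in> L2_space M"
      unfolding L2_space_def using L2_functional_scale[OF L2_zero[of M], of 0] L2_zero[of M]
      by (auto intro!: image_eqI[where x="\<lambda>x. 0"])
    show "x + y \<in> L2_space M" if "x \<in> L2_space M" "y \<in> L2_space M" for x y
      using that unfolding L2_space_def by (auto simp: L2_add simp flip: L2_functional_add)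
    show "c *\<^sub>R x \<in> L2_space M" if "x \<in> L2_space M" for c x
      using that unfolding L2_space_def by (auto simp: L2_scale simp flip: L2_functional_scale)
  qed
  show "closed (L2_space M)"
    unfolding closed_sequential_limits
  proof (intro allI impI, elim conjE)
    fix X l assume X: "\<forall>n. X n \<in> L2_space M" "X \<longlonglongrightarrow> l"
    then have "\<exists>u. \<forall>n. u n \<in> L2 M \<and> X n = L2_functional M (u n)"
      unfolding L2_space_def image_iff by (metis (no_types, lifting))
    then obtain u where u: "\<And>n. u n \<in> L2 M" "\<And>n. X n = L2_functional M (u n)" by blast
    have "Cauchy X" using X(2) by (rule LIMSEQ_imp_Cauchy)
    then have C: "\<exists>N. \<forall>i\<ge>N. \<forall>j\<ge>N. L2_norm M (\<lambda>x. u i x - u j x) < e" if "e > 0" for e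
      using that unfolding Cauchy_iff u(2) norm_L2_functional_diff[OF u(1) u(1)] by blast
    obtain v where v: "v \<in> L2 M" "(\<lambda>n. L2_norm M (\<lambda>x. u n x - v x)) \<longlonglongrightarrow> 0"
      using L2_complete[of u, OF u(1) C] by blast
    have "X \<longlonglongrightarrow> L2_functional M v"
      unfolding u(2)[abs_def] L2_functional_tendsto_iff[OF u(1) v(1)] by (rule v(2))
    then show "l \<in> L2_space M" using LIMSEQ_unique[OF X(2)] v(1) by (auto simp: L2_space_def)
  qed
qed

section \<open>Operators on functions and on classes\<close>

definition L2_rep :: "'a measure \<Rightarrow> (('a \<Rightarrow> real) discrete \<Rightarrow>\<^sub>C real) \<Rightarrow> 'a \<Rightarrow> real" where
  "L2_rep M w = (SOME u. u \<in> L2 M \<and> L2_functional M u = w)"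

definition lift_op :: "'a measure \<Rightarrow> (('a \<Rightarrow> real) \<Rightarrow> 'a \<Rightarrow> real)
    \<Rightarrow> (('a \<Rightarrow> real) discrete \<Rightarrow>\<^sub>C real) \<Rightarrow> (('a \<Rightarrow> real) discrete \<Rightarrow>\<^sub>C real)" where
  "lift_op M A w = L2_functional M (A (L2_rep M w))"

definition lower_op :: "'a measure \<Rightarrow> ((('a \<Rightarrow> real) discrete \<Rightarrow>\<^sub>C real) \<Rightarrow> (('a \<Rightarrow> real) discrete \<Rightarrow>\<^sub>C real))
    \<Rightarrow> ('a \<Rightarrow> real) \<Rightarrow> 'a \<Rightarrow> real" where
  "lower_op M B u = L2_rep M (B (L2_functional M u))"

lemma L2_functional_in: "u \<in> L2 M \<Longrightarrow> L2_functional M u \<in> L2_space M"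
  by (simp add: L2_space_def)

lemma L2_spaceE:
  assumes "w \<in> L2_space M" obtains u where "u \<in> L2 M" "w = L2_functional M u"
  using assms by (auto simp: L2_space_def)

lemma L2_rep:
  assumes "w \<in> L2_space M" shows "L2_rep M w \<in> L2 M" "L2_functional M (L2_rep M w) = w"
proof -
  have "\<exists>u. u \<in> L2 M \<and> L2_functional M u = w" using assms by (auto simp: L2_space_def)
  from someI_ex[OF this] show "L2_rep M w \<in> L2 M" "L2_functional M (L2_rep M w) = w"
    by (simp_all add: L2_rep_def)
qed

lemma L2_bounded_operatorD:
  assumes "L2_bounded_operator M A"
  shows "u \<in> L2 M \<Longrightarrow> A u \<in> L2 M"
    "u \<in> L2 M \<Longrightarrow> v \<in> L2 M \<Longrightarrow> AE x in M. A (\<lambda>y. u y + v y) x = A u x + A v x"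
    "u \<in> L2 M \<Longrightarrow> AE x in M. A (\<lambda>y. c * u y) x = c * A u x"
  using assms unfolding L2_bounded_operator_def by blast+

lemma L2_bounded_operatorE:
  assumes "L2_bounded_operator M A"
  obtains C where "\<And>u. u \<in> L2 M \<Longrightarrow> L2_norm M (A u) \<le> C * L2_norm M u"
  using assms unfolding L2_bounded_operator_def by blast

lemma L2_bounded_operator_diff:
  assumes A: "L2_bounded_operator M A" and u: "u \<in> L2 M" and v: "v \<in> L2 M"
  shows "AE x in M. A (\<lambda>y. u y - v y) x = A u x - A v x"
proof -
  have "AE x in M. A (\<lambda>y. u y + (-1) * v y) x = A u x - A v x"
    using L2_bounded_operatorD(2)[OF A u L2_scale[OF v, of "-1"]] L2_bounded_operatorD(3)[OF A v, of "-1"]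
    by eventually_elim simp
  then show ?thesis by simp
qed

lemma L2_bounded_operator_cong:
  assumes A: "L2_bounded_operator M A" and u: "u \<in> L2 M" and v: "v \<in> L2 M" and eq: "AE x in M. u x = v x"
  shows "AE x in M. A u x = A v x"
proof -
  obtain C where C: "\<And>u. u \<in> L2 M \<Longrightarrow> L2_norm M (A u) \<le> C * L2_norm M u"
    using L2_bounded_operatorE[OF A] by blast
  note d = L2_diff[OF u v]
  have "L2_norm M (\<lambda>x. u x - v x) = 0" using L2_norm_zero_iff[OF d] eq by simp
  then have "L2_norm M (A (\<lambda>x. u x - v x)) = 0"
    using C[OF d] L2_norm_nonneg[OF L2_bounded_operatorD(1)[OF A d]] by simp
  then have "AE x in M. A (\<lambda>x. u x - v x) x = 0"
    using L2_norm_zero_iff[OF L2_bounded_operatorD(1)[OF A d]] by simp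
  with L2_bounded_operator_diff[OF A u v] show ?thesis by eventually_elim simp
qed

text \<open>
  A bounded linear operator cannot distinguish functions that are equal almost everywhere, so the
  choice of a representative does not matter.
\<close>

lemma lift_op_functional:
  assumes A: "L2_bounded_operator M A" and u: "u \<in> L2 M"
  shows "lift_op M A (L2_functional M u) = L2_functional M (A u)"
proof -
  note r = L2_rep[OF L2_functional_in[OF u]]
  have "AE x in M. L2_rep M (L2_functional M u) x = u x"
    using r L2_functional_eq_iff[OF r(1) u] by simp
  from L2_bounded_operator_cong[OF A r(1) u this] show ?thesis
    unfolding lift_op_def
    by (subst L2_functional_eq_iff) (simp_all add: L2_bounded_operatorD(1)[OF A] r u)
qed

lemma lift_op_bounded:
  assumes A: "L2_bounded_operator M A" shows "bounded_map_on (L2_space M) (lift_op M A)"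
  unfolding bounded_map_on_def linear_map_on_def
proof (intro conjI ballI allI)
  fix x assume "x \<in> L2_space M"
  then obtain u where u: "u \<in> L2 M" "x = L2_functional M u" by (rule L2_spaceE)
  note Au = L2_bounded_operatorD(1)[OF A u(1)]
  show "lift_op M A x \<in> L2_space M" by (simp add: u lift_op_functional[OF A] L2_functional_in Au)
  show "lift_op M A (c *\<^sub>R x) = c *\<^sub>R lift_op M A x" for c
    unfolding u(2) L2_functional_scale[OF u(1), symmetric] lift_op_functional[OF A u(1)]
      lift_op_functional[OF A L2_scale[OF u(1)]] L2_functional_scale[OF Au, symmetric]
    by (subst L2_functional_eq_iff)
      (simp_all add: L2_bounded_operatorD[OF A] L2_scale u(1) Au)
  fix y assume "y \<in> L2_space M"
  then obtain v where v: "v \<in> L2 M" "y = L2_functional M v" by (rule L2_spaceE)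
  note Av = L2_bounded_operatorD(1)[OF A v(1)]
  show "lift_op M A (x + y) = lift_op M A x + lift_op M A y"
    unfolding u(2) v(2) L2_functional_add[OF u(1) v(1), symmetric] lift_op_functional[OF A u(1)]
      lift_op_functional[OF A v(1)] lift_op_functional[OF A L2_add[OF u(1) v(1)]]
      L2_functional_add[OF Au Av, symmetric]
    by (subst L2_functional_eq_iff)
      (simp_all add: L2_bounded_operatorD[OF A] L2_add u(1) v(1) Au Av)
next
  obtain C where C: "\<And>u. u \<in> L2 M \<Longrightarrow> L2_norm M (A u) \<le> C * L2_norm M u"
    using L2_bounded_operatorE[OF A] by blast
  have "norm (lift_op M A x) \<le> C * norm x" if x: "x \<in> L2_space M" for x
  proof -
    obtain u where u: "u \<in> L2 M" "x = L2_functional M u" using x by (rule L2_spaceE)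
    show ?thesis
      using C[OF u(1)] by (simp add: u lift_op_functional[OF A] norm_L2_functional L2_bounded_operatorD(1)[OF A])
  qed
  then show "\<exists>C. \<forall>x\<in>L2_space M. norm (lift_op M A x) \<le> C * norm x" by blast
qed

lemma lower_op_bounded:
  assumes B: "bounded_map_on (L2_space M) B"
  shows "L2_bounded_operator M (lower_op M B)"
    "u \<in> L2 M \<Longrightarrow> L2_functional M (lower_op M B u) = B (L2_functional M u)"
proof -
  have lin: "linear_map_on (L2_space M) B" using B by (simp add: bounded_map_on_def)
  have in1: "lower_op M B u \<in> L2 M" and eq: "L2_functional M (lower_op M B u) = B (L2_functional M u)"
    if "u \<in> L2 M" for u
    using L2_rep[OF linear_map_onD(1)[OF lin L2_functional_in[OF that]]] by (simp_all add: lower_op_def)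
  then show "u \<in> L2 M \<Longrightarrow> L2_functional M (lower_op M B u) = B (L2_functional M u)" by blast
  show "L2_bounded_operator M (lower_op M B)"
    unfolding L2_bounded_operator_def
  proof (intro conjI ballI allI in1)
    fix u assume u: "u \<in> L2 M"
    show "AE x in M. lower_op M B (\<lambda>y. c * u y) x = c * lower_op M B u x" for c
      using L2_functional_eq_iff[OF in1[OF L2_scale[OF u]] L2_scale[OF in1[OF u]], of c c]
        linear_map_onD(3)[OF lin L2_functional_in[OF u], of c]
      by (simp add: eq u L2_scale L2_functional_scale in1)
    fix v assume v: "v \<in> L2 M"
    show "AE x in M. lower_op M B (\<lambda>y. u y + v y) x = lower_op M B u x + lower_op M B v x"
      using L2_functional_eq_iff[OF in1[OF L2_add[OF u v]] L2_add[OF in1[OF u] in1[OF v]]]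
        linear_map_onD(2)[OF lin L2_functional_in[OF u] L2_functional_in[OF v]]
      by (simp add: eq u v L2_add L2_functional_add in1)
  next
    obtain C where C: "\<And>x. x \<in> L2_space M \<Longrightarrow> norm (B x) \<le> C * norm x"
      using B by (auto simp: bounded_map_on_def)
    have "L2_norm M (lower_op M B u) \<le> C * L2_norm M u" if "u \<in> L2 M" for u
      using C[OF L2_functional_in[OF that]] that by (simp add: norm_L2_functional in1 flip: eq)
    then show "\<exists>C. \<forall>u\<in>L2 M. L2_norm M (lower_op M B u) \<le> C * L2_norm M u" by blast
  qed
qed

lemma C0_semigroupD:
  assumes "C0_semigroup M T"
  shows "0 \<le> t \<Longrightarrow> L2_bounded_operator M (T t)" "0 \<le> t \<Longrightarrow> u \<in> L2 M \<Longrightarrow> T t u \<in> L2 M"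
    "u \<in> L2 M \<Longrightarrow> AE x in M. T 0 u x = u x"
    "0 \<le> s \<Longrightarrow> 0 \<le> t \<Longrightarrow> u \<in> L2 M \<Longrightarrow> AE x in M. T (s + t) u x = T s (T t u) x"
    "u \<in> L2 M \<Longrightarrow> ((\<lambda>h. L2_norm M (\<lambda>x. T h u x - u x)) \<longlongrightarrow> 0) (at_right 0)"
  using assms unfolding C0_semigroup_def L2_bounded_operator_def by blast+

text \<open>
  The functions need to be square-integrable for positive \<open>h\<close> only, as a semigroup is
  specified for nonnegative times only.
\<close>

lemma L2_functional_tendsto_at_right:
  assumes "\<And>h. 0 < h \<Longrightarrow> u h \<in> L2 M" "v \<in> L2 M"
  shows "((\<lambda>h. L2_functional M (u h)) \<longlongrightarrow> L2_functional M v) (at_right (0::real))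
    \<longleftrightarrow> ((\<lambda>h. L2_norm M (\<lambda>x. u h x - v x)) \<longlongrightarrow> 0) (at_right 0)"
proof -
  have "((\<lambda>h. L2_functional M (u h)) \<longlongrightarrow> L2_functional M v) (at_right 0)
    \<longleftrightarrow> ((\<lambda>h. norm (L2_functional M (u h) - L2_functional M v)) \<longlongrightarrow> 0) (at_right 0)"
    by (simp add: tendsto_norm_zero_iff LIM_zero_iff)
  also have "\<dots> \<longleftrightarrow> ((\<lambda>h. L2_norm M (\<lambda>x. u h x - v x)) \<longlongrightarrow> 0) (at_right 0)"
  proof (rule filterlim_cong[OF refl refl])
    show "\<forall>\<^sub>F h in at_right 0. norm (L2_functional M (u h) - L2_functional M v) = L2_norm M (\<lambda>x. u h x - v x)"
      using eventually_at_right_less[of "0::real"]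
      by eventually_elim (rule norm_L2_functional_diff[OF assms])
  qed
  finally show ?thesis .
qed

lemma generates_lift_iff:
  assumes T: "\<And>t. 0 \<le> t \<Longrightarrow> L2_bounded_operator M (T t)" and u: "u \<in> L2 M" and g: "g \<in> L2 M"
  shows "generates M T u g \<longleftrightarrow> generator_on (L2_space M) (\<lambda>t. lift_op M (T t)) (L2_functional M u) (L2_functional M g)"
proof -
  have Tu: "T h u \<in> L2 M" if "0 < h" for h using L2_bounded_operatorD(1)[OF T u] that by simp
  have q: "(\<lambda>x. (T h u x - u x) / h) \<in> L2 M" if "0 < h" for h
    using L2_scale[OF L2_diff[OF Tu[OF that] u], of "1 / h"] by simp
  have eq: "L2_functional M (\<lambda>x. (T h u x - u x) / h) = (lift_op M (T h) (L2_functional M u) - L2_functional M u) /\<^sub>R h"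
    if "0 < h" for h
    using L2_functional_scale[OF L2_diff[OF Tu[OF that] u], of "1 / h"] that
    by (simp add: lift_op_functional[OF T u] L2_functional_diff[OF Tu[OF that] u] divide_inverse mult.commute)
  have "generates M T u g \<longleftrightarrow> ((\<lambda>h. L2_functional M (\<lambda>x. (T h u x - u x) / h)) \<longlongrightarrow> L2_functional M g) (at_right 0)"
    unfolding generates_def using u g
      L2_functional_tendsto_at_right[where u="\<lambda>h x. (T h u x - u x) / h", OF q g] by simp
  also have "\<dots> \<longleftrightarrow> ((\<lambda>h. (lift_op M (T h) (L2_functional M u) - L2_functional M u) /\<^sub>R h) \<longlongrightarrow> L2_functional M g) (at_right 0)"
  proof (rule filterlim_cong[OF refl refl])
    show "\<forall>\<^sub>F h in at_right 0. L2_functional M (\<lambda>x. (T h u x - u x) / h) = (lift_op M (T h) (L2_functional M u) - L2_functional M u) /\<^sub>R h"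
      using eventually_at_right_less[of "0::real"] by eventually_elim (rule eq)
  qed
  finally show ?thesis unfolding generator_on_def using L2_functional_in u g by blast
qed

lemma C0_lift:
  assumes T: "C0_semigroup M T" shows "C0_on (L2_space M) (\<lambda>t. lift_op M (T t))"
  unfolding C0_on_def
proof (intro conjI allI impI ballI)
  note b = C0_semigroupD(1)[OF T] and i = C0_semigroupD(2)[OF T]
  show "bounded_map_on (L2_space M) (lift_op M (T t))" if "0 \<le> t" for t
    by (rule lift_op_bounded[OF b[OF that]])
  fix x assume "x \<in> L2_space M"
  then obtain u where u: "u \<in> L2 M" "x = L2_functional M u" by (rule L2_spaceE)
  show "lift_op M (T 0) x = x"
    unfolding u(2) lift_op_functional[OF b[OF order_refl] u(1)]
    by (subst L2_functional_eq_iff) (simp_all add: i u(1) C0_semigroupD(3)[OF T])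
  show "lift_op M (T (s + t)) x = lift_op M (T s) (lift_op M (T t) x)" if st: "0 \<le> s" "0 \<le> t" for s t
    unfolding u(2) lift_op_functional[OF b[OF st(2)] u(1)] lift_op_functional[OF b[OF st(1)] i[OF st(2) u(1)]]
      lift_op_functional[OF b[OF add_nonneg_nonneg[OF st]] u(1)]
    by (subst L2_functional_eq_iff) (simp_all add: i st u(1) C0_semigroupD(4)[OF T])
  have "((\<lambda>h. L2_functional M (T h u)) \<longlongrightarrow> x) (at_right 0)"
    unfolding u(2) using C0_semigroupD(5)[OF T u(1)] L2_functional_tendsto_at_right[of "\<lambda>h. T h u" M u] i u(1) by simp
  moreover have "\<forall>\<^sub>F h in at_right 0. L2_functional M (T h u) = lift_op M (T h) x"
    using eventually_at_right_less[of "0::real"]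
    by eventually_elim (simp add: u lift_op_functional[OF b])
  ultimately show "((\<lambda>h. lift_op M (T h) x) \<longlongrightarrow> x) (at_right 0)" by (rule Lim_transform_eventually)
qed

lemma C0_lower:
  assumes S: "C0_on (L2_space M) S" shows "C0_semigroup M (\<lambda>t. lower_op M (S t))"
  unfolding C0_semigroup_def
proof (intro conjI allI impI ballI)
  note b = lower_op_bounded[OF C0_onD(1)[OF S]]
  note i = L2_bounded_operatorD(1)[OF b(1)]
  show "L2_bounded_operator M (lower_op M (S t))" if "0 \<le> t" for t by (rule b(1)[OF that])
  fix u assume u: "u \<in> L2 M"
  note eu = L2_functional_in[OF u]
  show "AE x in M. lower_op M (S 0) u x = u x"
    using L2_functional_eq_iff[OF i[OF order_refl u] u] b(2)[OF order_refl u] C0_onD(4)[OF S eu] by simp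
  show "AE x in M. lower_op M (S (s + t)) u x = lower_op M (S s) (lower_op M (S t) u) x" if st: "0 \<le> s" "0 \<le> t" for s t
    using L2_functional_eq_iff[OF i[OF add_nonneg_nonneg[OF st] u] i[OF st(1) i[OF st(2) u]]]
      b(2)[OF add_nonneg_nonneg[OF st] u] b(2)[OF st(2) u] b(2)[OF st(1) i[OF st(2) u]]
      C0_onD(5)[OF S st eu] by simp
  have "\<forall>\<^sub>F h in at_right 0. S h (L2_functional M u) = L2_functional M (lower_op M (S h) u)"
    using eventually_at_right_less[of "0::real"] by eventually_elim (simp add: b(2) u)
  with C0_onD(6)[OF S eu] have "((\<lambda>h. L2_functional M (lower_op M (S h) u)) \<longlongrightarrow> L2_functional M u) (at_right 0)"
    by (rule Lim_transform_eventually)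
  then show "((\<lambda>h. L2_norm M (\<lambda>x. lower_op M (S h) u x - u x)) \<longlongrightarrow> 0) (at_right 0)"
    by (subst (asm) L2_functional_tendsto_at_right) (simp_all add: i u)
qed

lemma lift_lower:
  assumes "bounded_map_on (L2_space M) B" "w \<in> L2_space M"
  shows "lift_op M (lower_op M B) w = B w"
  using L2_spaceE[OF assms(2)] lift_op_functional[OF lower_op_bounded(1)[OF assms(1)]]
    lower_op_bounded(2)[OF assms(1)] by metis

lemma generator_on_cong:
  assumes "\<And>t. 0 < t \<Longrightarrow> S t x = T t x"
  shows "generator_on W S x g \<longleftrightarrow> generator_on W T x g"
proof -
  have "((\<lambda>h. (S h x - x) /\<^sub>R h) \<longlongrightarrow> g) (at_right 0) \<longleftrightarrow> ((\<lambda>h. (T h x - x) /\<^sub>R h) \<longlongrightarrow> g) (at_right 0)"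
  proof (rule filterlim_cong[OF refl refl])
    show "\<forall>\<^sub>F h in at_right 0. (S h x - x) /\<^sub>R h = (T h x - x) /\<^sub>R h"
      using eventually_at_right_less[of "0::real"] by eventually_elim (simp add: assms)
  qed
  then show ?thesis by (simp add: generator_on_def)
qed

text \<open>
  A semigroup on classes that has the right generator and is unique with this property determines
  the chosen semigroup on functions. Existence is needed for the choice to have its defining
  property at all, uniqueness to identify the result.
\<close>

lemma form_semigroup_characterization:
  assumes S: "C0_on (L2_space M) S"
    and dom: "\<And>u f. form_operator M E u f \<Longrightarrow> u \<in> L2 M \<and> f \<in> L2 M"
    and gen: "\<And>u f. u \<in> L2 M \<Longrightarrow> f \<in> L2 M \<Longrightarrow>
      form_operator M E u f \<longleftrightarrow> generator_on (L2_space M) S (L2_functional M u) (- L2_functional M f)"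
    and uniq: "\<And>T x t. C0_on (L2_space M) T \<Longrightarrow>
      (\<And>x g. x \<in> L2_space M \<Longrightarrow> g \<in> L2_space M \<Longrightarrow>
        generator_on (L2_space M) T x g \<longleftrightarrow> generator_on (L2_space M) S x g) \<Longrightarrow>
      x \<in> L2_space M \<Longrightarrow> 0 \<le> t \<Longrightarrow> T t x = S t x"
  shows "C0_semigroup M (form_semigroup M E)"
    "0 \<le> t \<Longrightarrow> u \<in> L2 M \<Longrightarrow> L2_functional M (form_semigroup M E t u) = S t (L2_functional M u)"
proof -
  have neg: "(\<lambda>x. - f x) \<in> L2 M" "L2_functional M (\<lambda>x. - f x) = - L2_functional M f" if "f \<in> L2 M" for f
    using L2_scale[OF that, of "-1"] L2_functional_scale[OF that, of "-1"] by simp_all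
  let ?Q = "\<lambda>T. C0_semigroup M T \<and> (\<forall>u f. form_operator M E u f \<longleftrightarrow> generates M T u (\<lambda>x. - f x))"
  let ?T0 = "\<lambda>t. lower_op M (S t)"
  have "form_operator M E u f \<longleftrightarrow> generates M ?T0 u (\<lambda>x. - f x)" for u f
  proof (cases "u \<in> L2 M \<and> f \<in> L2 M")
    case True
    then have u: "u \<in> L2 M" and f: "f \<in> L2 M" by auto
    have "generates M ?T0 u (\<lambda>x. - f x) \<longleftrightarrow>
        generator_on (L2_space M) (\<lambda>t. lift_op M (?T0 t)) (L2_functional M u) (L2_functional M (\<lambda>x. - f x))"
      by (rule generates_lift_iff[OF lower_op_bounded(1)[OF C0_onD(1)[OF S]] u neg(1)[OF f]])
    also have "\<dots> \<longleftrightarrow> generator_on (L2_space M) S (L2_functional M u) (L2_functional M (\<lambda>x. - f x))"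
      by (rule generator_on_cong)
        (rule lift_lower[OF C0_onD(1)[OF S less_imp_le] L2_functional_in[OF u]])
    finally show ?thesis using gen[OF u f] neg(2)[OF f] by simp
  next
    case False
    moreover have "f \<in> L2 M" if "(\<lambda>x. - f x) \<in> L2 M" using neg(1)[OF that] by simp
    ultimately show ?thesis using dom by (auto simp: generates_def)
  qed
  then have "?Q ?T0" using C0_lower[OF S] by blast
  then have Q: "?Q (form_semigroup M E)" unfolding form_semigroup_def by (rule someI[where P="?Q"])
  let ?T = "form_semigroup M E"
  show C0: "C0_semigroup M ?T" using Q by blast
  assume t: "0 \<le> t" and u: "u \<in> L2 M"
  have "lift_op M (?T t) (L2_functional M u) = S t (L2_functional M u)"
  proof (rule uniq[OF C0_lift[OF C0] _ L2_functional_in[OF u] t])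
    fix x g assume "x \<in> L2_space M" "g \<in> L2_space M"
    then obtain v h where v: "v \<in> L2 M" "x = L2_functional M v" and h: "h \<in> L2 M" "g = L2_functional M h"
      using L2_spaceE by metis
    have "generator_on (L2_space M) (\<lambda>t. lift_op M (?T t)) x g \<longleftrightarrow> generates M ?T v h"
      unfolding v h by (rule generates_lift_iff[symmetric, OF C0_semigroupD(1)[OF C0] v(1) h(1)])
    also have "\<dots> \<longleftrightarrow> form_operator M E v (\<lambda>x. - h x)" using Q by simp
    also have "\<dots> \<longleftrightarrow> generator_on (L2_space M) S x g"
      unfolding gen[OF v(1) neg(1)[OF h(1)]] neg(2)[OF h(1)] v h by simp
    finally show "generator_on (L2_space M) (\<lambda>t. lift_op M (?T t)) x g \<longleftrightarrow> generator_on (L2_space M) S x g" .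
  qed
  then show "L2_functional M (?T t u) = S t (L2_functional M u)"
    by (simp add: lift_op_functional[OF C0_semigroupD(1)[OF C0 t] u])
qed

section \<open>Resolvent and semigroup of a Dirichlet form\<close>

locale L2_form = sigma_finite_measure M for M :: "'a measure" +
  fixes E :: "'a qform"
  assumes quadratic: "quadratic_form M E" and nonneg: "nonnegative_form E"
    and dense: "densely_defined M E" and closed_E: "closed_form M E"
begin

abbreviation D where "D \<equiv> form_dom E"

lemma
  shows D_L2: "u \<in> D \<Longrightarrow> u \<in> L2 M"
    and D_AE: "u \<in> D \<Longrightarrow> v \<in> L2 M \<Longrightarrow> AE x in M. u x = v x \<Longrightarrow> v \<in> D"
    and energy_AE: "u \<in> D \<Longrightarrow> v \<in> D \<Longrightarrow> AE x in M. u x = v x \<Longrightarrow> energy E u = energy E v"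
    and D_add: "u \<in> D \<Longrightarrow> v \<in> D \<Longrightarrow> (\<lambda>x. u x + v x) \<in> D"
    and D_scale: "u \<in> D \<Longrightarrow> (\<lambda>x. c * u x) \<in> D"
    and energy_scale: "u \<in> D \<Longrightarrow> energy E (\<lambda>x. c * u x) = c\<^sup>2 * energy E u"
    and polar_add: "u \<in> D \<Longrightarrow> v \<in> D \<Longrightarrow> w \<in> D \<Longrightarrow> polar E (\<lambda>x. u x + v x) w = polar E u w + polar E v w"
    and polar_scale: "u \<in> D \<Longrightarrow> w \<in> D \<Longrightarrow> polar E (\<lambda>x. c * u x) w = c * polar E u w"
  using quadratic unfolding quadratic_form_def by blast+

lemma energy_nonneg: "u \<in> D \<Longrightarrow> 0 \<le> energy E u"
  using nonneg by (simp add: nonnegative_form_def)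

lemma D_diff: "u \<in> D \<Longrightarrow> v \<in> D \<Longrightarrow> (\<lambda>x. u x - v x) \<in> D"
  using D_add[OF _ D_scale[of v "-1"], of u] by simp

lemma polar_self: assumes "u \<in> D" shows "polar E u u = energy E u"
proof -
  have "(\<lambda>x. u x + u x) = (\<lambda>x. 2 * u x)" by auto
  then have "energy E (\<lambda>x. u x + u x) = 4 * energy E u"
    using energy_scale[OF assms, of 2] by (simp only:) simp
  moreover have "energy E (\<lambda>x. u x - u x) = 0"
    using energy_scale[OF assms, of 0] by simp
  ultimately show ?thesis by (simp add: polar_def)
qed

lemma polar_sym: assumes "u \<in> D" "v \<in> D" shows "polar E u v = polar E v u"
  using energy_scale[OF D_diff[OF assms], of "-1"] by (simp add: polar_def add.commute)

sublocale E: semi_inner_space D "polar E"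
  by standard (auto simp: D_add D_scale polar_add polar_scale polar_sym polar_self energy_nonneg)

lemma polar_AE_cong:
  assumes "u \<in> D" "u' \<in> D" "v \<in> D" "AE x in M. u x = u' x" shows "polar E u v = polar E u' v"
proof -
  have "energy E (\<lambda>x. u x + v x) = energy E (\<lambda>x. u' x + v x)"
    by (rule energy_AE) (use assms in \<open>auto simp: D_add\<close>)
  moreover have "energy E (\<lambda>x. u x - v x) = energy E (\<lambda>x. u' x - v x)"
    by (rule energy_AE) (use assms in \<open>auto simp: D_diff\<close>)
  ultimately show ?thesis by (simp add: polar_def)
qed

text \<open>
  The form of $L + \beta$.
\<close>

definition E\<^sub>\<beta> where "E\<^sub>\<beta> \<beta> u v = polar E u v + \<beta> * L2_inner M u v"

lemma shifted_form: "0 < \<beta> \<Longrightarrow> semi_inner_space D (E\<^sub>\<beta> \<beta>)"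
  by standard
    (auto simp: E\<^sub>\<beta>_def D_add D_scale D_L2 polar_add polar_scale polar_sym polar_self energy_nonneg
      L2.B_add L2.B_scale L2.sym L2.pos algebra_simps)

lemma E\<^sub>\<beta>_self_zero:
  assumes "0 < \<beta>" "u \<in> D" "E\<^sub>\<beta> \<beta> u u \<le> 0" shows "AE x in M. u x = 0"
proof -
  have "\<beta> * L2_inner M u u \<le> 0"
    using assms energy_nonneg[OF assms(2)] by (simp add: E\<^sub>\<beta>_def polar_self)
  then have "L2_inner M u u \<le> 0" using assms(1) by (simp add: mult_le_0_iff)
  then have "L2_norm M u = 0" using L2.pos[OF D_L2[OF assms(2)]] by (simp add: L2_norm_def)
  then show ?thesis using L2_norm_zero_iff[OF D_L2[OF assms(2)]] by simp
qed

lemma E\<^sub>\<beta>_unique: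
  assumes "0 < \<beta>" "u \<in> D" "v \<in> D" "\<And>w. w \<in> D \<Longrightarrow> E\<^sub>\<beta> \<beta> u w = E\<^sub>\<beta> \<beta> v w"
  shows "AE x in M. u x = v x"
proof -
  interpret B: semi_inner_space D "E\<^sub>\<beta> \<beta>" by (rule shifted_form[OF assms(1)])
  have "E\<^sub>\<beta> \<beta> (\<lambda>x. u x - v x) (\<lambda>x. u x - v x) = 0"
    using assms(4)[OF D_diff[OF assms(2,3)]] B.B_diff[OF assms(2,3) D_diff[OF assms(2,3)]] by simp
  then show ?thesis using E\<^sub>\<beta>_self_zero[OF assms(1) D_diff[OF assms(2,3)]] by simp
qed

lemma form_operator_resolvent_iff:
  assumes "f \<in> L2 M" 
  shows "form_operator M E u (\<lambda>x. f x - \<beta> * u x) \<longleftrightarrow> u \<in> D \<and> (\<forall>v\<in>D. E\<^sub>\<beta> \<beta> u v = L2_inner M f v)"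
proof -
  have "polar E u v = L2_inner M (\<lambda>x. f x - \<beta> * u x) v \<longleftrightarrow> E\<^sub>\<beta> \<beta> u v = L2_inner M f v" if "u \<in> D" "v \<in> D" for v
    using that assms by (auto simp: E\<^sub>\<beta>_def D_L2 L2_scale L2.B_diff L2.B_scale)
  then show ?thesis unfolding form_operator_def using assms L2_diff[OF assms L2_scale[OF D_L2]] by blast
qed

text \<open>
  The solution of $(L+\beta)u = f$ minimises $J(v) = \mathcal{E}[v] + \beta\|v\|^2 - 2(f,v)$. By the
  parallelogram identity a minimising sequence is Cauchy both in $L^2$ and with respect to the form,
  so closedness gives a limit in the domain. The variational equation is obtained from the sequence
  itself, by the discriminant of $c \mapsto J(u_n+cw) - \inf J$.
\<close>

lemma resolvent_exists:
  assumes \<beta>: "0 < \<beta>" and f: "f \<in> L2 M"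
  shows "\<exists>u. form_operator M E u (\<lambda>x. f x - \<beta> * u x)"
proof -
  interpret B: semi_inner_space D "E\<^sub>\<beta> \<beta>" by (rule shifted_form[OF \<beta>])
  define J where "J v = E\<^sub>\<beta> \<beta> v v - 2 * L2_inner M f v" for v
  have Jlow: "J v \<ge> - (L2_norm M f)\<^sup>2 / \<beta>" if v: "v \<in> D" for v
  proof -
    have "0 \<le> (\<beta> * L2_norm M v - L2_norm M f)\<^sup>2 / \<beta>" using \<beta> by simp
    also have "\<dots> = \<beta> * (L2_norm M v)\<^sup>2 - 2 * (L2_norm M f * L2_norm M v) + (L2_norm M f)\<^sup>2 / \<beta>"
      using \<beta> by (simp add: power2_eq_square field_simps)
    also have "\<dots> \<le> J v + (L2_norm M f)\<^sup>2 / \<beta>"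
      using L2_cauchy_schwarz[OF f D_L2[OF v]] energy_nonneg[OF v] L2_norm_sq[OF D_L2[OF v]]
      by (simp add: J_def E\<^sub>\<beta>_def polar_self v)
    finally show ?thesis by simp
  qed
  have zD: "(\<lambda>x. 0) \<in> D" using quadratic by (simp add: quadratic_form_def)
  define m where "m = Inf (J ` D)"
  have bdd: "bdd_below (J ` D)" using Jlow by (intro bdd_belowI2)
  have mJ: "m \<le> J v" if "v \<in> D" for v unfolding m_def using that bdd by (intro cInf_lower) auto
  define e where "e n = 1 / real (Suc n)" for n
  have e: "e n > 0" for n by (simp add: e_def)
  have "\<exists>u\<in>D. J u < m + e n" for n
    using cInf_less_iff[of "J ` D" "m + e n"] bdd zD e[of n] unfolding m_def by auto
  then obtain u where u: "\<And>n. u n \<in> D" "\<And>n. J (u n) < m + e n" by metis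
  have par: "E\<^sub>\<beta> \<beta> (\<lambda>x. u i x - u j x) (\<lambda>x. u i x - u j x) \<le> 2 * e i + 2 * e j" for i j
  proof -
    \<comment> \<open>The midpoint; the factor \<open>1\<close> matches the expansion of the square.\<close>
    let ?h = "\<lambda>x. 1/2 * (u i x + 1 * u j x)"
    have s: "(\<lambda>x. u i x + 1 * u j x) \<in> D" using D_add[OF u(1) u(1)] by simp
    have h: "?h \<in> D" by (rule D_scale[OF s])
    have "E\<^sub>\<beta> \<beta> ?h ?h = 1/4 * E\<^sub>\<beta> \<beta> (\<lambda>x. u i x + 1 * u j x) (\<lambda>x. u i x + 1 * u j x)"
      unfolding B.B_scale[OF s h] B.B_scale_right[OF s s] by simp
    then have 1: "4 * E\<^sub>\<beta> \<beta> ?h ?h = E\<^sub>\<beta> \<beta> (u i) (u i) + 2 * E\<^sub>\<beta> \<beta> (u i) (u j) + E\<^sub>\<beta> \<beta> (u j) (u j)"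
      using B.B_expand[OF u(1) u(1), of i 1 j] by simp
    have "L2_inner M f ?h = 1/2 * L2_inner M f (\<lambda>x. u i x + 1 * u j x)"
      by (rule L2.B_scale_right[OF D_L2[OF s] f])
    then have 2: "2 * L2_inner M f ?h = L2_inner M f (u i) + L2_inner M f (u j)"
      using L2.B_add_right[OF D_L2[OF u(1)] D_L2[OF u(1)] f, of i j] by simp
    have "E\<^sub>\<beta> \<beta> (\<lambda>x. u i x - u j x) (\<lambda>x. u i x - u j x) = 2 * J (u i) + 2 * J (u j) - 4 * J ?h"
      using 1 2 unfolding J_def B.B_expand_diff[OF u(1) u(1)] by simp
    then show ?thesis using mJ[OF h] u(2)[of i] u(2)[of j] by simp
  qed
  have small: "\<exists>N. \<forall>i\<ge>N. \<forall>j\<ge>N. 2 * e i + 2 * e j < r" if "r > 0" for r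
  proof -
    have "e \<longlonglongrightarrow> 0" unfolding e_def by (rule LIMSEQ_Suc[OF lim_1_over_n])
    then have "\<forall>\<^sub>F n in sequentially. e n < r / 4" by (rule order_tendstoD) (use that in simp)
    then obtain N where N: "\<forall>n\<ge>N. e n < r / 4" unfolding eventually_sequentially by blast
    show ?thesis
    proof (intro exI[of _ N] allI impI)
      fix i j assume "N \<le> i" "N \<le> j"
      then show "2 * e i + 2 * e j < r" using N[rule_format, of i] N[rule_format, of j] by linarith
    qed
  qed
  have split: "polar E w w \<le> E\<^sub>\<beta> \<beta> w w" "\<beta> * (L2_norm M w)\<^sup>2 \<le> E\<^sub>\<beta> \<beta> w w" if "w \<in> D" for w
    using energy_nonneg[OF that] L2_norm_sq[OF D_L2[OF that]] L2.pos[OF D_L2[OF that]] \<beta>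
    by (simp_all add: E\<^sub>\<beta>_def polar_self that)
  have "\<exists>N. \<forall>i\<ge>N. \<forall>j\<ge>N. L2_norm M (\<lambda>x. u i x - u j x) < r" if r: "r > 0" for r
  proof -
    obtain N where N: "\<And>i j. i \<ge> N \<Longrightarrow> j \<ge> N \<Longrightarrow> 2 * e i + 2 * e j < \<beta> * r\<^sup>2"
      using small[of "\<beta> * r\<^sup>2"] \<beta> r by auto
    show ?thesis
    proof (intro exI[of _ N] allI impI)
      fix i j assume ij: "N \<le> i" "N \<le> j"
      have "\<beta> * (L2_norm M (\<lambda>x. u i x - u j x))\<^sup>2 < \<beta> * r\<^sup>2"
        using split(2)[OF D_diff[OF u(1) u(1)]] par[of i j] N[OF ij] by (meson le_less_trans)
      then have "(L2_norm M (\<lambda>x. u i x - u j x))\<^sup>2 < r\<^sup>2" using \<beta> by simp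
      then show "L2_norm M (\<lambda>x. u i x - u j x) < r" using r by (simp add: power2_less_imp_less)
    qed
  qed
  then obtain v where v: "v \<in> L2 M" "(\<lambda>n. L2_norm M (\<lambda>x. u n x - v x)) \<longlonglongrightarrow> 0"
    using L2_complete[of u, OF D_L2[OF u(1)]] by blast
  have "\<exists>N. \<forall>i\<ge>N. \<forall>j\<ge>N. energy E (\<lambda>x. u i x - u j x) < r" if r: "r > 0" for r
  proof -
    obtain N where N: "\<And>i j. i \<ge> N \<Longrightarrow> j \<ge> N \<Longrightarrow> 2 * e i + 2 * e j < r" using small[OF r] by blast
    show ?thesis
    proof (intro exI[of _ N] allI impI)
      fix i j assume ij: "N \<le> i" "N \<le> j"
      show "energy E (\<lambda>x. u i x - u j x) < r"
        using split(1)[OF D_diff[OF u(1) u(1)], of i j] par[of i j] N[OF ij]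
        unfolding polar_self[OF D_diff[OF u(1) u(1)]] by linarith
    qed
  qed
  then have vD: "v \<in> D" and ve: "(\<lambda>n. energy E (\<lambda>x. u n x - v x)) \<longlonglongrightarrow> 0"
    using closed_E v u(1) unfolding closed_form_def by blast+
  have "E\<^sub>\<beta> \<beta> v w = L2_inner M f w" if w: "w \<in> D" for w
  proof -
    have near: "(E\<^sub>\<beta> \<beta> (u n) w - L2_inner M f w)\<^sup>2 \<le> e n * E\<^sub>\<beta> \<beta> w w" for n
    proof (rule discriminant_nonpos)
      fix c
      have uc: "(\<lambda>x. u n x + c * w x) \<in> D" by (rule D_add[OF u(1) D_scale[OF w]])
      have "J (\<lambda>x. u n x + c * w x) = J (u n) + 2 * c * (E\<^sub>\<beta> \<beta> (u n) w - L2_inner M f w) + c\<^sup>2 * E\<^sub>\<beta> \<beta> w w"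
        unfolding J_def B.B_expand[OF u(1) w] L2.B_add_right[OF D_L2[OF u(1)] L2_scale[OF D_L2[OF w]] f]
          L2.B_scale_right[OF D_L2[OF w] f] by (simp add: algebra_simps)
      then show "0 \<le> e n + 2 * c * (E\<^sub>\<beta> \<beta> (u n) w - L2_inner M f w) + c\<^sup>2 * E\<^sub>\<beta> \<beta> w w"
        using mJ[OF uc] u(2)[of n] by linarith
    qed (rule B.pos[OF w])
    have "(\<lambda>n. polar E (u n) w) \<longlonglongrightarrow> polar E v w"
    proof (rule LIM_zero_cancel, rule Lim_null_comparison[OF always_eventually])
      show "\<forall>n. norm (polar E (u n) w - polar E v w) \<le> sqrt (energy E (\<lambda>x. u n x - v x)) * E.nrm w"
        using E.cauchy_schwarz_abs[OF D_diff[OF u(1) vD] w] E.B_diff[OF u(1) vD w]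
        by (simp add: E.nrm_def polar_self D_diff u(1) vD)
      have "(\<lambda>n. sqrt (energy E (\<lambda>x. u n x - v x)) * E.nrm w) \<longlonglongrightarrow> sqrt 0 * E.nrm w"
        by (intro tendsto_intros ve)
      then show "(\<lambda>n. sqrt (energy E (\<lambda>x. u n x - v x)) * E.nrm w) \<longlonglongrightarrow> 0" by simp
    qed
    moreover have "(\<lambda>n. L2_inner M (u n) w) \<longlonglongrightarrow> L2_inner M v w"
    proof (rule LIM_zero_cancel, rule Lim_null_comparison[OF always_eventually])
      show "\<forall>n. norm (L2_inner M (u n) w - L2_inner M v w) \<le> L2_norm M (\<lambda>x. u n x - v x) * L2_norm M w"
        using L2_cauchy_schwarz[OF L2_diff[OF D_L2[OF u(1)] v(1)] D_L2[OF w]]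
          L2.B_diff[OF D_L2[OF u(1)] v(1) D_L2[OF w]] by simp
      have "(\<lambda>n. L2_norm M (\<lambda>x. u n x - v x) * L2_norm M w) \<longlonglongrightarrow> 0 * L2_norm M w"
        by (intro tendsto_intros v(2))
      then show "(\<lambda>n. L2_norm M (\<lambda>x. u n x - v x) * L2_norm M w) \<longlonglongrightarrow> 0" by simp
    qed
    ultimately have "(\<lambda>n. (E\<^sub>\<beta> \<beta> (u n) w - L2_inner M f w)\<^sup>2) \<longlonglongrightarrow> (E\<^sub>\<beta> \<beta> v w - L2_inner M f w)\<^sup>2"
      unfolding E\<^sub>\<beta>_def by (intro tendsto_intros)
    moreover have "(\<lambda>n. e n * E\<^sub>\<beta> \<beta> w w) \<longlonglongrightarrow> 0 * E\<^sub>\<beta> \<beta> w w"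
      unfolding e_def by (intro tendsto_intros LIMSEQ_Suc[OF lim_1_over_n])
    ultimately have "(E\<^sub>\<beta> \<beta> v w - L2_inner M f w)\<^sup>2 \<le> 0 * E\<^sub>\<beta> \<beta> w w"
      by (rule LIMSEQ_le) (use near in blast)
    then show ?thesis by simp
  qed
  then show ?thesis using form_operator_resolvent_iff[OF f] vD by blast
qed

abbreviation R where "R \<equiv> form_resolvent M E"

lemma
  assumes "0 < \<beta>" "f \<in> L2 M"
  shows R_D: "R \<beta> f \<in> D" and R_eq: "v \<in> D \<Longrightarrow> E\<^sub>\<beta> \<beta> (R \<beta> f) v = L2_inner M f v"
proof -
  have "form_operator M E (R \<beta> f) (\<lambda>x. f x - \<beta> * R \<beta> f x)"
    unfolding form_resolvent_def by (rule someI_ex[OF resolvent_exists[OF assms]])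
  then show "R \<beta> f \<in> D" "v \<in> D \<Longrightarrow> E\<^sub>\<beta> \<beta> (R \<beta> f) v = L2_inner M f v"
    using form_operator_resolvent_iff[OF assms(2)] by blast+
qed

lemmas R_L2 = D_L2[OF R_D]

lemma R_unique:
  assumes "0 < \<beta>" "f \<in> L2 M" "u \<in> D" "\<And>v. v \<in> D \<Longrightarrow> E\<^sub>\<beta> \<beta> u v = L2_inner M f v"
  shows "AE x in M. R \<beta> f x = u x"
  by (rule E\<^sub>\<beta>_unique[OF assms(1) R_D[OF assms(1,2)] assms(3)]) (simp add: R_eq assms)

lemma R_norm: assumes \<beta>: "0 < \<beta>" and f: "f \<in> L2 M" shows "\<beta> * L2_norm M (R \<beta> f) \<le> L2_norm M f"
proof -
  note u = R_D[OF \<beta> f] and uL = R_L2[OF \<beta> f]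
  have "\<beta> * L2_norm M (R \<beta> f) * L2_norm M (R \<beta> f) = \<beta> * L2_inner M (R \<beta> f) (R \<beta> f)"
    using L2_norm_sq[OF uL] by (simp add: power2_eq_square)
  also have "\<dots> \<le> L2_inner M f (R \<beta> f)"
    using R_eq[OF \<beta> f u] energy_nonneg[OF u] by (simp add: E\<^sub>\<beta>_def polar_self[OF u])
  also have "\<dots> \<le> L2_norm M f * L2_norm M (R \<beta> f)" using L2_cauchy_schwarz[OF f uL] by linarith
  finally show ?thesis
    using L2_norm_nonneg[OF uL] L2_norm_nonneg[OF f]
    by (cases "L2_norm M (R \<beta> f) = 0") (auto simp: mult_le_cancel_right)
qed

lemma R_bounded: assumes \<beta>: "0 < \<beta>" shows "L2_bounded_operator M (R \<beta>)"
  unfolding L2_bounded_operator_def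
proof (intro conjI ballI allI R_L2 \<beta>)
  interpret B: semi_inner_space D "E\<^sub>\<beta> \<beta>" by (rule shifted_form[OF \<beta>])
  fix u assume u: "u \<in> L2 M"
  note Ru = R_D[OF \<beta> u]
  show "AE x in M. R \<beta> (\<lambda>y. c * u y) x = c * R \<beta> u x" for c
    by (rule R_unique[OF \<beta> L2_scale[OF u] D_scale[OF Ru]])
      (simp add: B.B_scale Ru R_eq \<beta> u L2.B_scale D_L2)
  fix v assume v: "v \<in> L2 M"
  note Rv = R_D[OF \<beta> v]
  show "AE x in M. R \<beta> (\<lambda>y. u y + v y) x = R \<beta> u x + R \<beta> v x"
    by (rule R_unique[OF \<beta> L2_add[OF u v] D_add[OF Ru Rv]])
      (simp add: B.B_add Ru Rv R_eq \<beta> u v L2.B_add D_L2)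
next
  have "L2_norm M (R \<beta> u) \<le> 1 / \<beta> * L2_norm M u" if "u \<in> L2 M" for u
    using R_norm[OF \<beta> that] \<beta> by (simp add: field_simps)
  then show "\<exists>C. \<forall>u\<in>L2 M. L2_norm M (R \<beta> u) \<le> C * L2_norm M u" by blast
qed

lemma R_symmetric:
  assumes \<beta>: "0 < \<beta>" and f: "f \<in> L2 M" and g: "g \<in> L2 M"
  shows "L2_inner M (R \<beta> f) g = L2_inner M f (R \<beta> g)"
proof -
  interpret B: semi_inner_space D "E\<^sub>\<beta> \<beta>" by (rule shifted_form[OF \<beta>])
  have "L2_inner M (R \<beta> f) g = E\<^sub>\<beta> \<beta> (R \<beta> g) (R \<beta> f)"
    using L2.sym[OF R_L2[OF \<beta> f] g] R_eq[OF \<beta> g R_D[OF \<beta> f]] by simp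
  also have "\<dots> = E\<^sub>\<beta> \<beta> (R \<beta> f) (R \<beta> g)" by (rule B.sym[OF R_D[OF \<beta> g] R_D[OF \<beta> f]])
  finally show ?thesis using R_eq[OF \<beta> f R_D[OF \<beta> g]] by simp
qed

lemma R_resolvent:
  assumes \<beta>: "0 < \<beta>" and \<gamma>: "0 < \<gamma>" and f: "f \<in> L2 M"
  shows "AE x in M. R \<gamma> f x = R \<beta> f x + (\<beta> - \<gamma>) * R \<beta> (R \<gamma> f) x"
proof -
  note g = R_L2[OF \<gamma> f]
  have s: "(\<lambda>x. f x + (\<beta> - \<gamma>) * R \<gamma> f x) \<in> L2 M" by (rule L2_add[OF f L2_scale[OF g]])
  \<comment> \<open>Indeed $(L+\beta)K_\gamma f = f + (\beta-\gamma)K_\gamma f$.\<close>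
  have "AE x in M. R \<beta> (\<lambda>x. f x + (\<beta> - \<gamma>) * R \<gamma> f x) x = R \<gamma> f x"
  proof (rule R_unique[OF \<beta> s R_D[OF \<gamma> f]])
    fix v assume v: "v \<in> D"
    show "E\<^sub>\<beta> \<beta> (R \<gamma> f) v = L2_inner M (\<lambda>x. f x + (\<beta> - \<gamma>) * R \<gamma> f x) v"
      using R_eq[OF \<gamma> f v]
      unfolding E\<^sub>\<beta>_def L2.B_add[OF f L2_scale[OF g] D_L2[OF v]] L2.B_scale[OF g D_L2[OF v]]
      by (simp add: left_diff_distrib)
  qed
  with L2_bounded_operatorD(2)[OF R_bounded[OF \<beta>] f L2_scale[OF g, of "\<beta> - \<gamma>"]]
    L2_bounded_operatorD(3)[OF R_bounded[OF \<beta>] g, of "\<beta> - \<gamma>"]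
  show ?thesis by eventually_elim simp
qed

text \<open>
  With $w = u - \beta K_\beta u$ one has $\mathcal{E}(K_\beta u, v) = (w, v)$, whence $\beta\|w\|^2
  = \mathcal{E}(\beta K_\beta u, w) \le \mathcal{E}(\beta K_\beta u, u) \le \mathcal{E}[u]$.
\<close>

lemma R_approx_domain:
  assumes \<beta>: "0 < \<beta>" and u: "u \<in> D"
  shows "\<beta> * (L2_norm M (\<lambda>x. \<beta> * R \<beta> u x - u x))\<^sup>2 \<le> energy E u"
proof -
  note uL = D_L2[OF u]
  let ?K = "R \<beta> u" let ?w = "\<lambda>x. u x - \<beta> * R \<beta> u x"
  have K: "?K \<in> D" by (rule R_D[OF \<beta> uL])
  have w: "?w \<in> D" by (rule D_diff[OF u D_scale[OF K]])
  have EK: "polar E ?K v = L2_inner M ?w v" if "v \<in> D" for v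
    using R_eq[OF \<beta> uL that] L2.B_diff[OF uL L2_scale[OF D_L2[OF K]] D_L2[OF that]]
      L2.B_scale[OF D_L2[OF K] D_L2[OF that]] by (simp add: E\<^sub>\<beta>_def)
  have wK: "polar E ?w v = polar E u v - \<beta> * polar E ?K v" if "v \<in> D" for v
    using E.B_diff[OF u D_scale[OF K] that] E.B_scale[OF K that] by simp
  have wpos: "0 \<le> L2_inner M ?w ?w" by (rule L2.pos[OF D_L2[OF w]])
  have 1: "polar E u ?w = energy E ?w + \<beta> * L2_inner M ?w ?w"
    using wK[OF w] EK[OF w] polar_self[OF w] by simp
  have 2: "\<beta> * polar E ?K u \<le> energy E u"
  proof -
    have "\<beta> * polar E ?K u = energy E u - polar E ?w u" using wK[OF u] polar_self[OF u] by simp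
    moreover have "0 \<le> polar E ?w u"
      using 1 energy_nonneg[OF w] wpos \<beta> polar_sym[OF w u] by (simp add: add_nonneg_nonneg)
    ultimately show ?thesis by simp
  qed
  have "L2_inner M ?w ?w = polar E ?K ?w" using EK[OF w] by simp
  also have "\<dots> = polar E ?K u - \<beta> * energy E ?K"
    using E.B_diff_right[OF u D_scale[OF K] K] E.B_scale_right[OF K K] polar_self[OF K] by simp
  finally have "L2_inner M ?w ?w \<le> polar E ?K u" using energy_nonneg[OF K] \<beta> by simp
  then have "\<beta> * L2_inner M ?w ?w \<le> energy E u" using 2 \<beta> by (meson mult_left_mono less_imp_le order_trans)
  then show ?thesis
    unfolding L2_norm_minus_commute[of M _ u] using L2_norm_sq[OF D_L2[OF w]] by simp
qed

abbreviation W where "W \<equiv> L2_space M"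
abbreviation emb where "emb \<equiv> L2_functional M"

lemma yosida_contraction: 
  assumes \<beta>: "0 < \<beta>" shows "contraction_on W (\<lambda>x. \<beta> *\<^sub>R lift_op M (R \<beta>) x)"
proof -
  interpret closed_subspace W by (rule L2_space_closed_subspace)
  have lin: "linear_map_on W (lift_op M (R \<beta>))"
    using lift_op_bounded[OF R_bounded[OF \<beta>]] by (simp add: bounded_map_on_def)
  have "norm (\<beta> *\<^sub>R lift_op M (R \<beta>) x) \<le> norm x" if "x \<in> W" for x
  proof -
    obtain f where f: "f \<in> L2 M" "x = emb f" using \<open>x \<in> W\<close> by (rule L2_spaceE)
    show ?thesis
      using R_norm[OF \<beta> f(1)] \<beta> by (simp add: f(2) lift_op_functional[OF R_bounded[OF \<beta>] f(1)] norm_L2_functional f(1) R_L2)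
  qed
  then show ?thesis
    using linear_map_onD[OF lin] by (simp add: contraction_on_def linear_map_on_def scaleR_add_right)
qed

text \<open>
  On the form domain the rate $\beta^{-1/2}$ is available; the form domain is dense.
\<close>

lemma R_approx:
  assumes "x \<in> W" shows "((\<lambda>\<beta>. \<beta> *\<^sub>R lift_op M (R \<beta>) x) \<longlongrightarrow> x) at_top"
proof -
  interpret closed_subspace W by (rule L2_space_closed_subspace)
  obtain f where f: "f \<in> L2 M" "x = emb f" using assms by (rule L2_spaceE)
  show ?thesis
  proof (rule tendsto_dense[OF _ _ assms])
    show "\<forall>\<^sub>F \<beta> in at_top. contraction_on W (\<lambda>x. \<beta> *\<^sub>R lift_op M (R \<beta>) x)"
      using eventually_gt_at_top[of "0::real"] by eventually_elim (rule yosida_contraction)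
    show "contraction_on W (\<lambda>x. x)" by (simp add: contraction_on_def linear_map_on_def)
    fix e :: real assume e: "e > 0"
    obtain u where u: "u \<in> D" "L2_norm M (\<lambda>x. f x - u x) < e"
      using dense f(1) e unfolding densely_defined_def by blast
    note uL = D_L2[OF u(1)]
    have bd: "norm (\<beta> *\<^sub>R lift_op M (R \<beta>) (emb u) - emb u) \<le> sqrt (energy E u / \<beta>)" if \<beta>: "0 < \<beta>" for \<beta>
    proof -
      note Ru = R_L2[OF \<beta> uL]
      have "norm (\<beta> *\<^sub>R lift_op M (R \<beta>) (emb u) - emb u) = L2_norm M (\<lambda>x. \<beta> * R \<beta> u x - u x)"
        by (simp add: lift_op_functional[OF R_bounded[OF \<beta>] uL] norm_L2_functional_diff L2_scale Ru uL
            flip: L2_functional_scale[OF Ru])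
      also have "\<dots> \<le> sqrt (energy E u / \<beta>)"
        using R_approx_domain[OF \<beta> u(1)] \<beta> by (intro real_le_rsqrt) (simp add: field_simps)
      finally show ?thesis .
    qed
    have "((\<lambda>\<beta>. \<beta> *\<^sub>R lift_op M (R \<beta>) (emb u)) \<longlongrightarrow> emb u) at_top"
    proof (rule LIM_zero_cancel, rule Lim_null_comparison)
      show "\<forall>\<^sub>F \<beta> in at_top. norm (\<beta> *\<^sub>R lift_op M (R \<beta>) (emb u) - emb u) \<le> sqrt (energy E u / \<beta>)"
        using eventually_gt_at_top[of "0::real"] by eventually_elim (rule bd)
      have "((\<lambda>\<beta>. sqrt (energy E u / \<beta>)) \<longlongrightarrow> sqrt 0) at_top"
        by (intro tendsto_real_sqrt tendsto_divide_0[OF tendsto_const] filterlim_at_top_imp_at_infinity filterlim_ident)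
      then show "((\<lambda>\<beta>. sqrt (energy E u / \<beta>)) \<longlongrightarrow> 0) at_top" by simp
    qed
    then show "\<exists>v\<in>W. norm (x - v) < e \<and> ((\<lambda>\<beta>. \<beta> *\<^sub>R lift_op M (R \<beta>) v) \<longlongrightarrow> v) at_top"
      using u(2) L2_functional_in[OF uL] by (intro bexI[of _ "emb u"]) (simp_all add: f norm_L2_functional_diff uL)
  qed
qed

sublocale HY: resolvent_family W "\<lambda>\<beta>. lift_op M (R \<beta>)"
proof (intro resolvent_family.intro L2_space_closed_subspace, unfold_locales)
  fix \<beta> :: real assume \<beta>: "0 < \<beta>"
  show "linear_map_on W (lift_op M (R \<beta>))"
    using lift_op_bounded[OF R_bounded[OF \<beta>]] by (simp add: bounded_map_on_def)
  show "norm (\<beta> *\<^sub>R lift_op M (R \<beta>) x) \<le> norm x" if "x \<in> W" for x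
    using contraction_onD(2)[OF yosida_contraction[OF \<beta>] that] .
  fix \<gamma> :: real and x assume \<gamma>: "0 < \<gamma>" and "x \<in> W"
  then obtain f where f: "f \<in> L2 M" "x = emb f" by (elim L2_spaceE)
  note g = R_L2[OF \<gamma> f(1)]
  have "emb (R \<gamma> f) = emb (\<lambda>x. R \<beta> f x + (\<beta> - \<gamma>) * R \<beta> (R \<gamma> f) x)"
    using R_resolvent[OF \<beta> \<gamma> f(1)] L2_functional_eq_iff[OF g L2_add[OF R_L2[OF \<beta> f(1)] L2_scale[OF R_L2[OF \<beta> g]]]]
    by blast
  then show "lift_op M (R \<gamma>) x = lift_op M (R \<beta>) x + (\<beta> - \<gamma>) *\<^sub>R lift_op M (R \<beta>) (lift_op M (R \<gamma>) x)"
    unfolding f(2) lift_op_functional[OF R_bounded[OF \<gamma>] f(1)] lift_op_functional[OF R_bounded[OF \<beta>] f(1)]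
      lift_op_functional[OF R_bounded[OF \<beta>] g]
      L2_functional_add[OF R_L2[OF \<beta> f(1)] L2_scale[OF R_L2[OF \<beta> g]]] L2_functional_scale[OF R_L2[OF \<beta> g]] .
qed (rule R_approx)

text \<open>
  Both sides express $(L+1)u = f+u$, once through the resolvent and once through the form.
\<close>

lemma L_rel_iff:
  assumes u: "u \<in> L2 M" and f: "f \<in> L2 M"
  shows "HY.L_rel (emb u) (emb f) \<longleftrightarrow> form_operator M E u f"
proof -
  let ?g = "\<lambda>x. f x + u x"
  have g: "?g \<in> L2 M" by (rule L2_add[OF f u])
  have "HY.L_rel (emb u) (emb f) \<longleftrightarrow> emb u = emb (R 1 ?g)"
    unfolding HY.L_rel_def using lift_op_functional[OF R_bounded g, of 1] L2_functional_in[OF u] L2_functional_in[OF f]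
    by (simp add: L2_functional_add f u)
  also have "\<dots> \<longleftrightarrow> (AE x in M. u x = R 1 ?g x)"
    by (rule L2_functional_eq_iff[OF u R_L2[OF _ g]]) simp
  also have "\<dots> \<longleftrightarrow> form_operator M E u f"
  proof
    assume eq: "AE x in M. u x = R 1 ?g x"
    have RD: "R 1 ?g \<in> D" using R_D[OF _ g] by simp
    have uD: "u \<in> D" by (rule D_AE[OF RD u]) (use eq in \<open>auto elim: eventually_mono\<close>)
    have "polar E u v = L2_inner M f v" if v: "v \<in> D" for v
    proof -
      have "polar E u v + L2_inner M u v = E\<^sub>\<beta> 1 (R 1 ?g) v"
        using polar_AE_cong[OF uD RD v eq] L2_inner_AE_cong[OF u D_L2[OF RD] D_L2[OF v] D_L2[OF v] eq]
        by (simp add: E\<^sub>\<beta>_def)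
      also have "\<dots> = L2_inner M f v + L2_inner M u v"
        using R_eq[OF _ g v] L2.B_add[OF f u D_L2[OF v]] by simp
      finally show ?thesis by simp
    qed
    then show "form_operator M E u f" using uD f by (simp add: form_operator_def)
  next
    assume op: "form_operator M E u f"
    have "AE x in M. R 1 ?g x = u x"
      by (rule R_unique[OF _ g]) (use op in \<open>auto simp: form_operator_def E\<^sub>\<beta>_def L2.B_add[OF f u] D_L2\<close>)
    then show "AE x in M. u x = R 1 ?g x" by (auto elim: eventually_mono)
  qed
  finally show ?thesis .
qed

abbreviation T where "T \<equiv> form_semigroup M E"

lemma
  shows T_semigroup: "C0_semigroup M T"
    and T_functional: "0 \<le> t \<Longrightarrow> u \<in> L2 M \<Longrightarrow> emb (T t u) = HY.T t (emb u)"
proof -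
  have dom: "u \<in> L2 M \<and> f \<in> L2 M" if "form_operator M E u f" for u f
    using that D_L2 by (auto simp: form_operator_def)
  have gen: "form_operator M E u f \<longleftrightarrow> generator_on W HY.T (emb u) (- emb f)"
    if "u \<in> L2 M" "f \<in> L2 M" for u f
    using L_rel_iff[OF that] HY.generator_iff by simp
  have uniq: "S t x = HY.T t x"
    if S: "C0_on W S" and g: "\<And>x g. x \<in> W \<Longrightarrow> g \<in> W \<Longrightarrow> generator_on W S x g \<longleftrightarrow> generator_on W HY.T x g"
      and x: "x \<in> W" and t: "0 \<le> t" for S x t
  proof (rule HY.semigroup_unique[OF S _ x t])
    show "generator_on W S u g \<longleftrightarrow> HY.L_rel u (- g)" for u g
    proof (cases "u \<in> W \<and> g \<in> W")
      case True
      then show ?thesis using g[of u g] HY.generator_iff by simp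
    next
      case False
      then have "\<not> generator_on W S u g" "\<not> generator_on W HY.T u g" by (auto simp: generator_on_def)
      then show ?thesis using HY.generator_iff by simp
    qed
  qed
  show "C0_semigroup M T"
    by (rule form_semigroup_characterization(1)[OF HY.T_C0]) (fact dom, fact gen, fact uniq)
  show "emb (T t u) = HY.T t (emb u)" if "0 \<le> t" "u \<in> L2 M"
    by (rule form_semigroup_characterization(2)[OF HY.T_C0]) (fact dom, fact gen, fact uniq, fact that, fact that)
qed

lemma T_contraction: assumes "0 \<le> t" "u \<in> L2 M" shows "L2_norm M (T t u) \<le> L2_norm M u"
  using contraction_onD(2)[OF HY.T_contraction[OF assms(1)] L2_functional_in[OF assms(2)]] T_functional[OF assms]
    C0_semigroupD(2)[OF T_semigroup assms] by (simp add: norm_L2_functional assms(2) flip: norm_L2_functional)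

end

locale L2_dirichlet_form = L2_form +
  assumes cutoff: "u \<in> form_dom E \<Longrightarrow> unit_cutoff u \<in> form_dom E \<and> energy E (unit_cutoff u) \<le> energy E u"
begin

lemma square_distance_cutoff_le:
  fixes a r :: real
  assumes "0 \<le> a" "a \<le> 1"
  shows "min (max r 0) 1 * min (max r 0) 1 - 2 * (a * min (max r 0) 1) \<le> r * r - 2 * (a * r)"
proof -
  consider "r < 0" | "0 \<le> r" "r \<le> 1" | "1 < r" by linarith
  then show ?thesis
  proof cases
    case 1
    have "0 \<le> a * - r" using 1 assms by (intro mult_nonneg_nonneg) auto
    then have "0 \<le> r * r - 2 * (a * r)"
      using zero_le_square[of r] unfolding mult_minus_right by linarith
    moreover have "min (max r 0) 1 = 0" using 1 by simp
    ultimately show ?thesis by (simp only: mult_zero_right diff_zero)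
  next
    case 2
    then show ?thesis by simp
  next
    case 3
    have "0 \<le> (r - 1) * (r + 1 - 2 * a)" using 3 assms by (intro mult_nonneg_nonneg) auto
    then show ?thesis using 3 by (simp add: algebra_simps)
  qed
qed

text \<open>
  The function $u = \beta K_\beta f$ is the unique minimiser of $\mathcal{E}[v] + \beta\|v-f\|^2$.
  If \<open>0 \<le> f \<le> 1\<close>, the unit cutoff of \<open>u\<close> increases neither term,
  so it equals \<open>u\<close>.
\<close>

lemma R_markov:
  assumes \<beta>: "0 < \<beta>" and f: "f \<in> L2 M" and f01: "AE x in M. 0 \<le> f x \<and> f x \<le> 1"
  shows "AE x in M. 0 \<le> \<beta> * R \<beta> f x \<and> \<beta> * R \<beta> f x \<le> 1"
proof -
  interpret B: semi_inner_space D "E\<^sub>\<beta> \<beta>" by (rule shifted_form[OF \<beta>])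
  let ?u = "\<lambda>x. \<beta> * R \<beta> f x"
  let ?v = "unit_cutoff ?u"
  have u: "?u \<in> D" by (rule D_scale[OF R_D[OF \<beta> f]])
  have v: "?v \<in> D" and Ev: "energy E ?v \<le> energy E ?u" using cutoff[OF u] by auto
  note uL = D_L2[OF u] and vL = D_L2[OF v]
  have eq: "E\<^sub>\<beta> \<beta> ?u w = \<beta> * L2_inner M f w" if "w \<in> D" for w
    using B.B_scale[OF R_D[OF \<beta> f] that] R_eq[OF \<beta> f that] by simp
  have le: "L2_inner M ?v ?v - 2 * L2_inner M f ?v \<le> L2_inner M ?u ?u - 2 * L2_inner M f ?u"
  proof -
    have i: "integrable M (\<lambda>x. w x * w x - 2 * (f x * w x))" 
      "L2_inner M w w - 2 * L2_inner M f w = (LINT x|M. w x * w x - 2 * (f x * w x))" if "w \<in> L2 M" for w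
      using L2_mult_integrable[OF that that] L2_mult_integrable[OF f that] by (simp_all add: L2_inner_def)
    show ?thesis
      unfolding i(2)[OF uL] i(2)[OF vL]
    proof (rule integral_mono_AE[OF i(1)[OF vL] i(1)[OF uL]])
      show "AE x in M. ?v x * ?v x - 2 * (f x * ?v x) \<le> ?u x * ?u x - 2 * (f x * ?u x)"
        using f01
      proof eventually_elim
        case (elim x)
        then show ?case
          using square_distance_cutoff_le[of "f x" "?u x"] by (simp add: unit_cutoff_def)
      qed
    qed
  qed
  have "E\<^sub>\<beta> \<beta> (\<lambda>x. ?v x - ?u x) (\<lambda>x. ?v x - ?u x) = E\<^sub>\<beta> \<beta> ?v ?v - 2 * (\<beta> * L2_inner M f ?v) + \<beta> * L2_inner M f ?u"
    using B.B_expand_diff[OF v u] B.sym[OF v u] eq[OF v] eq[OF u] by simp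
  also have "\<dots> = (energy E ?v - energy E ?u)
      + \<beta> * ((L2_inner M ?v ?v - 2 * L2_inner M f ?v) - (L2_inner M ?u ?u - 2 * L2_inner M f ?u))"
    using eq[OF u] by (simp add: E\<^sub>\<beta>_def polar_self u v algebra_simps)
  also have "\<dots> \<le> 0"
  proof -
    have "\<beta> * ((L2_inner M ?v ?v - 2 * L2_inner M f ?v) - (L2_inner M ?u ?u - 2 * L2_inner M f ?u)) \<le> 0"
      using le \<beta> by (intro mult_nonneg_nonpos) auto
    then show ?thesis using Ev by linarith
  qed
  finally have "AE x in M. ?v x - ?u x = 0" by (rule E\<^sub>\<beta>_self_zero[OF \<beta> D_diff[OF v u]])
  then show ?thesis by eventually_elim (auto simp: unit_cutoff_def min_def max_def split: if_splits)
qed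

end

section \<open>Markov operators and the image of the constant one\<close>

definition markov_operator :: "'a measure \<Rightarrow> (('a \<Rightarrow> real) \<Rightarrow> 'a \<Rightarrow> real) \<Rightarrow> bool" where
  "markov_operator M A \<longleftrightarrow> L2_bounded_operator M A \<and> (\<forall>u\<in>L2 M. L2_norm M (A u) \<le> L2_norm M u) \<and>
     (\<forall>u\<in>L2 M. (AE x in M. 0 \<le> u x \<and> u x \<le> 1) \<longrightarrow> (AE x in M. 0 \<le> A u x \<and> A u x \<le> 1))"

definition symmetric_operator :: "'a measure \<Rightarrow> (('a \<Rightarrow> real) \<Rightarrow> 'a \<Rightarrow> real) \<Rightarrow> bool" where
  "symmetric_operator M A \<longleftrightarrow> (\<forall>u\<in>L2 M. \<forall>v\<in>L2 M. L2_inner M (A u) v = L2_inner M u (A v))"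

definition poisson_op :: "'a measure \<Rightarrow> (('a \<Rightarrow> real) \<Rightarrow> 'a \<Rightarrow> real) \<Rightarrow> real \<Rightarrow> ('a \<Rightarrow> real) \<Rightarrow> 'a \<Rightarrow> real" where
  "poisson_op M A s = lower_op M (poisson (lift_op M A) s)"

lemma markov_operatorD:
  assumes "markov_operator M A"
  shows "L2_bounded_operator M A" "u \<in> L2 M \<Longrightarrow> L2_norm M (A u) \<le> L2_norm M u"
    "u \<in> L2 M \<Longrightarrow> AE x in M. 0 \<le> u x \<and> u x \<le> 1 \<Longrightarrow> AE x in M. 0 \<le> A u x \<and> A u x \<le> 1"
    "u \<in> L2 M \<Longrightarrow> A u \<in> L2 M"
  using assms unfolding markov_operator_def L2_bounded_operator_def by blast+

lemma markov_operator_mono: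
  assumes A: "markov_operator M A" and u: "u \<in> L2 M" and v: "v \<in> L2 M"
    and le: "AE x in M. u x \<le> v x \<and> v x - u x \<le> 1"
  shows "AE x in M. A u x \<le> A v x"
proof -
  have "AE x in M. 0 \<le> A (\<lambda>x. v x - u x) x \<and> A (\<lambda>x. v x - u x) x \<le> 1"
    by (rule markov_operatorD(3)[OF A L2_diff[OF v u]]) (use le in \<open>auto elim: eventually_mono\<close>)
  with L2_bounded_operator_diff[OF markov_operatorD(1)[OF A] v u] show ?thesis
    by eventually_elim simp
qed

lemma markov_operator_tendsto:
  assumes A: "markov_operator M A" and u: "\<And>n::nat. u n \<in> L2 M" and v: "v \<in> L2 M"
    and lim: "(\<lambda>n. L2_norm M (\<lambda>x. u n x - v x)) \<longlonglongrightarrow> 0"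
  shows "(\<lambda>n. L2_norm M (\<lambda>x. A (u n) x - A v x)) \<longlonglongrightarrow> 0"
proof (rule Lim_null_comparison[OF always_eventually lim], intro allI)
  fix n
  note Ad = markov_operatorD[OF A]
  note d = L2_diff[OF Ad(4)[OF u[of n]] Ad(4)[OF v]] and Adiff = Ad(4)[OF L2_diff[OF u[of n] v]]
  have eq: "AE x in M. A (u n) x - A v x = A (\<lambda>x. u n x - v x) x"
    using L2_bounded_operator_diff[OF Ad(1) u[of n] v] by eventually_elim simp
  have "L2_norm M (\<lambda>x. A (u n) x - A v x) = L2_norm M (A (\<lambda>x. u n x - v x))"
    unfolding L2_norm_def using L2_inner_AE_cong[OF d Adiff d Adiff eq eq] by simp
  then show "norm (L2_norm M (\<lambda>x. A (u n) x - A v x)) \<le> L2_norm M (\<lambda>x. u n x - v x)"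
    using Ad(2)[OF L2_diff[OF u[of n] v]] L2_norm_nonneg[OF Adiff] by simp
qed

lemma markov_operator_compose:
  assumes A: "markov_operator M A" and B: "markov_operator M B" 
  shows "markov_operator M (\<lambda>u. A (B u))"
  unfolding markov_operator_def
proof (intro conjI ballI impI)
  note Ad = markov_operatorD[OF A] and Bd = markov_operatorD[OF B]
  show "L2_norm M (A (B u)) \<le> L2_norm M u" if "u \<in> L2 M" for u
    using Ad(2)[OF Bd(4)[OF that]] Bd(2)[OF that] by linarith
  show "AE x in M. 0 \<le> A (B u) x \<and> A (B u) x \<le> 1" if "u \<in> L2 M" "AE x in M. 0 \<le> u x \<and> u x \<le> 1" for u
    by (rule Ad(3)[OF Bd(4)[OF that(1)] Bd(3)[OF that]])
  show "L2_bounded_operator M (\<lambda>u. A (B u))"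
    unfolding L2_bounded_operator_def
  proof (intro conjI ballI allI exI[of _ 1])
    fix u assume u: "u \<in> L2 M"
    note Bu = Bd(4)[OF u]
    show "A (B u) \<in> L2 M" by (rule Ad(4)[OF Bu])
    show "L2_norm M (A (B u)) \<le> 1 * L2_norm M u" using Ad(2)[OF Bu] Bd(2)[OF u] by simp
    show "AE x in M. A (B (\<lambda>y. c * u y)) x = c * A (B u) x" for c
      using L2_bounded_operator_cong[OF Ad(1) Bd(4)[OF L2_scale[OF u]] L2_scale[OF Bu]
          L2_bounded_operatorD(3)[OF Bd(1) u, of c]] L2_bounded_operatorD(3)[OF Ad(1) Bu, of c]
      by eventually_elim simp
    fix v assume v: "v \<in> L2 M"
    note Bv = Bd(4)[OF v]
    show "AE x in M. A (B (\<lambda>y. u y + v y)) x = A (B u) x + A (B v) x"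
      using L2_bounded_operator_cong[OF Ad(1) Bd(4)[OF L2_add[OF u v]] L2_add[OF Bu Bv]
          L2_bounded_operatorD(2)[OF Bd(1) u v]] L2_bounded_operatorD(2)[OF Ad(1) Bu Bv]
      by eventually_elim simp
  qed
qed

lemma markov_operator_funpow: assumes "markov_operator M A" shows "markov_operator M (A ^^ n)"
proof (induction n)
  case 0
  have "L2_bounded_operator M (\<lambda>u. u)"
    unfolding L2_bounded_operator_def by (auto intro!: exI[of _ 1])
  then have "markov_operator M (\<lambda>u. u)" by (simp add: markov_operator_def)
  then show ?case by (simp add: id_def)
next
  case (Suc n)
  then show ?case using markov_operator_compose[OF assms Suc] by (simp add: o_def)
qed

lemma symmetric_operator_funpow:
  assumes A: "markov_operator M A" and s: "symmetric_operator M A" shows "symmetric_operator M (A ^^ n)"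
proof (induction n)
  case (Suc n)
  note i = markov_operatorD(4)[OF markov_operator_funpow[OF A]] markov_operatorD(4)[OF A]
  show ?case unfolding symmetric_operator_def
  proof (intro ballI)
    fix u v assume u: "u \<in> L2 M" and v: "v \<in> L2 M"
    have "L2_inner M ((A ^^ Suc n) u) v = L2_inner M ((A ^^ n) u) (A v)"
      using s i u v by (simp add: symmetric_operator_def)
    also have "\<dots> = L2_inner M u ((A ^^ n) (A v))"
      using Suc i u v by (simp add: symmetric_operator_def)
    finally show "L2_inner M ((A ^^ Suc n) u) v = L2_inner M u ((A ^^ Suc n) v)"
      by (simp add: funpow_swap1)
  qed
qed (simp add: symmetric_operator_def)

lemma L2_inner_tendsto:
  assumes "\<And>n::nat. u n \<in> L2 M" "v \<in> L2 M" "w \<in> L2 M" "(\<lambda>n. L2_norm M (\<lambda>x. u n x - v x)) \<longlonglongrightarrow> 0"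
  shows "(\<lambda>n. L2_inner M (u n) w) \<longlonglongrightarrow> L2_inner M v w"
proof (rule LIM_zero_cancel, rule Lim_null_comparison[OF always_eventually])
  show "\<forall>n. norm (L2_inner M (u n) w - L2_inner M v w) \<le> L2_norm M (\<lambda>x. u n x - v x) * L2_norm M w"
    using L2_cauchy_schwarz[OF L2_diff[OF assms(1,2)] assms(3)] L2.B_diff[OF assms(1-3)] by simp
  have "(\<lambda>n. L2_norm M (\<lambda>x. u n x - v x) * L2_norm M w) \<longlonglongrightarrow> 0 * L2_norm M w"
    by (intro tendsto_intros assms(4))
  then show "(\<lambda>n. L2_norm M (\<lambda>x. u n x - v x) * L2_norm M w) \<longlonglongrightarrow> 0" by simp
qed

lemma symmetric_operator_limit:
  assumes B: "\<And>n u. u \<in> L2 M \<Longrightarrow> B n u \<in> L2 M" and s: "\<And>n::nat. symmetric_operator M (B n)"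
    and A: "\<And>u. u \<in> L2 M \<Longrightarrow> A u \<in> L2 M"
    and lim: "\<And>u. u \<in> L2 M \<Longrightarrow> (\<lambda>n. L2_norm M (\<lambda>x. B n u x - A u x)) \<longlonglongrightarrow> 0"
  shows "symmetric_operator M A"
  unfolding symmetric_operator_def
proof (intro ballI)
  fix u v assume u: "u \<in> L2 M" and v: "v \<in> L2 M"
  have "(\<lambda>n. L2_inner M (B n u) v) \<longlonglongrightarrow> L2_inner M (A u) v"
    by (rule L2_inner_tendsto[OF B[OF u] A[OF u] v lim[OF u]])
  moreover have "(\<lambda>n. L2_inner M (B n u) v) \<longlonglongrightarrow> L2_inner M u (A v)"
    using L2_inner_tendsto[OF B[OF v] A[OF v] u lim[OF v]] s u v
    by (simp add: symmetric_operator_def L2.sym[OF u A[OF v]] L2.sym[OF u B[OF v]])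
  ultimately show "L2_inner M (A u) v = L2_inner M u (A v)" by (rule LIMSEQ_unique)
qed

lemma markov_operator_limit:
  assumes B: "\<And>n::nat. markov_operator M (B n)" and A: "L2_bounded_operator M A"
    and c: "\<And>u. u \<in> L2 M \<Longrightarrow> L2_norm M (A u) \<le> L2_norm M u"
    and lim: "\<And>u. u \<in> L2 M \<Longrightarrow> (\<lambda>n. L2_norm M (\<lambda>x. B n u x - A u x)) \<longlonglongrightarrow> 0"
  shows "markov_operator M A"
  unfolding markov_operator_def
proof (intro conjI ballI impI A c)
  fix u assume u: "u \<in> L2 M" and u01: "AE x in M. 0 \<le> u x \<and> u x \<le> 1"
  note Au = L2_bounded_operatorD(1)[OF A u] and Bu = markov_operatorD(4)[OF B u]
    and b = markov_operatorD(3)[OF B u u01]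
  have "AE x in M. A u x \<le> 1"
    by (rule L2_limit_le[OF Bu Au lim[OF u], where g="\<lambda>_ _. 1"]) (use b in \<open>auto elim: eventually_mono\<close>)
  moreover have "AE x in M. 0 \<le> A u x"
    by (rule L2_limit_ge[OF Bu Au lim[OF u], where g="\<lambda>_ _. 0"]) (use b in \<open>auto elim: eventually_mono\<close>)
  ultimately show "AE x in M. 0 \<le> A u x \<and> A u x \<le> 1" by eventually_elim simp
qed

lemma markov_operator_AE_cong:
  assumes A: "markov_operator M A" and B: "L2_bounded_operator M B"
    and eq: "\<And>u. u \<in> L2 M \<Longrightarrow> AE x in M. B u x = A u x"
  shows "markov_operator M B"
  unfolding markov_operator_def
proof (intro conjI ballI impI B)
  fix u assume u: "u \<in> L2 M"
  have "L2_norm M (B u) = L2_norm M (A u)"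
    unfolding L2_norm_def
    using L2_inner_AE_cong[OF L2_bounded_operatorD(1)[OF B u] markov_operatorD(4)[OF A u]
        L2_bounded_operatorD(1)[OF B u] markov_operatorD(4)[OF A u] eq[OF u] eq[OF u]] by simp
  then show "L2_norm M (B u) \<le> L2_norm M u" using markov_operatorD(2)[OF A u] by simp
  assume "AE x in M. 0 \<le> u x \<and> u x \<le> 1"
  from markov_operatorD(3)[OF A u this] eq[OF u] show "AE x in M. 0 \<le> B u x \<and> B u x \<le> 1"
    by eventually_elim simp
qed

text \<open>
  The recursion says that $b_0$ is the mixture of $a_1, a_2, \dots$ with geometric weights: the
  first \<open>n\<close> weights add up to $1 - q^n$, and they belong to terms that are at least
  $a_n$.
\<close>

lemma geometric_lower_bound:
  fixes a b :: "nat \<Rightarrow> real"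
  assumes rec: "\<And>n. b n = (1 - q) * a (Suc n) + q * b (Suc n)"
    and q: "0 \<le> q" "q \<le> 1" and dec: "\<And>n. a (Suc n) \<le> a n" and nn: "\<And>n. 0 \<le> b n"
  shows "(1 - q ^ n) * a n \<le> b 0"
proof -
  have anti: "a n \<le> a m" if "m \<le> n" for m n using that by (rule lift_Suc_antimono_le[of a, OF dec])
  have "(1 - q ^ j) * a n \<le> b (n - j)" if "j \<le> n" for j
    using that
  proof (induction j)
    case 0 then show ?case by (simp add: nn)
  next
    case (Suc j)
    have i: "n - j = Suc (n - Suc j)" using Suc.prems by simp
    have "(1 - q ^ Suc j) * a n = (1 - q) * a n + q * ((1 - q ^ j) * a n)" by (simp add: algebra_simps)
    also have "\<dots> \<le> (1 - q) * a (Suc (n - Suc j)) + q * b (Suc (n - Suc j))"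
      using Suc.IH Suc.prems anti[of "Suc (n - Suc j)" n] q unfolding i
      by (intro add_mono mult_left_mono) auto
    finally show ?case using rec[of "n - Suc j"] by simp
  qed
  from this[of n] show ?thesis by simp
qed

text \<open>
  A convex combination with positive weights of numbers below one equals one only if all of them do.
\<close>

lemma geometric_equality:
  fixes a b :: "nat \<Rightarrow> real"
  assumes rec: "\<And>n. b n = (1 - q) * a (Suc n) + q * b (Suc n)"
    and q: "0 < q" "q < 1" and a1: "\<And>n. a n \<le> 1" and b1: "\<And>n. b n \<le> 1" and b0: "b 0 = 1"
  shows "a (Suc n) = 1"
proof -
  have step: "b (Suc n) = 1 \<and> a (Suc n) = 1" if "b n = 1" for n
  proof -
    have "(1 - q) * (1 - a (Suc n)) + q * (1 - b (Suc n)) = 0" using rec[of n] that by (simp add: algebra_simps)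
    moreover have "0 \<le> (1 - q) * (1 - a (Suc n))" "0 \<le> q * (1 - b (Suc n))" using q a1 b1 by auto
    ultimately have "(1 - q) * (1 - a (Suc n)) = 0" "q * (1 - b (Suc n)) = 0" by linarith+
    then show ?thesis using q by simp
  qed
  have "b n = 1" for n by (induction n) (use b0 step in auto)
  then show ?thesis using step by blast
qed

lemma geometric_step:
  fixes a b :: "nat \<Rightarrow> real"
  assumes rec: "\<And>n. b n = (1 - q) * a (Suc n) + q * b (Suc n)"
    and q: "q \<le> 1" and a1: "\<And>n. a n \<le> 1" and nn: "\<And>n. 0 \<le> b n"
  shows "b 0 - real n * (1 - q) \<le> b n"
proof (induction n)
  case (Suc n)
  have "b n - b (Suc n) = (1 - q) * (a (Suc n) - b (Suc n))" using rec[of n] by (simp add: algebra_simps)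
  also have "\<dots> \<le> (1 - q) * 1" using q a1[of "Suc n"] nn[of "Suc n"] by (intro mult_left_mono) auto
  finally show ?case using Suc by (simp add: algebra_simps)
qed simp

definition unit_exhaustion :: "'a measure \<Rightarrow> nat \<Rightarrow> 'a \<Rightarrow> real" where
  "unit_exhaustion M = (SOME \<phi>. exhausting M \<phi>)"

text \<open>
  The value \<open>A1\<close> of the extension of \<open>A\<close> to bounded functions.
\<close>

definition unit_image :: "'a measure \<Rightarrow> (('a \<Rightarrow> real) \<Rightarrow> 'a \<Rightarrow> real) \<Rightarrow> 'a \<Rightarrow> real" where
  "unit_image M A x = lim (\<lambda>k. A (unit_exhaustion M k) x)"

context sigma_finite_measure
begin

abbreviation \<phi> where "\<phi> \<equiv> unit_exhaustion M"

lemma exhausting_exists: "\<exists>\<phi>. exhausting M \<phi>"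
proof -
  obtain f :: "'a \<Rightarrow> real" where f: "f \<in> borel_measurable M" "\<And>x. f x > 0" "\<And>x. f x \<le> 1" "integrable M f"
    using obtain_positive_integrable_function by blast
  note [measurable] = f(1)
  let ?\<phi> = "\<lambda>k x. min 1 (real (Suc k) * f x)"
  have "exhausting M ?\<phi>"
    unfolding exhausting_def
  proof (intro conjI allI always_eventually)
    show "integrable M (?\<phi> k)" for k
      by (rule Bochner_Integration.integrable_bound[OF integrable_mult_right[OF f(4), of "real (Suc k)"]])
        (use f(2) in \<open>auto simp: less_imp_le min_def intro!: AE_I2\<close>)
    show "0 < ?\<phi> k x" "?\<phi> k x \<le> 1" for k x using f(2)[of x] by auto
    show "incseq (\<lambda>k. ?\<phi> k x)" for x
      using f(2)[of x] by (intro incseq_SucI min.mono order_refl mult_right_mono) auto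
    show "(\<lambda>k. ?\<phi> k x) \<longlonglongrightarrow> 1" for x
    proof (rule tendsto_eventually)
      obtain n where n: "1 < real n * f x" using reals_Archimedean3[OF f(2)[of x]] by blast
      show "\<forall>\<^sub>F k in sequentially. ?\<phi> k x = 1"
        using eventually_ge_at_top[of n]
      proof eventually_elim
        case (elim k)
        have "real n * f x \<le> real (Suc k) * f x" using elim f(2)[of x] by (intro mult_right_mono) auto
        then show ?case using n by simp
      qed
    qed
  qed
  then show ?thesis by blast
qed

lemma phi: "exhausting M \<phi>"
  unfolding unit_exhaustion_def by (rule someI_ex[OF exhausting_exists])

lemma phi_unit: "AE x in M. 0 \<le> \<phi> k x \<and> \<phi> k x \<le> 1"
proof -
  have "AE x in M. 0 < \<phi> k x \<and> \<phi> k x \<le> 1" using phi by (simp add: exhausting_def)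
  then show ?thesis by eventually_elim simp
qed

lemma phi_limit: "AE x in M. incseq (\<lambda>k. \<phi> k x) \<and> (\<lambda>k. \<phi> k x) \<longlonglongrightarrow> 1"
  using phi by (simp add: exhausting_def)

lemma phi_L2: "\<phi> k \<in> L2 M"
  unfolding L2_def
proof (intro CollectI conjI)
  have i: "integrable M (\<phi> k)" using phi by (simp add: exhausting_def)
  then show [measurable]: "\<phi> k \<in> borel_measurable M" by (rule borel_measurable_integrable)
  show "integrable M (\<lambda>x. (\<phi> k x)\<^sup>2)"
  proof (rule Bochner_Integration.integrable_bound[OF i])
    show "AE x in M. norm ((\<phi> k x)\<^sup>2) \<le> norm (\<phi> k x)"
      using phi_unit[of k] by eventually_elim (simp add: power2_eq_square mult_left_le)
  qed simp
qed

lemma unit_image_limit: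
  assumes A: "markov_operator M A"
  shows "AE x in M. (\<lambda>k. A (\<phi> k) x) \<longlonglongrightarrow> unit_image M A x \<and> (\<forall>k. A (\<phi> k) x \<le> unit_image M A x)
    \<and> 0 \<le> unit_image M A x \<and> unit_image M A x \<le> 1"
proof -
  have "AE x in M. A (\<phi> k) x \<le> A (\<phi> (Suc k)) x" for k
  proof (rule markov_operator_mono[OF A phi_L2 phi_L2])
    show "AE x in M. \<phi> k x \<le> \<phi> (Suc k) x \<and> \<phi> (Suc k) x - \<phi> k x \<le> 1"
      using phi_limit phi_unit[of k] phi_unit[of "Suc k"] by eventually_elim (auto dest: incseq_SucD)
  qed
  then have 1: "AE x in M. \<forall>k. A (\<phi> k) x \<le> A (\<phi> (Suc k)) x" by (simp add: AE_all_countable)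
  have 2: "AE x in M. \<forall>k. 0 \<le> A (\<phi> k) x \<and> A (\<phi> k) x \<le> 1"
    unfolding AE_all_countable using markov_operatorD(3)[OF A phi_L2 phi_unit] by blast
  from 1 2 show ?thesis
  proof eventually_elim
    case (elim x)
    have inc: "incseq (\<lambda>k. A (\<phi> k) x)" using elim(1) by (intro incseq_SucI) blast
    obtain l where l: "(\<lambda>k. A (\<phi> k) x) \<longlonglongrightarrow> l" "\<forall>k. A (\<phi> k) x \<le> l"
      using incseq_convergent[OF inc, of 1] elim(2) by blast
    have ul: "unit_image M A x = l" unfolding unit_image_def by (rule limI[OF l(1)])
    have "l \<le> 1" by (rule LIMSEQ_le_const2[OF l(1)]) (use elim(2) in blast)
    moreover have "0 \<le> l" using l(2) elim(2) order_trans by blast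
    ultimately show ?case using l ul by simp
  qed
qed

lemma unit_image_cong:
  assumes "\<And>u. u \<in> L2 M \<Longrightarrow> AE x in M. A u x = B u x"
  shows "AE x in M. unit_image M A x = unit_image M B x"
proof -
  have "AE x in M. \<forall>k. A (\<phi> k) x = B (\<phi> k) x"
    unfolding AE_all_countable using assms[OF phi_L2] by blast
  then show ?thesis by eventually_elim (simp add: unit_image_def)
qed

text \<open>
  So \<open>A1\<close> bounds the image of any square-integrable function with values in the unit
  interval, not just of the functions $\varphi_k$: cut off with $\varphi_k$ and use continuity of
  \<open>A\<close> on $L^2$.
\<close>

lemma markov_le_unit_image:
  assumes A: "markov_operator M A" and g: "g \<in> L2 M" and g01: "AE x in M. 0 \<le> g x \<and> g x \<le> 1"
  shows "AE x in M. A g x \<le> unit_image M A x"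
proof -
  note Ad = markov_operatorD[OF A]
  have lim: "AE x in M. (\<lambda>k. \<phi> k x) \<longlonglongrightarrow> 1" using phi_limit by eventually_elim simp
  note c = L2_cutoff_tendsto[OF g L2_measurable[OF phi_L2] phi_unit lim]
  have le: "AE x in M. A (\<lambda>x. g x * \<phi> k x) x \<le> unit_image M A x" for k
  proof -
    have "AE x in M. A (\<lambda>x. g x * \<phi> k x) x \<le> A (\<phi> k) x"
    proof (rule markov_operator_mono[OF A c(1) phi_L2])
      show "AE x in M. g x * \<phi> k x \<le> \<phi> k x \<and> \<phi> k x - g x * \<phi> k x \<le> 1"
        using g01 phi_unit[of k]
      proof eventually_elim
        case (elim x)
        then have "0 \<le> g x * \<phi> k x" "g x * \<phi> k x \<le> \<phi> k x" by (simp_all add: mult_left_le_one_le)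
        with elim show ?case by linarith
      qed
    qed
    with unit_image_limit[OF A] show ?thesis by eventually_elim (auto intro: order_trans)
  qed
  have conv: "(\<lambda>k. L2_norm M (\<lambda>x. A (\<lambda>x. g x * \<phi> k x) x - A g x)) \<longlonglongrightarrow> 0"
    by (rule markov_operator_tendsto[OF A c(1) g c(2)])
  show ?thesis
    by (rule L2_limit_le[OF Ad(4)[OF c(1)] Ad(4)[OF g] conv le]) simp
qed

lemma unit_image_compose_le:
  assumes A: "markov_operator M A" and B: "markov_operator M B"
  shows "AE x in M. unit_image M (\<lambda>u. A (B u)) x \<le> unit_image M A x"
proof -
  have "AE x in M. A (B (\<phi> k)) x \<le> unit_image M A x" for k
    by (rule markov_le_unit_image[OF A markov_operatorD(4)[OF B phi_L2] markov_operatorD(3)[OF B phi_L2 phi_unit]])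
  then have "AE x in M. \<forall>k. A (B (\<phi> k)) x \<le> unit_image M A x" by (simp add: AE_all_countable)
  with unit_image_limit[OF markov_operator_compose[OF A B]] show ?thesis
    by eventually_elim (auto intro: LIMSEQ_le_const2)
qed

text \<open>
  If \<open>B1 = 1\<close>, the functions $B\varphi_k$ are as good as $\varphi_k$ for computing
  \<open>A1\<close>.
\<close>

lemma unit_image_compose_ge:
  assumes A: "markov_operator M A" and B: "markov_operator M B" and B1: "AE x in M. unit_image M B x = 1"
  shows "AE x in M. unit_image M A x \<le> unit_image M (\<lambda>u. A (B u)) x"
proof -
  note Ad = markov_operatorD[OF A] and Bd = markov_operatorD[OF B] and C = markov_operator_compose[OF A B]
  have lim: "AE x in M. (\<lambda>k. B (\<phi> k) x) \<longlonglongrightarrow> 1"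
    using unit_image_limit[OF B] B1 by eventually_elim simp
  have B01: "AE x in M. 0 \<le> B (\<phi> k) x \<and> B (\<phi> k) x \<le> 1" for k by (rule Bd(3)[OF phi_L2 phi_unit])
  have "AE x in M. A (\<phi> j) x \<le> unit_image M (\<lambda>u. A (B u)) x" for j
  proof -
    note c = L2_cutoff_tendsto[OF phi_L2[of j] L2_measurable[OF Bd(4)[OF phi_L2]] B01 lim]
    have le: "AE x in M. A (\<lambda>x. \<phi> j x * B (\<phi> k) x) x \<le> unit_image M (\<lambda>u. A (B u)) x" for k
    proof -
      have "AE x in M. A (\<lambda>x. \<phi> j x * B (\<phi> k) x) x \<le> A (B (\<phi> k)) x"
      proof (rule markov_operator_mono[OF A c(1) Bd(4)[OF phi_L2]])
        show "AE x in M. \<phi> j x * B (\<phi> k) x \<le> B (\<phi> k) x \<and> B (\<phi> k) x - \<phi> j x * B (\<phi> k) x \<le> 1"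
          using phi_unit[of j] B01[of k]
        proof eventually_elim
          case (elim x)
          then have "0 \<le> \<phi> j x * B (\<phi> k) x" "\<phi> j x * B (\<phi> k) x \<le> B (\<phi> k) x"
            by (simp_all add: mult_left_le_one_le)
          with elim show ?case by linarith
        qed
      qed
      with unit_image_limit[OF C] show ?thesis by eventually_elim (auto intro: order_trans)
    qed
    have conv: "(\<lambda>k. L2_norm M (\<lambda>x. A (\<lambda>x. \<phi> j x * B (\<phi> k) x) x - A (\<phi> j) x)) \<longlonglongrightarrow> 0"
      by (rule markov_operator_tendsto[OF A c(1) phi_L2 c(2)])
    show ?thesis by (rule L2_limit_le[OF Ad(4)[OF c(1)] Ad(4)[OF phi_L2] conv le]) simp
  qed
  then have "AE x in M. \<forall>j. A (\<phi> j) x \<le> unit_image M (\<lambda>u. A (B u)) x" by (simp add: AE_all_countable)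
  with unit_image_limit[OF A] show ?thesis by eventually_elim (auto intro: LIMSEQ_le_const2)
qed

lemma unit_image_funpow:
  assumes A: "markov_operator M A"
  shows "AE x in M. unit_image M (A ^^ 0) x = 1 \<and> (\<forall>n. unit_image M (A ^^ Suc n) x \<le> unit_image M (A ^^ n) x)
    \<and> (\<forall>n. unit_image M (A ^^ n) x \<le> 1) \<and> (\<forall>n. 0 \<le> unit_image M (A ^^ n) x)"
proof -
  have "AE x in M. unit_image M (A ^^ Suc n) x \<le> unit_image M (A ^^ n) x" for n
  proof -
    have "(A ^^ Suc n) = (\<lambda>u. (A ^^ n) (A u))" by (simp add: fun_eq_iff funpow_swap1)
    then show ?thesis using unit_image_compose_le[OF markov_operator_funpow[OF A] A, of n] by simp
  qed
  then have 1: "AE x in M. \<forall>n. unit_image M (A ^^ Suc n) x \<le> unit_image M (A ^^ n) x"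
    by (simp add: AE_all_countable del: funpow.simps)
  have "AE x in M. unit_image M (A ^^ 0) x = 1"
    using phi_limit by eventually_elim (auto simp: unit_image_def intro: limI)
  moreover have "AE x in M. \<forall>n. 0 \<le> unit_image M (A ^^ n) x \<and> unit_image M (A ^^ n) x \<le> 1"
    unfolding AE_all_countable
    using unit_image_limit[OF markov_operator_funpow[OF A]] by (auto elim: eventually_mono)
  ultimately show ?thesis using 1 by eventually_elim blast
qed

context
  fixes A assumes A: "markov_operator M A"
begin

lemma lift_contraction: "contraction_on (L2_space M) (lift_op M A)"
proof -
  note Ad = markov_operatorD[OF A]
  have "norm (lift_op M A x) \<le> norm x" if "x \<in> L2_space M" for x
  proof -
    obtain u where u: "u \<in> L2 M" "x = L2_functional M u" using \<open>x \<in> L2_space M\<close> by (rule L2_spaceE)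
    show ?thesis by (simp add: u lift_op_functional[OF Ad(1) u(1)] norm_L2_functional Ad)
  qed
  then show ?thesis using lift_op_bounded[OF Ad(1)] by (simp add: contraction_on_def bounded_map_on_def)
qed

lemma lift_funpow: "u \<in> L2 M \<Longrightarrow> (lift_op M A ^^ n) (L2_functional M u) = L2_functional M ((A ^^ n) u)"
  by (induction n)
    (simp_all add: lift_op_functional[OF markov_operatorD(1)[OF A]] markov_operatorD(4)[OF markov_operator_funpow[OF A]])

interpretation W: closed_subspace "L2_space M" by (rule L2_space_closed_subspace)

lemma
  assumes s: "0 \<le> s"
  shows poisson_op_bounded: "L2_bounded_operator M (poisson_op M A s)"
    and poisson_op_functional: "u \<in> L2 M \<Longrightarrow>
      L2_functional M (poisson_op M A s u) = poisson (lift_op M A) s (L2_functional M u)"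
  unfolding poisson_op_def
  using lower_op_bounded[OF contraction_on_bounded[OF W.poisson_contraction[OF lift_contraction s]]]
  by blast+

lemma poisson_partial_L2: "u \<in> L2 M \<Longrightarrow> (\<lambda>x. \<Sum>n<N. poisson_weight s n * (A ^^ n) u x) \<in> L2 M"
  by (intro L2_sum L2_scale markov_operatorD(4)[OF markov_operator_funpow[OF A]])

lemma poisson_op_limit:
  assumes s: "0 \<le> s" and u: "u \<in> L2 M"
  shows "(\<lambda>N. L2_norm M (\<lambda>x. (\<Sum>n<N. poisson_weight s n * (A ^^ n) u x) - poisson_op M A s u x)) \<longlonglongrightarrow> 0"
proof -
  note Pu = L2_bounded_operatorD(1)[OF poisson_op_bounded[OF s] u]
    and An = markov_operatorD(4)[OF markov_operator_funpow[OF A] u]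
  have "L2_functional M (\<lambda>x. \<Sum>n<N. poisson_weight s n * (A ^^ n) u x)
      = (\<Sum>n<N. poisson_weight s n *\<^sub>R (lift_op M A ^^ n) (L2_functional M u))" for N
    by (simp add: L2_functional_sum L2_scale An L2_functional_scale lift_funpow u)
  then show ?thesis
    using W.poisson_sums[OF lift_contraction s L2_functional_in[OF u]]
    unfolding sums_def poisson_op_functional[OF s u, symmetric]
    by (subst L2_functional_tendsto_iff[symmetric]) (simp_all add: poisson_partial_L2[OF u] Pu)
qed

lemma poisson_op_markov: assumes s: "0 \<le> s" shows "markov_operator M (poisson_op M A s)"
  unfolding markov_operator_def
proof (intro conjI ballI impI poisson_op_bounded[OF s])
  fix u assume u: "u \<in> L2 M"
  note Pu = L2_bounded_operatorD(1)[OF poisson_op_bounded[OF s] u]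
  show "L2_norm M (poisson_op M A s u) \<le> L2_norm M u"
    using contraction_onD(2)[OF W.poisson_contraction[OF lift_contraction s] L2_functional_in[OF u]]
    by (simp add: norm_L2_functional u Pu flip: poisson_op_functional[OF s u])
  assume u01: "AE x in M. 0 \<le> u x \<and> u x \<le> 1"
  have An: "AE x in M. \<forall>n. 0 \<le> (A ^^ n) u x \<and> (A ^^ n) u x \<le> 1"
    unfolding AE_all_countable using markov_operatorD(3)[OF markov_operator_funpow[OF A] u u01] by blast
  have "AE x in M. poisson_op M A s u x \<le> 1"
  proof (rule L2_limit_le[OF poisson_partial_L2[OF u] Pu poisson_op_limit[OF s u]])
    show "AE x in M. (\<Sum>n<N. poisson_weight s n * (A ^^ n) u x) \<le> (\<Sum>n<N. poisson_weight s n)" for N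
      using An by eventually_elim (auto intro!: sum_mono mult_left_le simp: poisson_weight_nonneg s)
    show "AE x in M. (\<lambda>N. \<Sum>n<N. poisson_weight s n) \<longlonglongrightarrow> 1"
      using sums_poisson_weight[of s] by (simp add: sums_def)
  qed
  moreover have "AE x in M. 0 \<le> poisson_op M A s u x"
  proof (rule L2_limit_ge[OF poisson_partial_L2[OF u] Pu poisson_op_limit[OF s u]])
    show "AE x in M. 0 \<le> (\<Sum>n<N. poisson_weight s n * (A ^^ n) u x)" for N
      using An by eventually_elim (auto intro!: sum_nonneg simp: poisson_weight_nonneg s)
  qed simp
  ultimately show "AE x in M. 0 \<le> poisson_op M A s u x \<and> poisson_op M A s u x \<le> 1" by eventually_elim simp
qed

lemma poisson_op_symmetric:
  assumes s: "0 \<le> s" and sym: "symmetric_operator M A" shows "symmetric_operator M (poisson_op M A s)"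
proof (rule symmetric_operator_limit[OF poisson_partial_L2 _ L2_bounded_operatorD(1)[OF poisson_op_bounded[OF s]]
      poisson_op_limit[OF s]])
  show "symmetric_operator M (\<lambda>u x. \<Sum>n<N. poisson_weight s n * (A ^^ n) u x)" for N
    unfolding symmetric_operator_def
  proof (intro ballI)
    fix u v assume u: "u \<in> L2 M" and v: "v \<in> L2 M"
    have i: "(\<lambda>x. \<Sum>n<N. poisson_weight s n * (A ^^ n) w x) \<in> L2 M" "(\<lambda>x. poisson_weight s N * (A ^^ N) w x) \<in> L2 M"
      "(A ^^ N) w \<in> L2 M" if "w \<in> L2 M" for w N
      using that poisson_partial_L2 L2_scale markov_operatorD(4)[OF markov_operator_funpow[OF A]] by blast+
    show "L2_inner M (\<lambda>x. \<Sum>n<N. poisson_weight s n * (A ^^ n) u x) v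
      = L2_inner M u (\<lambda>x. \<Sum>n<N. poisson_weight s n * (A ^^ n) v x)"
    proof (induction N)
      case (Suc N)
      have "L2_inner M ((A ^^ N) u) v = L2_inner M u ((A ^^ N) v)"
        using symmetric_operator_funpow[OF A sym, of N] u v by (simp add: symmetric_operator_def)
      with Suc show ?case
        using L2.B_add[OF i(1,2)[OF u] v] L2.B_add_right[OF i(1,2)[OF v] u]
          L2.B_scale[OF i(3)[OF u] v] L2.B_scale_right[OF i(3)[OF v] u] by simp
    qed (simp add: L2_inner_def)
  qed
qed

text \<open>
  The image of one under the mixture is at most the mixture of the images $A^n1$, and at least every
  partial sum of that series. Since all weights are positive and $A^n1 \le 1$, it equals one exactly
  if every $A^n1$ does.
\<close>

lemma poisson_op_unit:
  assumes s: "0 < s"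
  shows "AE x in M. unit_image M (poisson_op M A s) x = 1 \<longleftrightarrow> (\<forall>n. unit_image M (A ^^ n) x = 1)"
proof -
  note P = poisson_op_markov[OF less_imp_le[OF s]]
  have bounds: "AE x in M. poisson_op M A s (\<phi> k) x \<le> (\<Sum>n. poisson_weight s n * unit_image M (A ^^ n) x)
      \<and> (\<forall>N. (\<Sum>n<N. poisson_weight s n * (A ^^ n) (\<phi> k) x) \<le> poisson_op M A s (\<phi> k) x)" for k
  proof -
    note Pu = markov_operatorD(4)[OF P phi_L2[of k]]
      and L = poisson_op_limit[OF less_imp_le[OF s] phi_L2[of k]] and pL = poisson_partial_L2[OF phi_L2[of k]]
    have An: "AE x in M. \<forall>n. 0 \<le> (A ^^ n) (\<phi> k) x \<and> (A ^^ n) (\<phi> k) x \<le> unit_image M (A ^^ n) x"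
      unfolding AE_all_countable
    proof
      show "AE x in M. 0 \<le> (A ^^ n) (\<phi> k) x \<and> (A ^^ n) (\<phi> k) x \<le> unit_image M (A ^^ n) x" for n
        using unit_image_limit[OF markov_operator_funpow[OF A, of n]]
          markov_operatorD(3)[OF markov_operator_funpow[OF A] phi_L2[of k] phi_unit[of k], of n]
        by eventually_elim blast
    qed
    have "AE x in M. poisson_op M A s (\<phi> k) x \<le> (\<Sum>n. poisson_weight s n * unit_image M (A ^^ n) x)"
    proof (rule L2_limit_le[OF pL Pu L])
      show "AE x in M. (\<Sum>n<N. poisson_weight s n * (A ^^ n) (\<phi> k) x) \<le> (\<Sum>n<N. poisson_weight s n * unit_image M (A ^^ n) x)" for N
        using An by eventually_elim (auto intro!: sum_mono mult_left_mono simp: poisson_weight_nonneg s less_imp_le)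
      show "AE x in M. (\<lambda>N. \<Sum>n<N. poisson_weight s n * unit_image M (A ^^ n) x) \<longlonglongrightarrow> (\<Sum>n. poisson_weight s n * unit_image M (A ^^ n) x)"
        using unit_image_funpow[OF A]
      proof eventually_elim
        case (elim x)
        show ?case
          by (rule summable_LIMSEQ, rule summable_comparison_test'[OF sums_summable[OF sums_poisson_weight[of s]], of 0])
            (use elim in \<open>auto simp: abs_mult poisson_weight_nonneg s less_imp_le mult_left_le\<close>)
      qed
    qed
    moreover have "AE x in M. (\<Sum>n<N. poisson_weight s n * (A ^^ n) (\<phi> k) x) \<le> poisson_op M A s (\<phi> k) x" for N
    \<comment> \<open>Dropping the first \<open>N\<close> partial sums leaves a sequence that stays above the \<open>N\<close>-th one.\<close>
    proof (rule L2_limit_ge[where u="\<lambda>j x. \<Sum>n<j + N. poisson_weight s n * (A ^^ n) (\<phi> k) x"])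
      show "(\<lambda>j. L2_norm M (\<lambda>x. (\<Sum>n<j + N. poisson_weight s n * (A ^^ n) (\<phi> k) x) - poisson_op M A s (\<phi> k) x)) \<longlonglongrightarrow> 0"
        by (rule LIMSEQ_ignore_initial_segment[OF L])
      show "AE x in M. (\<Sum>n<N. poisson_weight s n * (A ^^ n) (\<phi> k) x) \<le> (\<Sum>n<j + N. poisson_weight s n * (A ^^ n) (\<phi> k) x)" for j
        using An by eventually_elim (auto intro!: sum_mono2 mult_nonneg_nonneg simp: poisson_weight_nonneg s less_imp_le)
    qed (use pL Pu in auto)
    then have "AE x in M. \<forall>N. (\<Sum>n<N. poisson_weight s n * (A ^^ n) (\<phi> k) x) \<le> poisson_op M A s (\<phi> k) x"
      by (simp add: AE_all_countable)
    ultimately show ?thesis by eventually_elim blast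
  qed
  then have b: "AE x in M. \<forall>k. poisson_op M A s (\<phi> k) x \<le> (\<Sum>n. poisson_weight s n * unit_image M (A ^^ n) x)
      \<and> (\<forall>N. (\<Sum>n<N. poisson_weight s n * (A ^^ n) (\<phi> k) x) \<le> poisson_op M A s (\<phi> k) x)"
    by (simp add: AE_all_countable)
  have c: "AE x in M. \<forall>n. (\<lambda>k. (A ^^ n) (\<phi> k) x) \<longlonglongrightarrow> unit_image M (A ^^ n) x"
    unfolding AE_all_countable
    using unit_image_limit[OF markov_operator_funpow[OF A]] by (auto elim: eventually_mono)
  from b c unit_image_limit[OF P] unit_image_funpow[OF A] show ?thesis
  proof eventually_elim
    case (elim x)
    let ?a = "\<lambda>n. unit_image M (A ^^ n) x" and ?p = "poisson_weight s"
    have p: "0 < ?p n" for n by (rule poisson_weight_pos[OF s])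
    have sm: "summable (\<lambda>n. ?p n * ?a n)"
      by (rule summable_comparison_test'[OF sums_summable[OF sums_poisson_weight[of s]], of 0])
        (use elim(4) in \<open>auto simp: abs_mult poisson_weight_nonneg s less_imp_le mult_left_le\<close>)
    have up: "unit_image M (poisson_op M A s) x \<le> (\<Sum>n. ?p n * ?a n)"
      using elim(1,3) by (auto intro: LIMSEQ_le_const2)
    have low: "(\<Sum>n<N. ?p n * ?a n) \<le> unit_image M (poisson_op M A s) x" for N
    proof (rule LIMSEQ_le)
      show "(\<lambda>k. \<Sum>n<N. ?p n * (A ^^ n) (\<phi> k) x) \<longlonglongrightarrow> (\<Sum>n<N. ?p n * ?a n)"
        using elim(2) by (intro tendsto_intros) auto
      show "(\<lambda>k. poisson_op M A s (\<phi> k) x) \<longlonglongrightarrow> unit_image M (poisson_op M A s) x" using elim(3) by simp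
    qed (use elim(1) in auto)
    show ?case
    proof
      assume "unit_image M (poisson_op M A s) x = 1"
      then have ge: "1 \<le> (\<Sum>n. ?p n * ?a n)" using up by simp
      have d: "(\<lambda>n. ?p n * (1 - ?a n)) sums (1 - (\<Sum>n. ?p n * ?a n))"
        using sums_diff[OF sums_poisson_weight[of s] summable_sums[OF sm]] by (simp add: right_diff_distrib)
      have nn: "0 \<le> ?p n * (1 - ?a n)" for n using p[of n] elim(4) by simp
      have "(\<Sum>n. ?p n * (1 - ?a n)) \<le> 0" using sums_unique[OF d] ge by simp
      moreover have "0 \<le> (\<Sum>n. ?p n * (1 - ?a n))" by (rule suminf_nonneg[OF sums_summable[OF d] nn])
      ultimately have "(\<Sum>n. ?p n * (1 - ?a n)) = 0" by simp
      then have "\<forall>n. ?p n * (1 - ?a n) = 0" using suminf_eq_zero_iff[OF sums_summable[OF d] nn] by simp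
      then show "\<forall>n. ?a n = 1" using p by (metis less_irrefl mult_eq_0_iff right_minus_eq)
    next
      assume a: "\<forall>n. ?a n = 1"
      have "1 \<le> unit_image M (poisson_op M A s) x"
      proof (rule LIMSEQ_le_const2)
        show "(\<lambda>N. \<Sum>n<N. ?p n) \<longlonglongrightarrow> 1" using sums_poisson_weight[of s] by (simp add: sums_def)
      qed (use low a in auto)
      then show "unit_image M (poisson_op M A s) x = 1" using elim(3) by simp
    qed
  qed
qed

end

end

section \<open>Forms with a bounded generator\<close>

text \<open>
  The common shape of the two approximations: the form of the bounded operator $c(1-A)$.
\<close>

definition jump_form :: "'a measure \<Rightarrow> real \<Rightarrow> (('a \<Rightarrow> real) \<Rightarrow> 'a \<Rightarrow> real) \<Rightarrow> 'a qform" where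
  "jump_form M c A = \<lparr>form_dom = L2 M, energy = (\<lambda>u. c * L2_inner M (\<lambda>x. u x - A u x) u)\<rparr>"

text \<open>
  Symmetry of \<open>A\<close> is what makes $c(1-A)$, and not only its symmetric part, the operator
  of the form.
\<close>

lemma polar_jump_form:
  assumes A: "L2_bounded_operator M A" and sym: "symmetric_operator M A" and u: "u \<in> L2 M" and v: "v \<in> L2 M"
  shows "polar (jump_form M c A) u v = c * L2_inner M (\<lambda>x. u x - A u x) v"
proof -
  note i = L2_bounded_operatorD(1)[OF A]
  have q: "L2_inner M (\<lambda>x. w x - A w x) w = L2_inner M w w - L2_inner M (A w) w" if "w \<in> L2 M" for w
    using L2.B_diff[OF that i[OF that] that] .
  have sm: "L2_inner M (A v) u = L2_inner M (A u) v"
    using sym u v L2.sym[OF v i[OF u]] by (simp add: symmetric_operator_def)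
  have plus: "L2_inner M (A (\<lambda>x. u x + v x)) (\<lambda>x. u x + v x) = L2_inner M (A u) u + 2 * L2_inner M (A u) v + L2_inner M (A v) v"
  proof -
    have "L2_inner M (A (\<lambda>x. u x + v x)) (\<lambda>x. u x + v x) = L2_inner M (\<lambda>x. A u x + A v x) (\<lambda>x. u x + v x)"
      by (rule L2_inner_AE_cong) (use L2_bounded_operatorD(2)[OF A u v] in \<open>auto simp: i u v L2_add\<close>)
    then show ?thesis by (simp add: L2.B_add L2.B_add_right i u v L2_add sm)
  qed
  have minus: "L2_inner M (A (\<lambda>x. u x - v x)) (\<lambda>x. u x - v x) = L2_inner M (A u) u - 2 * L2_inner M (A u) v + L2_inner M (A v) v"
  proof -
    have "L2_inner M (A (\<lambda>x. u x - v x)) (\<lambda>x. u x - v x) = L2_inner M (\<lambda>x. A u x - A v x) (\<lambda>x. u x - v x)"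
      by (rule L2_inner_AE_cong) (use L2_bounded_operator_diff[OF A u v] in \<open>auto simp: i u v L2_diff\<close>)
    then show ?thesis by (simp add: L2.B_diff L2.B_diff_right i u v L2_diff sm)
  qed
  have en: "energy (jump_form M c A) w = c * (L2_inner M w w - L2_inner M (A w) w)" if "w \<in> L2 M" for w
    using q[OF that] by (simp add: jump_form_def)
  have sq: "L2_inner M (\<lambda>x. u x + v x) (\<lambda>x. u x + v x) = L2_inner M u u + 2 * L2_inner M u v + L2_inner M v v"
    using L2.B_expand[OF u v, of 1] by simp
  show ?thesis
    unfolding polar_def en[OF L2_add[OF u v]] en[OF L2_diff[OF u v]] plus minus sq
      L2.B_expand_diff[OF u v] L2.B_diff[OF u i[OF u] v]
    by (simp add: field_simps)
qed

lemma jump_form_operator_iff: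
  assumes A: "L2_bounded_operator M A" and sym: "symmetric_operator M A" and u: "u \<in> L2 M" and f: "f \<in> L2 M"
  shows "form_operator M (jump_form M c A) u f \<longleftrightarrow> (AE x in M. f x = c * (u x - A u x))"
proof -
  have d: "(\<lambda>x. u x - A u x) \<in> L2 M" by (rule L2_diff[OF u L2_bounded_operatorD(1)[OF A u]])
  let ?g = "\<lambda>x. c * (u x - A u x)"
  have g: "?g \<in> L2 M" by (rule L2_scale[OF d])
  have "form_operator M (jump_form M c A) u f \<longleftrightarrow> (\<forall>v\<in>L2 M. L2_inner M ?g v = L2_inner M f v)"
    using u f by (auto simp: form_operator_def jump_form_def[THEN arg_cong, of form_dom]
        polar_jump_form[OF A sym] L2.B_scale[OF d])
  also have "\<dots> \<longleftrightarrow> (AE x in M. f x = ?g x)"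
  proof
    assume h: "\<forall>v\<in>L2 M. L2_inner M ?g v = L2_inner M f v"
    have dd: "(\<lambda>x. f x - ?g x) \<in> L2 M" by (rule L2_diff[OF f g])
    have "L2_inner M (\<lambda>x. f x - ?g x) (\<lambda>x. f x - ?g x) = 0"
      using L2.B_diff[OF f g dd] h dd by simp
    then have "L2_norm M (\<lambda>x. f x - ?g x) = 0" by (simp add: L2_norm_def)
    then show "AE x in M. f x = ?g x" using L2_norm_zero_iff[OF dd] by simp
  next
    assume e: "AE x in M. f x = ?g x"
    show "\<forall>v\<in>L2 M. L2_inner M ?g v = L2_inner M f v"
      by (intro ballI L2_inner_AE_cong[OF f g _ _ e, symmetric]) simp_all
  qed
  finally show ?thesis .
qed

context sigma_finite_measure
begin

interpretation W: closed_subspace "L2_space M" by (rule L2_space_closed_subspace)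

text \<open>
  The generator of the Poisson mixtures is defined everywhere and equals $-c(1-A)$, as required of
  the semigroup of this form.
\<close>

lemma
  assumes A: "markov_operator M A" and sym: "symmetric_operator M A" and c: "0 < c"
  shows jump_form_C0: "C0_semigroup M (form_semigroup M (jump_form M c A))"
    and jump_form_semigroup: "0 \<le> t \<Longrightarrow> u \<in> L2 M \<Longrightarrow>
      AE x in M. form_semigroup M (jump_form M c A) t u x = poisson_op M A (c * t) u x"
proof -
  let ?S = "\<lambda>t. poisson (lift_op M A) (c * t)"
  note Ab = markov_operatorD(1)[OF A] and L = lift_contraction[OF A]
  have S: "C0_on (L2_space M) ?S" by (rule W.poisson_C0[OF L less_imp_le[OF c]])
  have dom: "u \<in> L2 M \<and> f \<in> L2 M" if "form_operator M (jump_form M c A) u f" for u f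
    using that by (simp add: form_operator_def jump_form_def)
  have gen0: "generator_on (L2_space M) ?S x (- (c *\<^sub>R (x - lift_op M A x)))" if "x \<in> L2_space M" for x
    by (rule W.poisson_generator[OF L less_imp_le[OF c] that])
  have gen_iff: "generator_on (L2_space M) ?S x g \<longleftrightarrow> g = - (c *\<^sub>R (x - lift_op M A x))" if "x \<in> L2_space M" for x g
    using gen0[OF that] tendsto_unique[OF trivial_limit_at_right_real] unfolding generator_on_def by blast
  have gen: "form_operator M (jump_form M c A) u f \<longleftrightarrow> generator_on (L2_space M) ?S (L2_functional M u) (- L2_functional M f)"
    if u: "u \<in> L2 M" and f: "f \<in> L2 M" for u f
  proof -
    note Au = markov_operatorD(4)[OF A u] 
    note d = L2_diff[OF u Au]
    have "generator_on (L2_space M) ?S (L2_functional M u) (- L2_functional M f)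
      \<longleftrightarrow> L2_functional M f = L2_functional M (\<lambda>x. c * (u x - A u x))"
      unfolding gen_iff[OF L2_functional_in[OF u]] lift_op_functional[OF Ab u]
        L2_functional_scale[OF d] L2_functional_diff[OF u Au] by simp
    also have "\<dots> \<longleftrightarrow> (AE x in M. f x = c * (u x - A u x))" by (rule L2_functional_eq_iff[OF f L2_scale[OF d]])
    finally show ?thesis using jump_form_operator_iff[OF Ab sym u f] by simp
  qed
  have uniq: "T t x = ?S t x"
    if T: "C0_on (L2_space M) T" and g: "\<And>x g. x \<in> L2_space M \<Longrightarrow> g \<in> L2_space M \<Longrightarrow>
        generator_on (L2_space M) T x g \<longleftrightarrow> generator_on (L2_space M) ?S x g"
      and x: "x \<in> L2_space M" and t: "0 \<le> t" for T x t
  proof (rule W.poisson_unique[OF L c T _ x t])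
    show "generator_on (L2_space M) T y (- (c *\<^sub>R (y - lift_op M A y)))" if "y \<in> L2_space M" for y
      using g[OF that, of "- (c *\<^sub>R (y - lift_op M A y))"] gen0[OF that] by (auto simp: generator_on_def)
  qed
  show C0: "C0_semigroup M (form_semigroup M (jump_form M c A))"
    by (rule form_semigroup_characterization(1)[OF S]) (fact dom, fact gen, fact uniq)
  show "AE x in M. form_semigroup M (jump_form M c A) t u x = poisson_op M A (c * t) u x"
    if t: "0 \<le> t" and u: "u \<in> L2 M"
  proof -
    have ct: "0 \<le> c * t" using c t by simp
    have "L2_functional M (form_semigroup M (jump_form M c A) t u) = ?S t (L2_functional M u)"
      by (rule form_semigroup_characterization(2)[OF S]) (fact dom, fact gen, fact uniq, fact t, fact u)
    also have "\<dots> = L2_functional M (poisson_op M A (c * t) u)"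
      by (rule poisson_op_functional[OF A ct u, symmetric])
    finally show ?thesis
      using L2_functional_eq_iff[OF C0_semigroupD(2)[OF C0 t u] L2_bounded_operatorD(1)[OF poisson_op_bounded[OF A ct] u]]
      by simp
  qed
qed

section \<open>Conservativeness of Markov semigroups\<close>

lemma Linf_extension_unit:
  assumes A: "L2_bounded_operator M A"
  shows "AE x in M. Linf_extension M A (\<lambda>_. 1) x = unit_image M A x"
proof -
  have "AE x in M. A (\<lambda>y. 0) x = 0"
    using L2_bounded_operatorD(3)[OF A L2_zero, of 0] by simp
  then show ?thesis
    by eventually_elim (simp add: Linf_extension_def unit_image_def unit_exhaustion_def)
qed

definition markov_semigroup where
  "markov_semigroup S \<longleftrightarrow> C0_semigroup M S \<and> (\<forall>t\<ge>0. markov_operator M (S t))"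

lemma markov_semigroupD:
  assumes "markov_semigroup S"
  shows "0 \<le> t \<Longrightarrow> markov_operator M (S t)"
    "0 \<le> s \<Longrightarrow> 0 \<le> t \<Longrightarrow> u \<in> L2 M \<Longrightarrow> AE x in M. S (s + t) u x = S s (S t u) x"
  using assms C0_semigroupD(4) unfolding markov_semigroup_def by blast+

lemma unit_image_antimono:
  assumes S: "markov_semigroup S" and "0 \<le> s" "s \<le> t"
  shows "AE x in M. unit_image M (S t) x \<le> unit_image M (S s) x"
proof -
  have ts: "0 \<le> t - s" "s + (t - s) = t" using assms by simp_all
  have "AE x in M. unit_image M (S t) x = unit_image M (\<lambda>u. S s (S (t - s) u)) x"
    using unit_image_cong[OF markov_semigroupD(2)[OF S assms(2) ts(1)]] by (simp add: ts(2))
  with unit_image_compose_le[OF markov_semigroupD(1)[OF S assms(2)] markov_semigroupD(1)[OF S ts(1)]]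
  show ?thesis by eventually_elim simp
qed

text \<open>
  From one time to its multiples by composition, from these to all smaller times by monotonicity.
\<close>

lemma conservative_once_always:
  assumes S: "markov_semigroup S" and s: "0 < s" and one: "AE x in M. unit_image M (S s) x = 1" and t: "0 \<le> t"
  shows "AE x in M. unit_image M (S t) x = 1"
proof -
  have n: "AE x in M. unit_image M (S (real (Suc n) * s)) x = 1" for n
  proof (induction n)
    case (Suc n)
    let ?r = "real (Suc n) * s"
    have r: "0 \<le> ?r" and r': "?r + s = real (Suc (Suc n)) * s" using s by (auto simp: algebra_simps)
    have "AE x in M. unit_image M (S (?r + s)) x = unit_image M (\<lambda>u. S ?r (S s u)) x"
      by (rule unit_image_cong[OF markov_semigroupD(2)[OF S r less_imp_le[OF s]]])
    moreover have "0 \<le> ?r + s" using r s by simp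
    note unit_image_limit[OF markov_semigroupD(1)[OF S this]]
    moreover note Suc.IH
      unit_image_compose_ge[OF markov_semigroupD(1)[OF S r] markov_semigroupD(1)[OF S less_imp_le[OF s]] one]
    ultimately have "AE x in M. unit_image M (S (?r + s)) x = 1"
      by eventually_elim (simp only: order_antisym)
    then show ?case by (simp only: r')
  qed (use one in simp)
  obtain m :: nat where "t / s < real m" using reals_Archimedean2 by blast
  then have "t \<le> real (Suc m) * s" using s by (simp add: field_simps)
  from unit_image_antimono[OF S t this] n[of m] unit_image_limit[OF markov_semigroupD(1)[OF S t]]
  show ?thesis by eventually_elim simp
qed

lemma conservative_space_iff:
  assumes S: "markov_semigroup (form_semigroup M Q)"
  shows "AE x in M. x \<in> conservative_space M Q \<longleftrightarrow> (\<forall>k\<ge>1. unit_image M (form_semigroup M Q (real k)) x = 1)"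
proof -
  have "AE x in M. \<forall>k::nat. form_semigroup_Linf M Q (real k) (\<lambda>_. 1) x = unit_image M (form_semigroup M Q (real k)) x"
    unfolding AE_all_countable form_semigroup_Linf_def
    using Linf_extension_unit[OF markov_operatorD(1)[OF markov_semigroupD(1)[OF S]]] by simp
  then show ?thesis using AE_space
    by eventually_elim (auto simp: conservative_space_def)
qed

text \<open>
  Conservativeness at one time implies it at all times, so it can be tested at time one, which is
  one of the times in the definition of the conservative space. Dissipativity is the negation
  because the image of one never exceeds one.
\<close>

lemma conservative_iff_space:
  assumes S: "markov_semigroup (form_semigroup M Q)"
  shows "conservative M Q \<longleftrightarrow> (AE x in M. x \<in> conservative_space M Q)"
    and "dissipative M Q \<longleftrightarrow> \<not> conservative M Q"
proof -
  let ?T = "form_semigroup M Q"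
  have L: "AE x in M. form_semigroup_Linf M Q s (\<lambda>_. 1) x = unit_image M (?T s) x" if "0 < s" for s
    unfolding form_semigroup_Linf_def
    using Linf_extension_unit[OF markov_operatorD(1)[OF markov_semigroupD(1)[OF S]]] that by simp
  have L1: "(AE x in M. form_semigroup_Linf M Q s (\<lambda>_. 1) x = 1) \<longleftrightarrow> (AE x in M. unit_image M (?T s) x = 1)" if "0 < s" for s
    using L[OF that] by (intro iffI; elim AE_mp) auto
  have c1: "conservative M Q \<longleftrightarrow> (\<exists>s>0. AE x in M. unit_image M (?T s) x = 1)"
    unfolding conservative_def using L1 by blast
  have all: "conservative M Q \<longleftrightarrow> (\<forall>s>0. AE x in M. unit_image M (?T s) x = 1)"
    unfolding c1 using conservative_once_always[OF S] by (meson less_imp_le zero_less_one)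
  have "(AE x in M. x \<in> conservative_space M Q) \<longleftrightarrow> (AE x in M. \<forall>k\<ge>1. unit_image M (?T (real k)) x = 1)"
    using conservative_space_iff[OF S] by (intro iffI; elim AE_mp) auto
  also have "\<dots> \<longleftrightarrow> (\<forall>k\<ge>1. AE x in M. unit_image M (?T (real k)) x = 1)"
    by (simp add: AE_all_countable)
  also have "\<dots> \<longleftrightarrow> conservative M Q"
  proof
    assume "\<forall>k\<ge>1. AE x in M. unit_image M (?T (real k)) x = 1"
    then have "AE x in M. unit_image M (?T 1) x = 1" by (metis of_nat_1 order_refl)
    then show "conservative M Q" unfolding c1 using zero_less_one by blast
  qed (auto simp: all)
  finally show "conservative M Q \<longleftrightarrow> (AE x in M. x \<in> conservative_space M Q)" by simp
  have "emeasure M {x \<in> space M. form_semigroup_Linf M Q s (\<lambda>_. 1) x < 1} > 0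
    \<longleftrightarrow> \<not> (AE x in M. unit_image M (?T s) x = 1)" if s: "0 < s" for s
  proof -
    let ?P = "form_semigroup_Linf M Q s (\<lambda>_. 1)"
    note mk = markov_semigroupD(1)[OF S less_imp_le[OF s]]
    have [measurable]: "?T s u \<in> borel_measurable M" if "u \<in> L2 M" for u
      by (rule L2_measurable[OF markov_operatorD(4)[OF mk that]])
    have pos: "(\<lambda>y. max 1 0 * \<phi> k y) \<in> L2 M" "(\<lambda>y. max (- 1) 0 * \<phi> k y) \<in> L2 M" for k
      by (rule L2_scale[OF phi_L2])+
    have meas: "?P \<in> borel_measurable M"
      unfolding form_semigroup_Linf_def Linf_extension_def Let_def unit_exhaustion_def[symmetric]
      by (intro borel_measurable_diff borel_measurable_lim_metric L2_measurable[OF markov_operatorD(4)[OF mk]] pos)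
    then have [measurable]: "{x \<in> space M. ?P x < 1} \<in> sets M" by measurable
    have "emeasure M {x \<in> space M. ?P x < 1} = 0 \<longleftrightarrow> (AE x in M. \<not> ?P x < 1)"
      by (rule AE_iff_measurable[symmetric]) auto
    also have "\<dots> \<longleftrightarrow> (AE x in M. unit_image M (?T s) x = 1)"
    proof
      assume "AE x in M. \<not> ?P x < 1"
      with L[OF s] unit_image_limit[OF mk] show "AE x in M. unit_image M (?T s) x = 1"
        by eventually_elim simp
    next
      assume "AE x in M. unit_image M (?T s) x = 1"
      with L[OF s] show "AE x in M. \<not> ?P x < 1" by eventually_elim simp
    qed
    finally show ?thesis unfolding zero_less_iff_neq_zero by blast
  qed
  then show "dissipative M Q \<longleftrightarrow> \<not> conservative M Q" unfolding dissipative_def all by blast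
qed

lemma jump_form_markov:
  assumes A: "markov_operator M A" and sym: "symmetric_operator M A" and c: "0 < c"
  shows "markov_semigroup (form_semigroup M (jump_form M c A))"
  unfolding markov_semigroup_def
proof (intro conjI allI impI jump_form_C0[OF assms])
  fix t :: real assume t: "0 \<le> t"
  have ct: "0 \<le> c * t" using c t by simp
  show "markov_operator M (form_semigroup M (jump_form M c A) t)"
    by (rule markov_operator_AE_cong[OF poisson_op_markov[OF A ct] C0_semigroupD(1)[OF jump_form_C0[OF assms] t]
        jump_form_semigroup[OF assms t]])
qed

text \<open>
  For each positive time the same condition on the powers of \<open>A\<close> results.
\<close>

lemma jump_form_conservative_space:
  assumes A: "markov_operator M A" and sym: "symmetric_operator M A" and c: "0 < c"
  shows "AE x in M. x \<in> conservative_space M (jump_form M c A) \<longleftrightarrow> (\<forall>n. unit_image M (A ^^ n) x = 1)"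
proof -
  let ?T = "form_semigroup M (jump_form M c A)"
  have "AE x in M. k \<ge> 1 \<longrightarrow> (unit_image M (?T (real k)) x = 1 \<longleftrightarrow> (\<forall>n. unit_image M (A ^^ n) x = 1))" for k :: nat
  proof (cases "k \<ge> 1")
    case True
    then have ck: "0 < c * real k" using c by simp
    have "AE x in M. unit_image M (?T (real k)) x = unit_image M (poisson_op M A (c * real k)) x"
      by (rule unit_image_cong) (rule jump_form_semigroup[OF assms of_nat_0_le_iff])
    with poisson_op_unit[OF A ck] show ?thesis by eventually_elim simp
  qed simp
  then have "AE x in M. \<forall>k\<ge>1. unit_image M (?T (real k)) x = 1 \<longleftrightarrow> (\<forall>n. unit_image M (A ^^ n) x = 1)"
    by (simp add: AE_all_countable)
  with conservative_space_iff[OF jump_form_markov[OF assms]] show ?thesis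
    by eventually_elim (metis order_refl)
qed

end

section \<open>The semigroup of a Dirichlet form against its Yosida approximations\<close>

context L2_dirichlet_form
begin

definition Y where "Y \<beta> u x = \<beta> * R \<beta> u x"

lemma Y_markov: assumes \<beta>: "0 < \<beta>" shows "markov_operator M (Y \<beta>)"
  unfolding markov_operator_def
proof (intro conjI ballI impI)
  have YL: "Y \<beta> u \<in> L2 M" if "u \<in> L2 M" for u
    unfolding Y_def[abs_def] by (rule L2_scale[OF R_L2[OF \<beta> that]])
  have norm: "L2_norm M (Y \<beta> u) \<le> L2_norm M u" if "u \<in> L2 M" for u
  proof -
    have "norm (\<beta> *\<^sub>R emb (R \<beta> u)) \<le> L2_norm M u"
      using R_norm[OF \<beta> that] \<beta> by (simp add: norm_L2_functional R_L2 that)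
    then show ?thesis
      unfolding L2_functional_scale[OF R_L2[OF \<beta> that], symmetric] norm_L2_functional[OF L2_scale[OF R_L2[OF \<beta> that]]]
      by (simp add: Y_def[abs_def])
  qed
  show "L2_norm M (Y \<beta> u) \<le> L2_norm M u" if "u \<in> L2 M" for u by (rule norm[OF that])
  show "AE x in M. 0 \<le> Y \<beta> u x \<and> Y \<beta> u x \<le> 1" if "u \<in> L2 M" "AE x in M. 0 \<le> u x \<and> u x \<le> 1" for u
    unfolding Y_def by (rule R_markov[OF \<beta> that])
  show "L2_bounded_operator M (Y \<beta>)"
    unfolding L2_bounded_operator_def
  proof (intro conjI ballI allI exI[of _ 1] YL)
    fix u assume u: "u \<in> L2 M"
    show "L2_norm M (Y \<beta> u) \<le> 1 * L2_norm M u" using norm[OF u] by simp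
    show "AE x in M. Y \<beta> (\<lambda>y. c * u y) x = c * Y \<beta> u x" for c
      using L2_bounded_operatorD(3)[OF R_bounded[OF \<beta>] u, of c] by eventually_elim (simp add: Y_def)
    show "AE x in M. Y \<beta> (\<lambda>y. u y + v y) x = Y \<beta> u x + Y \<beta> v x" if "v \<in> L2 M" for v
      using L2_bounded_operatorD(2)[OF R_bounded[OF \<beta>] u that] by eventually_elim (simp add: Y_def algebra_simps)
  qed
qed

lemma Y_symmetric: assumes \<beta>: "0 < \<beta>" shows "symmetric_operator M (Y \<beta>)"
  unfolding symmetric_operator_def
proof (intro ballI)
  fix u v assume u: "u \<in> L2 M" and v: "v \<in> L2 M"
  show "L2_inner M (Y \<beta> u) v = L2_inner M u (Y \<beta> v)"
    unfolding Y_def[abs_def] L2.B_scale[OF R_L2[OF \<beta> u] v] L2.B_scale_right[OF R_L2[OF \<beta> v] u]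
    using R_symmetric[OF \<beta> u v] by simp
qed

lemma HY_P:
  assumes \<beta>: "0 < \<beta>" and t: "0 \<le> t" and u: "u \<in> L2 M"
  shows "HY.P \<beta> t (emb u) = emb (poisson_op M (Y \<beta>) (\<beta> * t) u)"
proof -
  have st: "0 \<le> \<beta> * t" using \<beta> t by simp
  have "(HY.A \<beta> ^^ n) (emb u) = (lift_op M (Y \<beta>) ^^ n) (emb u)" for n
  proof (induction n)
    case (Suc n)
    let ?w = "(Y \<beta> ^^ n) u"
    have w: "?w \<in> L2 M" by (rule markov_operatorD(4)[OF markov_operator_funpow[OF Y_markov[OF \<beta>]] u])
    have "HY.A \<beta> (emb ?w) = emb (\<lambda>x. \<beta> * R \<beta> ?w x)"
      by (simp add: lift_op_functional[OF R_bounded[OF \<beta>] w] L2_functional_scale R_L2 \<beta> w)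
    also have "\<dots> = lift_op M (Y \<beta>) (emb ?w)"
      unfolding lift_op_functional[OF markov_operatorD(1)[OF Y_markov[OF \<beta>]] w] by (simp add: Y_def[abs_def])
    finally show ?case using Suc lift_funpow[OF Y_markov[OF \<beta>] u, of n] by simp
  qed simp
  then show ?thesis
    unfolding HY.P_def poisson_op_functional[OF Y_markov[OF \<beta>] st u] by (simp add: poisson_def)
qed

text \<open>
  The Yosida semigroups are Poisson mixtures of $\beta K_\beta$. Being their strong limit, the
  semigroup of the form inherits the Markov property and symmetry from the resolvents.
\<close>

lemma T_limit:
  assumes t: "0 \<le> t" and u: "u \<in> L2 M" and b: "filterlim b at_top sequentially" "\<And>n. 0 < b n"
  shows "(\<lambda>n. L2_norm M (\<lambda>x. poisson_op M (Y (b n)) (b n * t) u x - T t u x)) \<longlonglongrightarrow> 0"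
proof -
  have "(\<lambda>n. HY.P (b n) t (emb u)) \<longlonglongrightarrow> emb (T t u)"
    unfolding T_functional[OF t u]
    by (rule filterlim_compose[OF HY.P_tendsto[OF L2_functional_in[OF u] t] b(1)])
  then have "(\<lambda>n. emb (poisson_op M (Y (b n)) (b n * t) u)) \<longlonglongrightarrow> emb (T t u)"
    by (simp only: HY_P[OF b(2) t u])
  moreover have "poisson_op M (Y (b n)) (b n * t) u \<in> L2 M" for n
    by (rule markov_operatorD(4)[OF poisson_op_markov[OF Y_markov[OF b(2)] mult_nonneg_nonneg[OF less_imp_le[OF b(2)] t]] u])
  moreover have "T t u \<in> L2 M" by (rule C0_semigroupD(2)[OF T_semigroup t u])
  ultimately show ?thesis using L2_functional_tendsto_iff[of "\<lambda>n. poisson_op M (Y (b n)) (b n * t) u" M "T t u"] by blast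
qed

lemma T_markov: assumes t: "0 \<le> t" shows "markov_operator M (T t)"
proof (rule markov_operator_limit)
  show "markov_operator M (poisson_op M (Y (real (Suc n))) (real (Suc n) * t))" for n
    using t by (intro poisson_op_markov Y_markov) auto
  show "L2_bounded_operator M (T t)" by (rule C0_semigroupD(1)[OF T_semigroup t])
  show "L2_norm M (T t u) \<le> L2_norm M u" if "u \<in> L2 M" for u by (rule T_contraction[OF t that])
  show "(\<lambda>n. L2_norm M (\<lambda>x. poisson_op M (Y (real (Suc n))) (real (Suc n) * t) u x - T t u x)) \<longlonglongrightarrow> 0" if "u \<in> L2 M" for u
    by (rule T_limit[OF t that HY.filterlim_Suc_at_top]) simp
qed

lemma T_symmetric: assumes t: "0 \<le> t" shows "symmetric_operator M (T t)"
proof (rule symmetric_operator_limit)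
  let ?B = "\<lambda>n. poisson_op M (Y (real (Suc n))) (real (Suc n) * t)"
  show "?B n u \<in> L2 M" if "u \<in> L2 M" for n u
    using t that by (intro markov_operatorD(4)[OF poisson_op_markov[OF Y_markov]]) auto
  show "symmetric_operator M (?B n)" for n
    using t by (intro poisson_op_symmetric Y_markov Y_symmetric) auto
  show "T t u \<in> L2 M" if "u \<in> L2 M" for u by (rule C0_semigroupD(2)[OF T_semigroup t that])
  show "(\<lambda>n. L2_norm M (\<lambda>x. ?B n u x - T t u x)) \<longlonglongrightarrow> 0" if "u \<in> L2 M" for u
    by (rule T_limit[OF t that HY.filterlim_Suc_at_top]) simp
qed

lemma T_markov_semigroup: "markov_semigroup T"
  unfolding markov_semigroup_def using T_semigroup T_markov by blast

text \<open>
  The resolvent identity in the form $\gamma K_\gamma = \frac\gamma\beta M +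
  (1-\frac\gamma\beta)M\gamma K_\gamma$ with $M = \beta K_\beta$, with powers of \<open>M\<close>
  applied. The coefficient $\frac\gamma\beta$ is written as \<open>1 - q\<close> for the geometric
  recursion with ratio \<open>q\<close>.
\<close>

lemma Y_recursion:
  assumes \<gamma>: "0 < \<gamma>" and \<beta>: "\<gamma> \<le> \<beta>" and u: "u \<in> L2 M"
  shows "AE x in M. \<forall>n. (Y \<beta> ^^ n) (Y \<gamma> u) x
    = (1 - (1 - \<gamma> / \<beta>)) * (Y \<beta> ^^ Suc n) u x + (1 - \<gamma> / \<beta>) * (Y \<beta> ^^ Suc n) (Y \<gamma> u) x"
  unfolding AE_all_countable
proof
  fix n
  have b: "0 < \<beta>" using assms by simp
  note N = markov_operator_funpow[OF Y_markov[OF b], of n]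
  note Nb = markov_operatorD(1)[OF N]
  note G = markov_operatorD(4)[OF Y_markov[OF \<gamma>] u] and Yu = markov_operatorD(4)[OF Y_markov[OF b] u]
  note YG = markov_operatorD(4)[OF Y_markov[OF b] G]
  let ?s = "\<lambda>x. \<gamma> / \<beta> * Y \<beta> u x + (1 - \<gamma> / \<beta>) * Y \<beta> (Y \<gamma> u) x"
  have s: "?s \<in> L2 M" by (intro L2_add L2_scale Yu YG)
  have "AE x in M. Y \<gamma> u x = ?s x"
    using R_resolvent[OF b \<gamma> u] L2_bounded_operatorD(3)[OF R_bounded[OF b] R_L2[OF \<gamma> u], of \<gamma>]
  proof eventually_elim
    case (elim x)
    have "Y \<beta> (Y \<gamma> u) x = \<beta> * (\<gamma> * R \<beta> (R \<gamma> u) x)" using elim(2) by (simp add: Y_def[abs_def])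
    moreover have "(1 - \<gamma> / \<beta>) * (\<beta> * z) = (\<beta> - \<gamma>) * z" "\<gamma> / \<beta> * (\<beta> * z) = \<gamma> * z" for z
      using b by (simp_all add: field_simps)
    moreover have "Y \<gamma> u x = \<gamma> * R \<beta> u x + (\<beta> - \<gamma>) * (\<gamma> * R \<beta> (R \<gamma> u) x)"
      unfolding Y_def elim(1) by (simp add: algebra_simps)
    ultimately show ?case by (simp only: Y_def[of \<beta> u x])
  qed
  from L2_bounded_operator_cong[OF Nb G s this]
    L2_bounded_operatorD(2)[OF Nb L2_scale[OF Yu, of "\<gamma> / \<beta>"] L2_scale[OF YG, of "1 - \<gamma> / \<beta>"]]
    L2_bounded_operatorD(3)[OF Nb Yu, of "\<gamma> / \<beta>"] L2_bounded_operatorD(3)[OF Nb YG, of "1 - \<gamma> / \<beta>"]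
  show "AE x in M. (Y \<beta> ^^ n) (Y \<gamma> u) x
    = (1 - (1 - \<gamma> / \<beta>)) * (Y \<beta> ^^ Suc n) u x + (1 - \<gamma> / \<beta>) * (Y \<beta> ^^ Suc n) (Y \<gamma> u) x"
    by eventually_elim (simp add: funpow_swap1)
qed

lemma Y_unit_recursion:
  assumes \<gamma>: "0 < \<gamma>" and \<beta>: "\<gamma> \<le> \<beta>"
  shows "AE x in M. \<forall>n. unit_image M (\<lambda>u. (Y \<beta> ^^ n) (Y \<gamma> u)) x
    = (1 - (1 - \<gamma> / \<beta>)) * unit_image M (Y \<beta> ^^ Suc n) x + (1 - \<gamma> / \<beta>) * unit_image M (\<lambda>u. (Y \<beta> ^^ Suc n) (Y \<gamma> u)) x"
proof -
  have b: "0 < \<beta>" using assms by simp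
  note N = markov_operator_funpow[OF Y_markov[OF b]]
  note NG = markov_operator_compose[OF N Y_markov[OF \<gamma>]]
  have r: "AE x in M. \<forall>k n. (Y \<beta> ^^ n) (Y \<gamma> (\<phi> k)) x
    = (1 - (1 - \<gamma> / \<beta>)) * (Y \<beta> ^^ Suc n) (\<phi> k) x + (1 - \<gamma> / \<beta>) * (Y \<beta> ^^ Suc n) (Y \<gamma> (\<phi> k)) x"
    unfolding AE_all_countable[of "\<lambda>k x. \<forall>n. P k n x" for P] using Y_recursion[OF assms phi_L2] by blast
  have l1: "AE x in M. \<forall>n. (\<lambda>k. (Y \<beta> ^^ n) (\<phi> k) x) \<longlonglongrightarrow> unit_image M (Y \<beta> ^^ n) x"
    unfolding AE_all_countable using unit_image_limit[OF N] by (auto elim: eventually_mono)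
  have l2: "AE x in M. \<forall>n. (\<lambda>k. (Y \<beta> ^^ n) (Y \<gamma> (\<phi> k)) x) \<longlonglongrightarrow> unit_image M (\<lambda>u. (Y \<beta> ^^ n) (Y \<gamma> u)) x"
    unfolding AE_all_countable using unit_image_limit[OF NG] by (auto elim: eventually_mono)
  from r l1 l2 show ?thesis
  proof eventually_elim
    case (elim x)
    show ?case
    proof
      fix n
      have "(\<lambda>k. (1 - (1 - \<gamma> / \<beta>)) * (Y \<beta> ^^ Suc n) (\<phi> k) x + (1 - \<gamma> / \<beta>) * (Y \<beta> ^^ Suc n) (Y \<gamma> (\<phi> k)) x)
        \<longlonglongrightarrow> (1 - (1 - \<gamma> / \<beta>)) * unit_image M (Y \<beta> ^^ Suc n) x + (1 - \<gamma> / \<beta>) * unit_image M (\<lambda>u. (Y \<beta> ^^ Suc n) (Y \<gamma> u)) x"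
        using elim(2,3) by (intro tendsto_intros) blast+
      moreover have "(\<lambda>k. (Y \<beta> ^^ n) (Y \<gamma> (\<phi> k)) x)
        = (\<lambda>k. (1 - (1 - \<gamma> / \<beta>)) * (Y \<beta> ^^ Suc n) (\<phi> k) x + (1 - \<gamma> / \<beta>) * (Y \<beta> ^^ Suc n) (Y \<gamma> (\<phi> k)) x)"
        by (rule ext) (rule elim(1)[rule_format])
      ultimately have "(\<lambda>k. (Y \<beta> ^^ n) (Y \<gamma> (\<phi> k)) x)
        \<longlonglongrightarrow> (1 - (1 - \<gamma> / \<beta>)) * unit_image M (Y \<beta> ^^ Suc n) x + (1 - \<gamma> / \<beta>) * unit_image M (\<lambda>u. (Y \<beta> ^^ Suc n) (Y \<gamma> u)) x"
        by (rule ssubst[rotated])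
      then show "unit_image M (\<lambda>u. (Y \<beta> ^^ n) (Y \<gamma> u)) x
        = (1 - (1 - \<gamma> / \<beta>)) * unit_image M (Y \<beta> ^^ Suc n) x + (1 - \<gamma> / \<beta>) * unit_image M (\<lambda>u. (Y \<beta> ^^ Suc n) (Y \<gamma> u)) x"
        using elim(3) LIMSEQ_unique by blast
    qed
  qed
qed

text \<open>
  The geometric recursion holds pointwise with $a_n = M^n1$ and $b_n = (M^n\gamma K_\gamma)1$, where
  $M = \beta K_\beta$; here $b_0 = \gamma K_\gamma1$.
\<close>

lemma Y_unit_bounds:
  assumes \<gamma>: "0 < \<gamma>" and \<beta>: "\<gamma> < \<beta>"
  shows "AE x in M. (\<forall>n. (1 - (1 - \<gamma> / \<beta>) ^ n) * unit_image M (Y \<beta> ^^ n) x \<le> unit_image M (Y \<gamma>) x)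
    \<and> (unit_image M (Y \<gamma>) x = 1 \<longrightarrow> (\<forall>n. unit_image M (Y \<beta> ^^ n) x = 1))"
proof -
  have b: "0 < \<beta>" using assms by simp
  have q: "0 < 1 - \<gamma> / \<beta>" "1 - \<gamma> / \<beta> < 1" using assms b by (simp_all add: field_simps)
  note N = markov_operator_funpow[OF Y_markov[OF b]]
  note NG = markov_operator_compose[OF N Y_markov[OF \<gamma>]]
  have "AE x in M. \<forall>n. 0 \<le> unit_image M (\<lambda>u. (Y \<beta> ^^ n) (Y \<gamma> u)) x \<and> unit_image M (\<lambda>u. (Y \<beta> ^^ n) (Y \<gamma> u)) x \<le> 1"
    unfolding AE_all_countable using unit_image_limit[OF NG] by (auto elim: eventually_mono)
  with Y_unit_recursion[OF \<gamma> less_imp_le[OF \<beta>]] unit_image_funpow[OF Y_markov[OF b]] show ?thesis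
  proof eventually_elim
    case (elim x)
    let ?a = "\<lambda>n. unit_image M (Y \<beta> ^^ n) x" and ?b = "\<lambda>n. unit_image M (\<lambda>u. (Y \<beta> ^^ n) (Y \<gamma> u)) x"
    have b0: "?b 0 = unit_image M (Y \<gamma>) x" by simp
    have rec: "?b n = (1 - (1 - \<gamma> / \<beta>)) * ?a (Suc n) + (1 - \<gamma> / \<beta>) * ?b (Suc n)" for n
      using elim(1) by blast
    show ?case
    proof (intro conjI allI impI)
      show "(1 - (1 - \<gamma> / \<beta>) ^ n) * ?a n \<le> unit_image M (Y \<gamma>) x" for n
        unfolding b0[symmetric] by (rule geometric_lower_bound[of ?b "1 - \<gamma> / \<beta>" ?a, OF rec]) (use q elim in auto)
      show "?a n = 1" if "unit_image M (Y \<gamma>) x = 1" for n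
      proof (cases n)
        case (Suc m)
        show ?thesis
          unfolding Suc by (rule geometric_equality[of ?b "1 - \<gamma> / \<beta>" ?a, OF rec q]) (use elim that b0 in auto)
      qed (use elim in simp)
    qed
  qed
qed

text \<open>
  Let $\beta = 2m/t$ and $M = \beta K_\beta$. The Poisson mixture at time \<open>t\<close> then has
  mean \<open>2m\<close>: terms with index below \<open>m\<close> have total weight at most
  $(2/e)^m$, and the others contribute at most $M^m1$. In turn $M^m1$ is bounded by $\gamma
  K_\gamma1/(1-(1-\gamma/\beta)^m)$, where $(1-\gamma/\beta)^m \le e^{-\gamma m/\beta} = e^{-\gamma
  t/2}$. Let $m\to\infty$.
\<close>

lemma T_unit_le:
  assumes t: "0 < t" and \<gamma>: "0 < \<gamma>"
  shows "AE x in M. (1 - exp (- (\<gamma> * t / 2))) * unit_image M (T t) x \<le> unit_image M (Y \<gamma>) x"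
proof -
  let ?e = "1 - exp (- (\<gamma> * t / 2))" and ?\<kappa> = "unit_image M (Y \<gamma>)"
  have e: "0 < ?e" using t \<gamma> by simp
  \<comment> \<open>The shift by \<open>m0\<close> ensures that the Yosida parameter exceeds \<open>\<gamma>\<close> from the start.\<close>
  obtain m0 :: nat where m0: "\<gamma> * t / 2 < real m0" using reals_Archimedean2 by blast
  define m where "m n = n + m0" for n :: nat
  define b where "b n = 2 * real (m n) / t" for n
  have m_gt: "\<gamma> * t / 2 < real (m n)" for n using m0 by (simp add: m_def)
  have b_gt: "\<gamma> < b n" for n using m_gt[of n] t by (simp add: b_def field_simps)
  have b_pos: "0 < b n" for n using b_gt[of n] \<gamma> by simp
  have bt: "b n * t = 2 * real (m n)" for n using t by (simp add: b_def)
  have b_top: "filterlim b at_top sequentially"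
  proof -
    have "filterlim (\<lambda>n. (2 / t) * real (n + m0)) at_top sequentially"
      using t by (intro filterlim_tendsto_pos_mult_at_top[OF tendsto_const]
          filterlim_compose[OF filterlim_real_sequentially] filterlim_add_const_nat_at_top) auto
    then show ?thesis by (simp add: b_def[abs_def] m_def mult.commute[of _ "1/t"] field_simps)
  qed
  have "AE x in M. T t (\<phi> k) x \<le> ?\<kappa> x / ?e" for k
  proof (rule L2_limit_le[where u="\<lambda>n. poisson_op M (Y (b n)) (b n * t) (\<phi> k)"
        and g="\<lambda>n x. (2 * exp (-1)) ^ (m n) + ?\<kappa> x / ?e"])
    show "(\<lambda>n. L2_norm M (\<lambda>x. poisson_op M (Y (b n)) (b n * t) (\<phi> k) x - T t (\<phi> k) x)) \<longlonglongrightarrow> 0"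
      by (rule T_limit[OF less_imp_le[OF t] phi_L2 b_top b_pos])
    show "T t (\<phi> k) \<in> L2 M" by (rule C0_semigroupD(2)[OF T_semigroup less_imp_le[OF t] phi_L2])
    show "poisson_op M (Y (b n)) (b n * t) (\<phi> k) \<in> L2 M" for n
      using b_pos[of n] t by (intro markov_operatorD(4)[OF poisson_op_markov[OF Y_markov]] phi_L2) auto
    show "AE x in M. (\<lambda>n. (2 * exp (-1)) ^ (m n) + ?\<kappa> x / ?e) \<longlonglongrightarrow> ?\<kappa> x / ?e"
    proof (intro always_eventually allI)
      fix x
      have "2 < exp (1::real)" using exp_lower_Taylor_quadratic[of "1::real"] by simp
      then have "2 * exp (-1::real) < 1" by (simp add: exp_minus field_simps)
      then have "(\<lambda>n. (2 * exp (-1::real)) ^ n) \<longlonglongrightarrow> 0" by (intro LIMSEQ_realpow_zero) auto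
      then have "(\<lambda>n. (2 * exp (-1::real)) ^ (m n)) \<longlonglongrightarrow> 0" unfolding m_def by (rule LIMSEQ_ignore_initial_segment)
      from tendsto_add[OF this tendsto_const[of "?\<kappa> x / ?e"]]
      show "(\<lambda>n. (2 * exp (-1)) ^ (m n) + ?\<kappa> x / ?e) \<longlonglongrightarrow> ?\<kappa> x / ?e" by simp
    qed
    fix n
    let ?A = "Y (b n)" and ?p = "poisson_weight (b n * t)"
    have s: "0 \<le> b n * t" using b_pos[of n] t by simp
    note A = Y_markov[OF b_pos[of n]]
    note N = markov_operator_funpow[OF A]
    have tail: "AE x in M. j \<ge> m n \<longrightarrow> (?A ^^ j) (\<phi> k) x \<le> unit_image M (?A ^^ m n) x" for j
    proof (cases "j \<ge> m n")
      case True
      then have j: "(?A ^^ j) (\<phi> k) = (?A ^^ m n) ((?A ^^ (j - m n)) (\<phi> k))"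
        by (metis comp_apply funpow_add le_add_diff_inverse)
      have "AE x in M. (?A ^^ m n) ((?A ^^ (j - m n)) (\<phi> k)) x \<le> unit_image M (?A ^^ m n) x"
        by (rule markov_le_unit_image[OF N markov_operatorD(4)[OF N phi_L2] markov_operatorD(3)[OF N phi_L2 phi_unit]])
      then show ?thesis unfolding j by eventually_elim simp
    qed simp
    have tail': "AE x in M. \<forall>j\<ge>m n. (?A ^^ j) (\<phi> k) x \<le> unit_image M (?A ^^ m n) x"
      using tail by (simp add: AE_all_countable)
    have unit: "AE x in M. \<forall>j. (?A ^^ j) (\<phi> k) x \<le> 1"
      unfolding AE_all_countable using markov_operatorD(3)[OF N phi_L2 phi_unit] by (auto elim: eventually_mono)
    show "AE x in M. poisson_op M ?A (b n * t) (\<phi> k) x \<le> (2 * exp (-1)) ^ (m n) + ?\<kappa> x / ?e"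
    proof (rule L2_limit_le[OF poisson_partial_L2[OF A phi_L2] _ poisson_op_limit[OF A s phi_L2]])
      show "poisson_op M ?A (b n * t) (\<phi> k) \<in> L2 M"
        by (rule markov_operatorD(4)[OF poisson_op_markov[OF A s] phi_L2])
      show "AE x in M. (\<lambda>N. (2 * exp (-1)) ^ (m n) + ?\<kappa> x / ?e) \<longlonglongrightarrow> (2 * exp (-1)) ^ (m n) + ?\<kappa> x / ?e" by simp
      fix J
      show "AE x in M. (\<Sum>j<J. ?p j * (?A ^^ j) (\<phi> k) x) \<le> (2 * exp (-1)) ^ (m n) + ?\<kappa> x / ?e"
        using tail' unit Y_unit_bounds[OF \<gamma> b_gt[of n]] unit_image_funpow[OF A]
      proof eventually_elim
        case (elim x)
        let ?a = "unit_image M (?A ^^ m n) x"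
        have a: "0 \<le> ?a" using elim(4) by blast
        have p0: "0 \<le> ?p j" for j by (rule poisson_weight_nonneg[OF s])
        have "(\<Sum>j<J. ?p j * (?A ^^ j) (\<phi> k) x) \<le> (\<Sum>j<J. (if j < m n then ?p j else 0) + ?p j * ?a)"
        proof (rule sum_mono)
          fix j
          show "?p j * (?A ^^ j) (\<phi> k) x \<le> (if j < m n then ?p j else 0) + ?p j * ?a"
          proof (cases "j < m n")
            case True
            have "?p j * (?A ^^ j) (\<phi> k) x \<le> ?p j * 1" using elim(2) p0 by (intro mult_left_mono) auto
            then show ?thesis using True mult_nonneg_nonneg[OF p0[of j] a] by simp
          next
            case False
            then show ?thesis using elim(1) p0 by (auto intro!: mult_left_mono)
          qed
        qed
        also have "\<dots> = (\<Sum>j<J. if j < m n then ?p j else 0) + (\<Sum>j<J. ?p j) * ?a"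
          by (simp add: sum.distrib sum_distrib_right)
        also have "\<dots> \<le> (\<Sum>j<m n. ?p j) + 1 * ?a"
        proof (intro add_mono mult_right_mono a)
          have "(\<Sum>j<J. if j < m n then ?p j else 0) = (\<Sum>j\<in>{..<J} \<inter> {..<m n}. ?p j)"
            by (subst sum.inter_restrict) (auto intro: sum.cong)
          also have "\<dots> \<le> (\<Sum>j<m n. ?p j)" by (rule sum_mono2) (auto simp: p0)
          finally show "(\<Sum>j<J. if j < m n then ?p j else 0) \<le> (\<Sum>j<m n. ?p j)" .
          show "(\<Sum>j<J. ?p j) \<le> 1"
            using sum_le_suminf[OF sums_summable[OF sums_poisson_weight], of "{..<J}"] p0
              sums_unique[OF sums_poisson_weight] by simp
        qed
        also have "(\<Sum>j<m n. ?p j) \<le> (2 * exp (-1)) ^ (m n)" unfolding bt by (rule poisson_tail)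
        also have "1 * ?a \<le> ?\<kappa> x / ?e"
        proof -
          have "(1 - \<gamma> / b n) ^ m n \<le> exp (- (\<gamma> / b n)) ^ m n"
            using exp_ge_add_one_self[of "- (\<gamma> / b n)"] b_gt[of n] b_pos[of n] by (intro power_mono) (auto simp: field_simps)
          also have "\<dots> = exp (- (\<gamma> * t / 2))"
          proof -
            have "real (m n) * (\<gamma> / b n) = \<gamma> * t / 2"
              using bt[of n] b_pos[of n] t by (simp add: field_simps)
            then show ?thesis by (simp flip: exp_of_nat_mult)
          qed
          finally have "?e * ?a \<le> (1 - (1 - \<gamma> / b n) ^ m n) * ?a" using a by (intro mult_right_mono) auto
          also have "\<dots> \<le> ?\<kappa> x" using elim(3) by blast
          finally show ?thesis using e by (simp add: field_simps)
        qed
        finally show ?case by simp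
      qed
    qed
  qed
  then have "AE x in M. \<forall>k. T t (\<phi> k) x \<le> ?\<kappa> x / ?e" by (simp add: AE_all_countable)
  with unit_image_limit[OF T_markov[OF less_imp_le[OF t]]] show ?thesis
  proof eventually_elim
    case (elim x)
    have "unit_image M (T t) x \<le> ?\<kappa> x / ?e" using elim by (auto intro: LIMSEQ_le_const2)
    then show ?case using e by (simp add: field_simps)
  qed
qed

text \<open>
  Put $f = \gamma K_\gamma\varphi_k$. By the geometric recursion each application of $M = \beta
  K_\beta$ lowers \<open>f\<close> by at most $\gamma/\beta$, so the Poisson mixture, which has mean
  $\beta t$, lowers it by at most $\gamma t$. This bound does not depend on \<open>\<beta>\<close>
  and passes to the limit.
\<close>

lemma T_unit_ge:
  assumes t: "0 < t" and \<gamma>: "0 < \<gamma>"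
  shows "AE x in M. unit_image M (Y \<gamma>) x - \<gamma> * t \<le> unit_image M (T t) x"
proof -
  define b where "b n = real (Suc n) + \<gamma>" for n
  have b_ge: "\<gamma> \<le> b n" and b_pos: "0 < b n" for n using \<gamma> by (auto simp: b_def)
  have b_top: "filterlim b at_top sequentially"
    unfolding b_def by (rule filterlim_at_top_mono[OF HY.filterlim_Suc_at_top]) (use \<gamma> in auto)
  note G = Y_markov[OF \<gamma>]
  have "AE x in M. Y \<gamma> (\<phi> k) x - \<gamma> * t \<le> unit_image M (T t) x" for k
  proof -
    let ?f = "Y \<gamma> (\<phi> k)"
    have f: "?f \<in> L2 M" by (rule markov_operatorD(4)[OF G phi_L2])
    have f01: "AE x in M. 0 \<le> ?f x \<and> ?f x \<le> 1" by (rule markov_operatorD(3)[OF G phi_L2 phi_unit])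
    have "AE x in M. ?f x - \<gamma> * t \<le> T t ?f x"
    proof (rule L2_limit_ge[where u="\<lambda>n. poisson_op M (Y (b n)) (b n * t) ?f" and g="\<lambda>n x. ?f x - \<gamma> * t"])
      show "(\<lambda>n. L2_norm M (\<lambda>x. poisson_op M (Y (b n)) (b n * t) ?f x - T t ?f x)) \<longlonglongrightarrow> 0"
        by (rule T_limit[OF less_imp_le[OF t] f b_top b_pos])
      show "T t ?f \<in> L2 M" by (rule C0_semigroupD(2)[OF T_semigroup less_imp_le[OF t] f])
      show "poisson_op M (Y (b n)) (b n * t) ?f \<in> L2 M" for n
        using b_pos[of n] t by (intro markov_operatorD(4)[OF poisson_op_markov[OF Y_markov]] f) auto
      fix n
      let ?A = "Y (b n)" and ?p = "poisson_weight (b n * t)"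
      have s: "0 \<le> b n * t" using b_pos[of n] t by simp
      note A = Y_markov[OF b_pos[of n]]
      note N = markov_operator_funpow[OF A]
      have unit: "AE x in M. \<forall>j. (?A ^^ j) (\<phi> k) x \<le> 1"
        unfolding AE_all_countable using markov_operatorD(3)[OF N phi_L2 phi_unit] by (auto elim: eventually_mono)
      have nn: "AE x in M. \<forall>j. 0 \<le> (?A ^^ j) ?f x"
        unfolding AE_all_countable using markov_operatorD(3)[OF N f f01] by (auto elim: eventually_mono)
      have step: "AE x in M. \<forall>j. ?f x - real j * (\<gamma> / b n) \<le> (?A ^^ j) ?f x"
        using Y_recursion[OF \<gamma> b_ge[of n] phi_L2[of k]] unit nn
      proof eventually_elim
        case (elim x)
        have "(?A ^^ 0) ?f x - real j * (1 - (1 - \<gamma> / b n)) \<le> (?A ^^ j) ?f x" for j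
          by (rule geometric_step[of "\<lambda>j. (?A ^^ j) ?f x" _ "\<lambda>j. (?A ^^ j) (\<phi> k) x"])
            (use elim \<gamma> b_pos[of n] in auto)
        then show ?case by simp
      qed
      show "AE x in M. ?f x - \<gamma> * t \<le> poisson_op M ?A (b n * t) ?f x"
      proof (rule L2_limit_ge[OF poisson_partial_L2[OF A f] _ poisson_op_limit[OF A s f]])
        show "poisson_op M ?A (b n * t) ?f \<in> L2 M"
          by (rule markov_operatorD(4)[OF poisson_op_markov[OF A s] f])
        show "AE x in M. (\<Sum>j<J. ?p j) * ?f x - (\<Sum>j<J. real j * ?p j) * (\<gamma> / b n) \<le> (\<Sum>j<J. ?p j * (?A ^^ j) ?f x)" for J
          using step
        proof eventually_elim
          case (elim x)
          have "(\<Sum>j<J. ?p j) * ?f x - (\<Sum>j<J. real j * ?p j) * (\<gamma> / b n) = (\<Sum>j<J. ?p j * (?f x - real j * (\<gamma> / b n)))"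
            unfolding right_diff_distrib sum_subtractf sum_distrib_right by (simp only: mult_ac)
          also have "\<dots> \<le> (\<Sum>j<J. ?p j * (?A ^^ j) ?f x)"
            using elim poisson_weight_nonneg[OF s] by (intro sum_mono mult_left_mono) auto
          finally show ?case .
        qed
        show "AE x in M. (\<lambda>J. (\<Sum>j<J. ?p j) * ?f x - (\<Sum>j<J. real j * ?p j) * (\<gamma> / b n)) \<longlonglongrightarrow> ?f x - \<gamma> * t"
        proof (intro always_eventually allI)
          fix x
          have "(\<lambda>J. (\<Sum>j<J. ?p j) * ?f x - (\<Sum>j<J. real j * ?p j) * (\<gamma> / b n)) \<longlonglongrightarrow> 1 * ?f x - (b n * t) * (\<gamma> / b n)"
            using sums_poisson_weight[of "b n * t"] sums_poisson_mean[of "b n * t"] unfolding sums_def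
            by (intro tendsto_intros)
          then show "(\<lambda>J. (\<Sum>j<J. ?p j) * ?f x - (\<Sum>j<J. real j * ?p j) * (\<gamma> / b n)) \<longlonglongrightarrow> ?f x - \<gamma> * t"
            using b_pos[of n] by (simp add: mult.commute)
        qed
      qed
    qed simp
    with markov_le_unit_image[OF T_markov[OF less_imp_le[OF t]] f f01] show ?thesis by eventually_elim simp
  qed
  then have "AE x in M. \<forall>k. Y \<gamma> (\<phi> k) x - \<gamma> * t \<le> unit_image M (T t) x" by (simp add: AE_all_countable)
  with unit_image_limit[OF G] show ?thesis
  proof eventually_elim
    case (elim x)
    have "(\<lambda>k. Y \<gamma> (\<phi> k) x - \<gamma> * t) \<longlonglongrightarrow> unit_image M (Y \<gamma>) x - \<gamma> * t"
      using elim by (intro tendsto_intros) auto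
    then show ?case by (rule LIMSEQ_le_const2) (use elim in auto)
  qed
qed

text \<open>
  A sequence \<open>g\<close> of parameters below \<open>\<beta>\<close> that tends to zero
  suffices, so only countably many null sets occur. One direction uses a single parameter and large
  times, the other one a fixed time and the whole sequence.
\<close>

lemma yosida_unit_iff:
  assumes \<beta>: "0 < \<beta>"
  shows "AE x in M. (\<forall>k\<ge>1. unit_image M (T (real k)) x = 1) \<longleftrightarrow> (\<forall>n. unit_image M (Y \<beta> ^^ n) x = 1)"
proof -
  \<comment> \<open>The shift by \<open>2\<close> keeps every parameter strictly below \<open>\<beta>\<close>.\<close>
  define g where "g j = \<beta> / real (j + 2)" for j :: nat
  have g: "0 < g j" "g j < \<beta>" for j unfolding g_def using \<beta> by (simp_all add: pos_divide_less_eq del: of_nat_add)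
  have up: "AE x in M. \<forall>k::nat. k \<ge> 1 \<longrightarrow> (1 - exp (- (g 0 * real k / 2))) * unit_image M (T (real k)) x \<le> unit_image M (Y (g 0)) x"
    unfolding AE_all_countable
  proof
    show "AE x in M. k \<ge> 1 \<longrightarrow> (1 - exp (- (g 0 * real k / 2))) * unit_image M (T (real k)) x \<le> unit_image M (Y (g 0)) x" for k
      by (cases "k \<ge> 1") (use T_unit_le[of "real k" "g 0"] g in \<open>auto elim: eventually_mono\<close>)
  qed
  have low: "AE x in M. \<forall>k j. k \<ge> (1::nat) \<longrightarrow> unit_image M (Y (g j)) x - g j * real k \<le> unit_image M (T (real k)) x"
    unfolding AE_all_countable
  proof (intro allI)
    show "AE x in M. k \<ge> 1 \<longrightarrow> unit_image M (Y (g j)) x - g j * real k \<le> unit_image M (T (real k)) x" for k j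
      by (cases "k \<ge> 1") (use T_unit_ge[of "real k" "g j"] g in \<open>auto elim: eventually_mono\<close>)
  qed
  have bounds: "AE x in M. \<forall>j. (\<forall>n. (1 - (1 - g j / \<beta>) ^ n) * unit_image M (Y \<beta> ^^ n) x \<le> unit_image M (Y (g j)) x)
    \<and> (unit_image M (Y (g j)) x = 1 \<longrightarrow> (\<forall>n. unit_image M (Y \<beta> ^^ n) x = 1))"
    unfolding AE_all_countable[of "\<lambda>j x. (\<forall>n. P j n x) \<and> Q j x" for P Q] using Y_unit_bounds[OF g] by blast
  have le1: "AE x in M. \<forall>k::nat. unit_image M (T (real k)) x \<le> 1"
    unfolding AE_all_countable using unit_image_limit[OF T_markov] by (auto elim: eventually_mono)
  from up low bounds le1 unit_image_limit[OF Y_markov[OF g(1)[of 0]]] show ?thesis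
  proof eventually_elim
    case (elim x)
    show ?case
    proof
      assume one: "\<forall>k\<ge>1. unit_image M (T (real k)) x = 1"
      have "1 \<le> unit_image M (Y (g 0)) x"
      proof (rule LIMSEQ_le_const2)
        have "(\<lambda>k. exp (- (g 0 / 2 * real k))) \<longlonglongrightarrow> 0"
          using g(1)[of 0] by (intro filterlim_compose[OF exp_at_bot] filterlim_compose[OF filterlim_uminus_at_bot_at_top]
              filterlim_tendsto_pos_mult_at_top[OF tendsto_const] filterlim_real_sequentially) auto
        from tendsto_diff[OF tendsto_const[of 1] this]
        show "(\<lambda>k. 1 - exp (- (g 0 * real k / 2))) \<longlonglongrightarrow> 1" by simp
        show "\<exists>N. \<forall>k\<ge>N. 1 - exp (- (g 0 * real k / 2)) \<le> unit_image M (Y (g 0)) x"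
          using elim(1) one by (intro exI[of _ 1]) auto
      qed
      then have "unit_image M (Y (g 0)) x = 1" using elim(5) by simp
      then show "\<forall>n. unit_image M (Y \<beta> ^^ n) x = 1" using elim(3) by blast
    next
      assume one: "\<forall>n. unit_image M (Y \<beta> ^^ n) x = 1"
      have ge: "1 \<le> unit_image M (Y (g j)) x" for j
      proof (rule LIMSEQ_le_const2)
        have "(\<lambda>n. (1 - g j / \<beta>) ^ n) \<longlonglongrightarrow> 0"
          using g[of j] \<beta> by (intro LIMSEQ_realpow_zero) (auto simp: field_simps)
        from tendsto_diff[OF tendsto_const[of 1] this]
        show "(\<lambda>n. 1 - (1 - g j / \<beta>) ^ n) \<longlonglongrightarrow> 1" by simp
        show "\<exists>N. \<forall>n\<ge>N. 1 - (1 - g j / \<beta>) ^ n \<le> unit_image M (Y (g j)) x"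
          using elim(3) one by (metis mult.right_neutral)
      qed
      show "\<forall>k\<ge>1. unit_image M (T (real k)) x = 1"
      proof (intro allI impI)
        fix k :: nat assume k: "1 \<le> k"
        have "1 \<le> unit_image M (T (real k)) x"
        proof (rule LIMSEQ_le_const2)
          have "(\<lambda>j. \<beta> * (1 / real (j + 2)) * real k) \<longlonglongrightarrow> \<beta> * 0 * real k"
            by (intro tendsto_intros LIMSEQ_ignore_initial_segment[OF lim_1_over_n])
          from tendsto_diff[OF tendsto_const[of 1] this]
          show "(\<lambda>j. 1 - g j * real k) \<longlonglongrightarrow> 1" by (simp add: g_def)
          have "1 - g j * real k \<le> unit_image M (T (real k)) x" for j
          proof -
            have "unit_image M (Y (g j)) x - g j * real k \<le> unit_image M (T (real k)) x" using elim(2) k by blast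
            then show ?thesis using ge[of j] by linarith
          qed
          then show "\<exists>N. \<forall>j\<ge>N. 1 - g j * real k \<le> unit_image M (T (real k)) x" by blast
        qed
        then show "unit_image M (T (real k)) x = 1" using elim(4) by (simp add: antisym)
      qed
    qed
  qed
qed

text \<open>
  Multiples of \<open>t\<close> and integers are cofinal in each other, and $T_s1$ decreases in
  \<open>s\<close>.
\<close>

lemma time_unit_iff:
  assumes t: "0 < t"
  shows "AE x in M. (\<forall>k\<ge>1. unit_image M (T (real k)) x = 1) \<longleftrightarrow> (\<forall>n. unit_image M (T t ^^ n) x = 1)"
proof -
  have pow: "AE x in M. unit_image M (T t ^^ n) x = unit_image M (T (real n * t)) x" for n
  proof (rule unit_image_cong)
    fix u assume u: "u \<in> L2 M"
    show "AE x in M. (T t ^^ n) u x = T (real n * t) u x"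
    proof (induction n)
      case 0
      show ?case using C0_semigroupD(3)[OF T_semigroup u] by eventually_elim simp
    next
      case (Suc n)
      have nt: "0 \<le> real n * t" using t by simp
      have e: "real (Suc n) * t = t + real n * t" by (simp add: algebra_simps)
      have "AE x in M. T t ((T t ^^ n) u) x = T t (T (real n * t) u) x"
        by (rule L2_bounded_operator_cong[OF C0_semigroupD(1)[OF T_semigroup less_imp_le[OF t]] _ _ Suc])
          (use t u nt in \<open>auto intro: markov_operatorD(4)[OF markov_operator_funpow[OF T_markov]] C0_semigroupD(2)[OF T_semigroup]\<close>)
      with C0_semigroupD(4)[OF T_semigroup less_imp_le[OF t] nt u] show ?case
        unfolding e by eventually_elim simp
    qed
  qed
  then have pow': "AE x in M. \<forall>n. unit_image M (T t ^^ n) x = unit_image M (T (real n * t)) x" by (simp add: AE_all_countable)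
  have m1: "AE x in M. \<forall>k n. real k \<le> real n * t \<longrightarrow> unit_image M (T (real n * t)) x \<le> unit_image M (T (real k)) x"
    unfolding AE_all_countable
  proof (intro allI)
    show "AE x in M. real k \<le> real n * t \<longrightarrow> unit_image M (T (real n * t)) x \<le> unit_image M (T (real k)) x" for k n
      by (cases "real k \<le> real n * t") (use unit_image_antimono[OF T_markov_semigroup, of "real k" "real n * t"] in auto)
  qed
  have m2: "AE x in M. \<forall>k n. real n * t \<le> real k \<longrightarrow> unit_image M (T (real k)) x \<le> unit_image M (T (real n * t)) x"
    unfolding AE_all_countable
  proof (intro allI)
    show "AE x in M. real n * t \<le> real k \<longrightarrow> unit_image M (T (real k)) x \<le> unit_image M (T (real n * t)) x" for k n
      by (cases "real n * t \<le> real k") (use unit_image_antimono[OF T_markov_semigroup, of "real n * t" "real k"] t in auto)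
  qed
  have le1: "AE x in M. \<forall>k::nat. unit_image M (T (real k)) x \<le> 1"
    unfolding AE_all_countable using unit_image_limit[OF T_markov] by (auto elim: eventually_mono)
  from pow' m1 m2 le1 unit_image_funpow[OF T_markov[OF less_imp_le[OF t]]] show ?thesis
  proof eventually_elim
    case (elim x)
    show ?case
    proof
      assume one: "\<forall>k\<ge>1. unit_image M (T (real k)) x = 1"
      show "\<forall>n. unit_image M (T t ^^ n) x = 1"
      proof
        fix n
        obtain k :: nat where "real n * t < real k" using reals_Archimedean2 by blast
        then have "real n * t \<le> real (Suc k)" by simp
        then have "1 \<le> unit_image M (T t ^^ n) x" using elim(1,3) one by (metis Suc_eq_plus1 le_add2)
        then show "unit_image M (T t ^^ n) x = 1" using elim(5) by (simp add: antisym)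
      qed
    next
      assume one: "\<forall>n. unit_image M (T t ^^ n) x = 1"
      show "\<forall>k\<ge>1. unit_image M (T (real k)) x = 1"
      proof (intro allI impI)
        fix k :: nat
        obtain n :: nat where "real k / t < real n" using reals_Archimedean2 by blast
        then have "real k \<le> real n * t" using t by (simp add: field_simps)
        then have "1 \<le> unit_image M (T (real k)) x" using elim(1,2) one by metis
        then show "unit_image M (T (real k)) x = 1" using elim(4) by (simp add: antisym)
      qed
    qed
  qed
qed

lemma time_approx_jump: "time_approx M E t = jump_form M (1 / t) (T t)"
  by (simp add: time_approx_def jump_form_def)

lemma deny_yosida_jump: "deny_yosida_approx M E \<beta> = jump_form M \<beta> (Y \<beta>)"
  by (simp add: deny_yosida_approx_def jump_form_def Y_def[abs_def])

lemma conservative_space_time_approx: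
  assumes t: "0 < t"
  shows "AE x in M. x \<in> conservative_space M E \<longleftrightarrow> x \<in> conservative_space M (time_approx M E t)"
proof -
  have "0 < 1 / t" using t by simp
  from jump_form_conservative_space[OF T_markov[OF less_imp_le[OF t]] T_symmetric[OF less_imp_le[OF t]] this]
    conservative_space_iff[OF T_markov_semigroup] time_unit_iff[OF t]
  show ?thesis unfolding time_approx_jump by eventually_elim simp
qed

lemma conservative_space_deny_yosida:
  assumes \<beta>: "0 < \<beta>"
  shows "AE x in M. x \<in> conservative_space M E \<longleftrightarrow> x \<in> conservative_space M (deny_yosida_approx M E \<beta>)"
  using jump_form_conservative_space[OF Y_markov[OF \<beta>] Y_symmetric[OF \<beta>] \<beta>]
    conservative_space_iff[OF T_markov_semigroup] yosida_unit_iff[OF \<beta>]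
  unfolding deny_yosida_jump by eventually_elim simp

lemma approx_conservative_iff:
  "0 < t \<Longrightarrow> conservative M (time_approx M E t) \<longleftrightarrow> conservative M E"
  "0 < \<beta> \<Longrightarrow> conservative M (deny_yosida_approx M E \<beta>) \<longleftrightarrow> conservative M E"
proof -
  note c = conservative_iff_space(1)
  show "conservative M (time_approx M E t) \<longleftrightarrow> conservative M E" if t: "0 < t"
  proof -
    have "markov_semigroup (form_semigroup M (time_approx M E t))"
      unfolding time_approx_jump using t by (intro jump_form_markov T_markov T_symmetric) auto
    from c[OF this] c[OF T_markov_semigroup] show ?thesis
      using conservative_space_time_approx[OF t] by (auto elim: AE_mp)
  qed
  show "conservative M (deny_yosida_approx M E \<beta>) \<longleftrightarrow> conservative M E" if \<beta>: "0 < \<beta>"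
  proof -
    have "markov_semigroup (form_semigroup M (deny_yosida_approx M E \<beta>))"
      unfolding deny_yosida_jump by (rule jump_form_markov[OF Y_markov[OF \<beta>] Y_symmetric[OF \<beta>] \<beta>])
    from c[OF this] c[OF T_markov_semigroup] show ?thesis
      using conservative_space_deny_yosida[OF \<beta>] by (auto elim: AE_mp)
  qed
qed

lemma approx_dissipative_iff:
  "dissipative M E \<longleftrightarrow> \<not> conservative M E"
  "0 < t \<Longrightarrow> dissipative M (time_approx M E t) \<longleftrightarrow> \<not> conservative M E"
  "0 < \<beta> \<Longrightarrow> dissipative M (deny_yosida_approx M E \<beta>) \<longleftrightarrow> \<not> conservative M E"
proof -
  note d = conservative_iff_space(2)
  show "dissipative M E \<longleftrightarrow> \<not> conservative M E" by (rule d[OF T_markov_semigroup])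
  show "dissipative M (time_approx M E t) \<longleftrightarrow> \<not> conservative M E" if t: "0 < t"
  proof -
    have "markov_semigroup (form_semigroup M (time_approx M E t))"
      unfolding time_approx_jump using t by (intro jump_form_markov T_markov T_symmetric) auto
    from d[OF this] approx_conservative_iff(1)[OF t] show ?thesis by simp
  qed
  show "dissipative M (deny_yosida_approx M E \<beta>) \<longleftrightarrow> \<not> conservative M E" if \<beta>: "0 < \<beta>"
  proof -
    have "markov_semigroup (form_semigroup M (deny_yosida_approx M E \<beta>))"
      unfolding deny_yosida_jump by (rule jump_form_markov[OF Y_markov[OF \<beta>] Y_symmetric[OF \<beta>] \<beta>])
    from d[OF this] approx_conservative_iff(2)[OF \<beta>] show ?thesis by simp
  qed
qed

end

theorem theorem4p15:
  fixes M :: "'a::t2_space measure" and E :: "'a qform"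
  assumes "sigma_finite_measure M" and "radon_measure M" and "full_support M"
    and "dirichlet_form M E"
  shows
    "(\<forall>\<beta>>0. \<forall>t>0.
        ae_eq_set M (conservative_space M E) (conservative_space M (time_approx M E t)) \<and>
        ae_eq_set M (conservative_space M (time_approx M E t))
                    (conservative_space M (deny_yosida_approx M E \<beta>)) \<and>
        ae_eq_set M (dissipative_space M E) (dissipative_space M (time_approx M E t)) \<and>
        ae_eq_set M (dissipative_space M (time_approx M E t))
                    (dissipative_space M (deny_yosida_approx M E \<beta>)))
     \<and>
     ((conservative M E \<longleftrightarrow> (\<exists>t>0. conservative M (time_approx M E t))) \<and>
      (conservative M E \<longleftrightarrow> (\<forall>t>0. conservative M (time_approx M E t))) \<and>
      (conservative M E \<longleftrightarrow> (\<exists>\<beta>>0. conservative M (deny_yosida_approx M E \<beta>))) \<and>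
      (conservative M E \<longleftrightarrow> (\<forall>\<beta>>0. conservative M (deny_yosida_approx M E \<beta>))))
     \<and>
     ((dissipative M E \<longleftrightarrow> (\<exists>t>0. dissipative M (time_approx M E t))) \<and>
      (dissipative M E \<longleftrightarrow> (\<forall>t>0. dissipative M (time_approx M E t))) \<and>
      (dissipative M E \<longleftrightarrow> (\<exists>\<beta>>0. dissipative M (deny_yosida_approx M E \<beta>))) \<and>
      (dissipative M E \<longleftrightarrow> (\<forall>\<beta>>0. dissipative M (deny_yosida_approx M E \<beta>))))"
proof -
  interpret L2_dirichlet_form M E
    using assms(1,4)
    by (intro L2_dirichlet_form.intro L2_form.intro L2_form_axioms.intro L2_dirichlet_form_axioms.intro)
      (auto simp: dirichlet_form_def)
  have spaces: "ae_eq_set M (conservative_space M E) (conservative_space M (time_approx M E t)) \<and>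
        ae_eq_set M (conservative_space M (time_approx M E t)) (conservative_space M (deny_yosida_approx M E \<beta>)) \<and>
        ae_eq_set M (dissipative_space M E) (dissipative_space M (time_approx M E t)) \<and>
        ae_eq_set M (dissipative_space M (time_approx M E t)) (dissipative_space M (deny_yosida_approx M E \<beta>))"
    if "0 < \<beta>" "0 < t" for \<beta> t
  proof -
    note c = conservative_space_time_approx[OF that(2)] conservative_space_deny_yosida[OF that(1)]
    have "AE x in M. x \<in> conservative_space M (time_approx M E t) \<longleftrightarrow> x \<in> conservative_space M (deny_yosida_approx M E \<beta>)"
      using c by eventually_elim simp
    then show ?thesis
      using c(1) unfolding ae_eq_set_def dissipative_space_def by (auto elim: eventually_mono)
  qed
  have ex: "\<exists>r::real. 0 < r" by (rule exI[of _ 1]) simp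
  show ?thesis
  proof (intro conjI)
    show "\<forall>\<beta>>0. \<forall>t>0.
        ae_eq_set M (conservative_space M E) (conservative_space M (time_approx M E t)) \<and>
        ae_eq_set M (conservative_space M (time_approx M E t)) (conservative_space M (deny_yosida_approx M E \<beta>)) \<and>
        ae_eq_set M (dissipative_space M E) (dissipative_space M (time_approx M E t)) \<and>
        ae_eq_set M (dissipative_space M (time_approx M E t)) (dissipative_space M (deny_yosida_approx M E \<beta>))"
      by (intro allI impI spaces)
  qed (use approx_conservative_iff approx_dissipative_iff ex in blast)+
qed

end
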